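(* Let $\mathfrak h$ be a topological Lie algebra, $V$ a topological $\mathfrak h$-module, $\omega\in C^2(\mathfrak h,V)$, $G$ a connected Lie group with Lie algebra $\mathfrak g$, $\zeta:\mathfrak g\to\mathrm{ham}(\mathfrak h,\omega)$ a continuous Lie algebra homomorphism, and $J:\mathfrak g\to V_\omega$ a momentum map for $\zeta$, with $\tau=\tau_J$ and $\kappa(g)=g.J-J$. If $\rho_V$ is an abstract hamiltonian $G$-action for $\zeta$, then the adjoint action of $\mathfrak g$ on $\hat{\mathfrak g}_{\rm cen}=V^{\mathfrak h}\times_\tau\mathfrak g$ integrates to a smooth $G$-action, given by $$\widehat{\mathrm{Ad}}(g)(v,X):=\big(v+\kappa(g)(\mathrm{Ad}(g)X),\mathrm{Ad}(g)X\big)=\big(v-\kappa(g^{-1})(X),\mathrm{Ad}(g)X\big)$$ for $(v,X)\in\hat{\mathfrak g}_{\rm cen}$ and $g\in G$. With respect to this action, the momentum map $$\hat J:\hat{\mathfrak g}_{\rm cen}\to V,\qquad (v,X)\mapsto J(X)+v$$ is $G$-equivariant.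
   Context: Lie groups may be infinite-dimensional (modelled on locally convex spaces); $V$ is locally convex. Cochains are continuous Chevalley–Eilenberg cochains with differential $d_{\mathfrak h}$; $(d_{\mathfrak h}v)(\xi)=\xi.v$; $i_\xi$ is insertion in the first argument; $(\mathcal L_\xi\omega)(\eta,\nu)=\xi.\omega(\eta,\nu)-\omega([\xi,\eta],\nu)-\omega(\eta,[\xi,\nu])$. $\mathrm{sp}(\mathfrak h,\omega)=\{\xi\in\mathfrak h:\mathcal L_\xi\omega=0,\ i_\xi d_{\mathfrak h}\omega=0\}$; $\mathrm{ham}(\mathfrak h,\omega)=\{\xi\in\mathrm{sp}(\mathfrak h,\omega):(\exists v\in V)\ i_\xi\omega=d_{\mathfrak h}v\}$; $V_\omega=\{v\in V:(\exists\xi\in\mathrm{ham}(\mathfrak h,\omega))\ d_{\mathfrak h}v=i_\xi\omega\}$; $V^{\mathfrak h}=\{v\in V:\mathfrak h.v=0\}$. $\mathfrak g$ acts on $V$ by $X.v=\zeta(X).v$. A momentum map for $\zeta$ is a continuous linear map $J:\mathfrak g\to V_\omega$ with $d_{\mathfrak h}(J(X))=i_{\zeta(X)}\omega$ for all $X$. Put $\tau_J(X,Y)=X.J(Y)-J([X,Y])$, a $V^{\mathfrak h}$-valued $2$-cocycle on $\mathfrak g$. $V^{\mathfrak h}\times_\tau\mathfrak g$ has bracket $[(v,X),(w,Y)]=(\tau(X,Y),[X,Y])$; since $V^{\mathfrak h}$ is central, its adjoint action induces the action $\widehat{\mathrm{ad}}(Y)(v,X)=(\tau(Y,X),[Y,X])$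 of $\mathfrak g$ on it. An abstract hamiltonian $G$-action for $\zeta$ is a smooth linear action $\rho_V$ of $G$ on $V$ whose derived $\mathfrak g$-action is $X.v=\zeta(X).v$. $G$ acts on $C^1(\mathfrak g,V)$ by $(g.c)(Y)=g.c(\mathrm{Ad}(g)^{-1}Y)$; the map $\kappa(g)=g.J-J$ takes values in $C^1(\mathfrak g,V^{\mathfrak h})$. *)

theory Defs
  imports "HOL-Analysis.Analysis" "HOL-Algebra.Group"
begin

section \<open>Locally convex spaces and smooth maps\<close>

class real_tvs = real_vector + topological_ab_group_add +
  assumes tendsto_scaleR_Pair:
    "((\<lambda>p. fst p *\<^sub>R snd p) \<longlongrightarrow> a *\<^sub>R x) (nhds a \<times>\<^sub>F nhds x)"

class locally_convex_space = real_tvs + t2_space +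
  assumes convex_nhds_0:
    "open U \<Longrightarrow> 0 \<in> U \<Longrightarrow>
       \<exists>W. open W \<and> 0 \<in> W \<and> W \<subseteq> U \<and>
           (\<forall>x\<in>W. \<forall>y\<in>W. \<forall>u. 0 \<le> u \<and> u \<le> 1 \<longrightarrow> (1 - u) *\<^sub>R x + u *\<^sub>R y \<in> W)"

definition has_dirderiv ::
    "('a::real_vector \<Rightarrow> 'b::{real_vector,t2_space}) \<Rightarrow> 'a \<Rightarrow> 'a \<Rightarrow> 'b \<Rightarrow> bool" where
  "has_dirderiv f x h l \<longleftrightarrow>
     ((\<lambda>t::real. (1 / t) *\<^sub>R (f (x + t *\<^sub>R h) - f x)) \<longlongrightarrow> l) (at 0)"

definition dirderiv ::
    "('a::real_vector \<Rightarrow> 'b::{real_vector,t2_space}) \<Rightarrow> 'a \<Rightarrow> 'a \<Rightarrow> 'b" where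
  "dirderiv f x h = Lim (at 0) (\<lambda>t::real. (1 / t) *\<^sub>R (f (x + t *\<^sub>R h) - f x))"

text \<open>The $j$-th iterated directional derivative
  $(\partial_{h_{j-1}} \cdots \partial_{h_0} f)(x)$.  The directions form an infinite sequence of
  which only the first $j$ members matter, so that all orders live on one type.\<close>

primrec iter_dirderiv ::
    "('a::real_vector \<Rightarrow> 'b::{real_vector,t2_space}) \<Rightarrow> nat \<Rightarrow> (nat \<Rightarrow> 'a) \<Rightarrow> 'a \<Rightarrow> 'b" where
  "iter_dirderiv f 0 h x = f x"
| "iter_dirderiv f (Suc j) h x = dirderiv (iter_dirderiv f j h) x (h j)"

text \<open>Smoothness in the Michal--Bastiani sense (the standard notion for Lie groups modelled on
  locally convex spaces): all iterated directional derivatives exist and are jointly continuous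
  in the point and the directions.  Here \<open>E\<close> and \<open>F\<close> are linear subspaces, each with the subspace
  topology, and \<open>U\<close> is a relatively open subset of \<open>E\<close>; requiring the derivatives to lie in \<open>F\<close>
  says that the limits exist in \<open>F\<close>.  Continuity on \<open>U \<times> E\<^sup>\<nat>\<close> in the product topology amounts to
  continuity on \<open>U \<times> E\<^sup>j\<close>.\<close>

definition smooth_on ::
    "'a::{real_vector,topological_space} set \<Rightarrow> 'b::{real_vector,t2_space} set \<Rightarrow> 'a set
       \<Rightarrow> ('a \<Rightarrow> 'b) \<Rightarrow> bool" where
  "smooth_on E F U f \<longleftrightarrow>
     (\<forall>j. (\<forall>x\<in>U. \<forall>h. (\<forall>i. h i \<in> E) \<longrightarrow>
             iter_dirderiv f j h x \<in> F \<and>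
             (\<exists>l. has_dirderiv (iter_dirderiv f j h) x (h j) l)) \<and>
          continuous_on (U \<times> {h. \<forall>i. h i \<in> E}) (\<lambda>(x, h). iter_dirderiv f j h x))"

section \<open>Manifolds and Lie groups\<close>

text \<open>A manifold is modelled on the linear subspace \<open>model\<close> of the type \<open>'e\<close>.\<close>

record ('p, 'e) mfd =
  model :: "'e set"
  mtop :: "'p topology"
  atlas :: "('p set \<times> ('p \<Rightarrow> 'e)) set"

definition chart_inv :: "'p set \<times> ('p \<Rightarrow> 'e) \<Rightarrow> 'e \<Rightarrow> 'p" where
  "chart_inv c = inv_into (fst c) (snd c)"

definition manifold :: "('p, 'e::{real_vector,t2_space}) mfd \<Rightarrow> bool" where
  "manifold M \<longleftrightarrow>
     subspace (model M) \<and>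
     Hausdorff_space (mtop M) \<and>
     \<Union> (fst ` atlas M) = topspace (mtop M) \<and>
     (\<forall>(U, \<phi>)\<in>atlas M.
        openin (mtop M) U \<and>
        openin (top_of_set (model M)) (\<phi> ` U) \<and>
        homeomorphic_map (subtopology (mtop M) U) (top_of_set (\<phi> ` U)) \<phi>) \<and>
     (\<forall>(U, \<phi>)\<in>atlas M. \<forall>(W, \<psi>)\<in>atlas M.
        smooth_on (model M) (model M) (\<phi> ` (U \<inter> W)) (\<psi> \<circ> chart_inv (U, \<phi>)))"

definition vec_mfd :: "'e::topological_space set \<Rightarrow> ('e, 'e) mfd" where
  "vec_mfd E = \<lparr>model = E, mtop = top_of_set E, atlas = {(E, id)}\<rparr>"

definition prod_mfd :: "('p, 'e) mfd \<Rightarrow> ('q, 'f) mfd \<Rightarrow> ('p \<times> 'q, 'e \<times> 'f) mfd" where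
  "prod_mfd M N =
     \<lparr>model = model M \<times> model N,
      mtop = prod_topology (mtop M) (mtop N),
      atlas = {(U \<times> W, map_prod \<phi> \<psi>) |U \<phi> W \<psi>. (U, \<phi>) \<in> atlas M \<and> (W, \<psi>) \<in> atlas N}\<rparr>"

definition smooth_map ::
    "('p, 'e::{real_vector,topological_space}) mfd \<Rightarrow> ('q, 'f::{real_vector,t2_space}) mfd
       \<Rightarrow> ('p \<Rightarrow> 'q) \<Rightarrow> bool" where
  "smooth_map M N f \<longleftrightarrow>
     continuous_map (mtop M) (mtop N) f \<and>
     (\<forall>(U, \<phi>)\<in>atlas M. \<forall>(W, \<psi>)\<in>atlas N.
        smooth_on (model M) (model N) (\<phi> ` {p \<in> U. f p \<in> W}) (\<psi> \<circ> f \<circ> chart_inv (U, \<phi>)))"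

definition lie_group ::
    "('p, 'm) monoid_scheme \<Rightarrow> ('p, 'g::locally_convex_space) mfd \<Rightarrow> bool" where
  "lie_group G M \<longleftrightarrow>
     group G \<and>
     manifold M \<and> model M = UNIV \<and> topspace (mtop M) = carrier G \<and>
     smooth_map (prod_mfd M M) M (\<lambda>(g, h). g \<otimes>\<^bsub>G\<^esub> h) \<and>
     smooth_map M M (\<lambda>g. inv\<^bsub>G\<^esub> g)"

section \<open>The Lie algebra of a Lie group and the adjoint action\<close>

text \<open>The tangent space at the identity is identified with the model space \<open>'g\<close> by means of a
  chart \<open>c\<close> around the identity.\<close>

definition chart_at_one ::
    "('p, 'm) monoid_scheme \<Rightarrow> ('p, 'g) mfd \<Rightarrow> 'p set \<times> ('p \<Rightarrow> 'g) \<Rightarrow> bool" where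
  "chart_at_one G M c \<longleftrightarrow> c \<in> atlas M \<and> \<one>\<^bsub>G\<^esub> \<in> fst c"

text \<open>The left invariant vector field $X_l(p) = T_1(\lambda_p)X$ with value \<open>X\<close> at the identity,
  expressed in the chart \<open>c\<close>.\<close>

definition left_inv_field ::
    "('p, 'm) monoid_scheme \<Rightarrow> 'p set \<times> ('p \<Rightarrow> 'g::locally_convex_space) \<Rightarrow> 'g \<Rightarrow> 'g \<Rightarrow> 'g" where
  "left_inv_field G c X x =
     dirderiv (\<lambda>y. snd c (chart_inv c x \<otimes>\<^bsub>G\<^esub> chart_inv c y)) (snd c \<one>\<^bsub>G\<^esub>) X"

text \<open>$[X,Y] = [X_l,Y_l](1)$, where vector fields on an open subset of a locally convex space have
  the bracket $[\xi,\eta](x) = d\eta(x)(\xi(x)) - d\xi(x)(\eta(x))$.\<close>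

definition lie_bracket ::
    "('p, 'm) monoid_scheme \<Rightarrow> 'p set \<times> ('p \<Rightarrow> 'g::locally_convex_space) \<Rightarrow> 'g \<Rightarrow> 'g \<Rightarrow> 'g" where
  "lie_bracket G c X Y =
     (let e = snd c \<one>\<^bsub>G\<^esub>; Xl = left_inv_field G c X; Yl = left_inv_field G c Y
      in dirderiv Yl e (Xl e) - dirderiv Xl e (Yl e))"

definition Ad ::
    "('p, 'm) monoid_scheme \<Rightarrow> 'p set \<times> ('p \<Rightarrow> 'g::locally_convex_space) \<Rightarrow> 'p \<Rightarrow> 'g \<Rightarrow> 'g" where
  "Ad G c g X =
     dirderiv (\<lambda>x. snd c (g \<otimes>\<^bsub>G\<^esub> chart_inv c x \<otimes>\<^bsub>G\<^esub> inv\<^bsub>G\<^esub> g)) (snd c \<one>\<^bsub>G\<^esub>) X"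

definition smooth_linear_action ::
    "('p, 'm) monoid_scheme \<Rightarrow> ('p, 'g::locally_convex_space) mfd
       \<Rightarrow> 'e::{real_vector,t2_space} set \<Rightarrow> ('p \<Rightarrow> 'e \<Rightarrow> 'e) \<Rightarrow> bool" where
  "smooth_linear_action G M E \<rho> \<longleftrightarrow>
     (\<forall>g\<in>carrier G. \<forall>v\<in>E. \<rho> g v \<in> E) \<and>
     (\<forall>v\<in>E. \<rho> \<one>\<^bsub>G\<^esub> v = v) \<and>
     (\<forall>g\<in>carrier G. \<forall>h\<in>carrier G. \<forall>v\<in>E. \<rho> (g \<otimes>\<^bsub>G\<^esub> h) v = \<rho> g (\<rho> h v)) \<and>
     (\<forall>g\<in>carrier G. \<forall>v\<in>E. \<forall>w\<in>E. \<forall>a b.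
        \<rho> g (a *\<^sub>R v + b *\<^sub>R w) = a *\<^sub>R \<rho> g v + b *\<^sub>R \<rho> g w) \<and>
     smooth_map (prod_mfd M (vec_mfd E)) (vec_mfd E) (\<lambda>(g, v). \<rho> g v)"

text \<open>The action \<open>\<delta>\<close> of the Lie algebra is derived from the action \<open>\<rho>\<close> of the group:
  \<open>\<delta> X v\<close> is the tangent map at the identity of the orbit map of \<open>v\<close>, applied to \<open>X\<close>.\<close>

definition derived_action ::
    "('p, 'm) monoid_scheme \<Rightarrow> 'p set \<times> ('p \<Rightarrow> 'g::locally_convex_space)
       \<Rightarrow> 'e::{real_vector,t2_space} set \<Rightarrow> ('p \<Rightarrow> 'e \<Rightarrow> 'e) \<Rightarrow> ('g \<Rightarrow> 'e \<Rightarrow> 'e) \<Rightarrow> bool" where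
  "derived_action G c E \<rho> \<delta> \<longleftrightarrow>
     (\<forall>X. \<forall>v\<in>E. has_dirderiv (\<lambda>x. \<rho> (chart_inv c x) v) (snd c \<one>\<^bsub>G\<^esub>) X (\<delta> X v))"

section \<open>Topological Lie algebras, modules and cochains\<close>

definition topological_lie_algebra :: "('h::real_tvs \<Rightarrow> 'h \<Rightarrow> 'h) \<Rightarrow> bool" where
  "topological_lie_algebra br \<longleftrightarrow>
     bilinear br \<and>
     (\<forall>\<xi>. br \<xi> \<xi> = 0) \<and>
     (\<forall>\<xi> \<eta> \<nu>. br \<xi> (br \<eta> \<nu>) + br \<eta> (br \<nu> \<xi>) + br \<nu> (br \<xi> \<eta>) = 0) \<and>
     continuous_on UNIV (\<lambda>(\<xi>, \<eta>). br \<xi> \<eta>)"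

definition topological_module ::
    "('h::real_tvs \<Rightarrow> 'h \<Rightarrow> 'h) \<Rightarrow> ('h \<Rightarrow> 'v::locally_convex_space \<Rightarrow> 'v) \<Rightarrow> bool" where
  "topological_module br act \<longleftrightarrow>
     bilinear act \<and>
     (\<forall>\<xi> \<eta> v. act (br \<xi> \<eta>) v = act \<xi> (act \<eta> v) - act \<eta> (act \<xi> v)) \<and>
     continuous_on UNIV (\<lambda>(\<xi>, v). act \<xi> v)"

text \<open>$\omega \in C^2(\mathfrak h,V)$.  Insertion $i_\xi\omega$ in the first argument is the partial
  application \<open>\<omega> \<xi>\<close>.\<close>

definition cochain2 :: "('h::real_tvs \<Rightarrow> 'h \<Rightarrow> 'v::locally_convex_space) \<Rightarrow> bool" where
  "cochain2 \<omega> \<longleftrightarrow>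
     bilinear \<omega> \<and> (\<forall>\<xi>. \<omega> \<xi> \<xi> = 0) \<and> continuous_on UNIV (\<lambda>(\<xi>, \<eta>). \<omega> \<xi> \<eta>)"

text \<open>The Chevalley--Eilenberg differential in degrees $0$ and $2$.\<close>

definition d0 :: "('h \<Rightarrow> 'v \<Rightarrow> 'v) \<Rightarrow> 'v \<Rightarrow> 'h \<Rightarrow> 'v" where
  "d0 act v = (\<lambda>\<xi>. act \<xi> v)"

definition d2 ::
    "('h \<Rightarrow> 'h \<Rightarrow> 'h) \<Rightarrow> ('h \<Rightarrow> 'v::ab_group_add \<Rightarrow> 'v) \<Rightarrow> ('h \<Rightarrow> 'h \<Rightarrow> 'v)
       \<Rightarrow> 'h \<Rightarrow> 'h \<Rightarrow> 'h \<Rightarrow> 'v" where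
  "d2 br act \<omega> = (\<lambda>\<xi> \<eta> \<nu>.
     act \<xi> (\<omega> \<eta> \<nu>) - act \<eta> (\<omega> \<xi> \<nu>) + act \<nu> (\<omega> \<xi> \<eta>)
     - \<omega> (br \<xi> \<eta>) \<nu> + \<omega> (br \<xi> \<nu>) \<eta> - \<omega> (br \<eta> \<nu>) \<xi>)"

definition lie_deriv ::
    "('h \<Rightarrow> 'h \<Rightarrow> 'h) \<Rightarrow> ('h \<Rightarrow> 'v::ab_group_add \<Rightarrow> 'v) \<Rightarrow> 'h \<Rightarrow> ('h \<Rightarrow> 'h \<Rightarrow> 'v)
       \<Rightarrow> 'h \<Rightarrow> 'h \<Rightarrow> 'v" where
  "lie_deriv br act \<xi> \<omega> = (\<lambda>\<eta> \<nu>. act \<xi> (\<omega> \<eta> \<nu>) - \<omega> (br \<xi> \<eta>) \<nu> - \<omega> \<eta> (br \<xi> \<nu>))"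

definition sp ::
    "('h \<Rightarrow> 'h \<Rightarrow> 'h) \<Rightarrow> ('h \<Rightarrow> 'v::ab_group_add \<Rightarrow> 'v) \<Rightarrow> ('h \<Rightarrow> 'h \<Rightarrow> 'v) \<Rightarrow> 'h set" where
  "sp br act \<omega> =
     {\<xi>. lie_deriv br act \<xi> \<omega> = (\<lambda>\<eta> \<nu>. 0) \<and> d2 br act \<omega> \<xi> = (\<lambda>\<eta> \<nu>. 0)}"

definition ham ::
    "('h \<Rightarrow> 'h \<Rightarrow> 'h) \<Rightarrow> ('h \<Rightarrow> 'v::ab_group_add \<Rightarrow> 'v) \<Rightarrow> ('h \<Rightarrow> 'h \<Rightarrow> 'v) \<Rightarrow> 'h set" where
  "ham br act \<omega> = {\<xi> \<in> sp br act \<omega>. \<exists>v. \<omega> \<xi> = d0 act v}"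

definition ham_fun ::
    "('h \<Rightarrow> 'h \<Rightarrow> 'h) \<Rightarrow> ('h \<Rightarrow> 'v::ab_group_add \<Rightarrow> 'v) \<Rightarrow> ('h \<Rightarrow> 'h \<Rightarrow> 'v) \<Rightarrow> 'v set" where
  "ham_fun br act \<omega> = {v. \<exists>\<xi>\<in>ham br act \<omega>. d0 act v = \<omega> \<xi>}"

definition invariants :: "('h \<Rightarrow> 'v::zero \<Rightarrow> 'v) \<Rightarrow> 'v set" where
  "invariants act = {v. \<forall>\<xi>. act \<xi> v = 0}"

section \<open>Momentum maps and the central extension\<close>

definition ham_hom ::
    "('g::real_tvs \<Rightarrow> 'g \<Rightarrow> 'g) \<Rightarrow> ('h::real_tvs \<Rightarrow> 'h \<Rightarrow> 'h)
       \<Rightarrow> ('h \<Rightarrow> 'v::locally_convex_space \<Rightarrow> 'v) \<Rightarrow> ('h \<Rightarrow> 'h \<Rightarrow> 'v) \<Rightarrow> ('g \<Rightarrow> 'h) \<Rightarrow> bool" where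
  "ham_hom brg br act \<omega> \<zeta> \<longleftrightarrow>
     linear \<zeta> \<and> continuous_on UNIV \<zeta> \<and>
     (\<forall>X. \<zeta> X \<in> ham br act \<omega>) \<and>
     (\<forall>X Y. \<zeta> (brg X Y) = br (\<zeta> X) (\<zeta> Y))"

text \<open>\<open>E\<close> is the domain, a linear subspace of the type \<open>'e\<close> with the subspace topology.\<close>

definition momentum_map ::
    "('h::real_tvs \<Rightarrow> 'h \<Rightarrow> 'h) \<Rightarrow> ('h \<Rightarrow> 'v::locally_convex_space \<Rightarrow> 'v) \<Rightarrow> ('h \<Rightarrow> 'h \<Rightarrow> 'v)
       \<Rightarrow> 'e::{real_vector,topological_space} set \<Rightarrow> ('e \<Rightarrow> 'h) \<Rightarrow> ('e \<Rightarrow> 'v) \<Rightarrow> bool" where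
  "momentum_map br act \<omega> E \<zeta> J \<longleftrightarrow>
     (\<forall>X\<in>E. \<forall>Y\<in>E. \<forall>a b. J (a *\<^sub>R X + b *\<^sub>R Y) = a *\<^sub>R J X + b *\<^sub>R J Y) \<and>
     continuous_on E J \<and>
     (\<forall>X\<in>E. J X \<in> ham_fun br act \<omega>) \<and>
     (\<forall>X\<in>E. d0 act (J X) = \<omega> (\<zeta> X))"

definition mom_cocycle ::
    "('g \<Rightarrow> 'g \<Rightarrow> 'g) \<Rightarrow> ('h \<Rightarrow> 'v::ab_group_add \<Rightarrow> 'v) \<Rightarrow> ('g \<Rightarrow> 'h) \<Rightarrow> ('g \<Rightarrow> 'v)
       \<Rightarrow> 'g \<Rightarrow> 'g \<Rightarrow> 'v" where
  "mom_cocycle brg act \<zeta> J X Y = act (\<zeta> X) (J Y) - J (brg X Y)"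

definition cen_ext :: "('h \<Rightarrow> 'v::zero \<Rightarrow> 'v) \<Rightarrow> ('v \<times> 'g) set" where
  "cen_ext act = invariants act \<times> UNIV"

definition cen_bracket ::
    "('g \<Rightarrow> 'g \<Rightarrow> 'g) \<Rightarrow> ('g \<Rightarrow> 'g \<Rightarrow> 'v) \<Rightarrow> 'v \<times> 'g \<Rightarrow> 'v \<times> 'g \<Rightarrow> 'v \<times> 'g" where
  "cen_bracket brg \<tau> = (\<lambda>(v, X) (w, Y). (\<tau> X Y, brg X Y))"

text \<open>The adjoint action of the central extension, which factors through the quotient algebra;
  hence any lift of \<open>Y\<close>, such as \<open>(0, Y)\<close>, may be used.\<close>

definition ad_hat ::
    "('g \<Rightarrow> 'g \<Rightarrow> 'g) \<Rightarrow> ('g \<Rightarrow> 'g \<Rightarrow> 'v::zero) \<Rightarrow> 'g \<Rightarrow> 'v \<times> 'g \<Rightarrow> 'v \<times> 'g" where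
  "ad_hat brg \<tau> Y p = cen_bracket brg \<tau> (0, Y) p"

definition abstract_hamiltonian_action ::
    "('p, 'm) monoid_scheme \<Rightarrow> ('p, 'g::locally_convex_space) mfd \<Rightarrow> 'p set \<times> ('p \<Rightarrow> 'g)
       \<Rightarrow> ('h \<Rightarrow> 'v::locally_convex_space \<Rightarrow> 'v) \<Rightarrow> ('g \<Rightarrow> 'h) \<Rightarrow> ('p \<Rightarrow> 'v \<Rightarrow> 'v) \<Rightarrow> bool" where
  "abstract_hamiltonian_action G M c act \<zeta> \<rho> \<longleftrightarrow>
     smooth_linear_action G M UNIV \<rho> \<and>
     derived_action G c UNIV \<rho> (\<lambda>X v. act (\<zeta> X) v)"

text \<open>$\kappa(g) = g.J - J$ for the action $(g.c)(Y) = g.c(\mathrm{Ad}(g)^{-1}Y)$ on $1$-cochains.\<close>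

definition kappa ::
    "('p, 'm) monoid_scheme \<Rightarrow> 'p set \<times> ('p \<Rightarrow> 'g::locally_convex_space)
       \<Rightarrow> ('p \<Rightarrow> 'v \<Rightarrow> 'v::ab_group_add) \<Rightarrow> ('g \<Rightarrow> 'v) \<Rightarrow> 'p \<Rightarrow> 'g \<Rightarrow> 'v" where
  "kappa G c \<rho> J g Y = \<rho> g (J (inv_into UNIV (Ad G c g) Y)) - J Y"

definition Ad_hat ::
    "('p, 'm) monoid_scheme \<Rightarrow> 'p set \<times> ('p \<Rightarrow> 'g::locally_convex_space)
       \<Rightarrow> ('p \<Rightarrow> 'v \<Rightarrow> 'v::ab_group_add) \<Rightarrow> ('g \<Rightarrow> 'v) \<Rightarrow> 'p \<Rightarrow> 'v \<times> 'g \<Rightarrow> 'v \<times> 'g" where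
  "Ad_hat G c \<rho> J g = (\<lambda>(v, X). (v + kappa G c \<rho> J g (Ad G c g X), Ad G c g X))"

definition J_hat :: "('g \<Rightarrow> 'v) \<Rightarrow> 'v \<times> 'g \<Rightarrow> 'v::plus" where
  "J_hat J = (\<lambda>(v, X). J X + v)"

end

theory Submission
  imports Defs
begin

text \<open>
  Unfolding $\kappa$ gives
  \[\widehat{\mathrm{Ad}}(g)(v,X) = (v + g.J(X) - J(\mathrm{Ad}(g)X), \mathrm{Ad}(g)X),\]
  and everything follows from two facts about the connected group $G$: it fixes $V^{\mathfrak h}$
  pointwise (lemma \<open>rho_invariant\<close>), and the defect $g.J(X) - J(\mathrm{Ad}(g)X)$ lies in
  $V^{\mathfrak h}$ (lemma \<open>kappa_invariant\<close>).  The first component of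
  $\widehat{\mathrm{Ad}}$ is corrected by exactly this defect, so that $\hat J$ takes the value
  $g.J(X) + v = g.(J(X) + v)$ at $\widehat{\mathrm{Ad}}(g)(v,X)$, and multiplicativity and the two descriptions of
  $\widehat{\mathrm{Ad}}$ are short computations.

  Both facts are instances of one integration principle (lemma \<open>increment_in_subspace\<close>): if all
  derivatives of a smooth map $f : G \to V$ lie in a closed subspace $W$, then so do the increments
  $f(g) - f(1)$.  For the orbit map of $v \in V^{\mathfrak h}$ the derivatives vanish.  For
  $f(g) = g.J(\mathrm{Ad}(g)^{-1}Y)$ they are $g.\tau(X, \mathrm{Ad}(g)^{-1}Y)$, and $\tau$ takes values
  in $V^{\mathfrak h}$ because $\zeta(X)$ preserves $\omega$.

  The computation of these derivatives, and of the derived action of $\widehat{\mathrm{Ad}}$, needs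
  that $\mathrm{Ad}$ is smooth with derivative $X \mapsto [X, \cdot]$ at the identity (lemmas
  \<open>smooth_Ad\<close> and \<open>dirderiv_Ad\<close>).  The bracket is defined by left invariant vector fields,
  that is, by second derivatives of the multiplication $m$; it is matched with the derivative of
  $\mathrm{Ad}$ by differentiating $(ghg^{-1})g = gh$ twice and using that mixed second derivatives of
  $m$ commute.

  All this rests on differential calculus in locally convex spaces.  Its foundation is a mean value
  theorem (lemma \<open>increment_in_convex\<close>), proved by bisection: if the derivative of a curve stays in an
  open convex set, then so does its increment.  It yields the chain rule, the linearity and the
  symmetry of derivatives.  Higher derivatives of composites are controlled by observing that the maps
  $x \mapsto D^k g(p(x))(u_0(x), \dots, u_{k-1}(x))$ are closed under differentiation up to sums
  (lemma \<open>Ck_iter_compose\<close>).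
\<close>

section \<open>Products of locally convex spaces\<close>

text \<open>The group multiplication and the central extension $V^{\mathfrak h} \times \mathfrak g$ both live on
  product spaces, so the calculus below has to apply to products of locally convex spaces.\<close>

instance prod :: (topological_monoid_add, topological_monoid_add) topological_monoid_add
proof
  fix a b :: "'a \<times> 'b"
  have "((\<lambda>x. (fst (fst x) + fst (snd x), snd (fst x) + snd (snd x)))
          \<longlongrightarrow> (fst a + fst b, snd a + snd b)) (nhds (a, b))"
    by (intro tendsto_Pair tendsto_add tendsto_fst tendsto_snd
        filterlim_ident[of "nhds (a, b)", THEN tendsto_fst, simplified fst_conv]
         filterlim_ident[of "nhds (a, b)", THEN tendsto_snd, simplified snd_conv])
  then show "((\<lambda>x. fst x + snd x) \<longlongrightarrow> a + b) (nhds a \<times>\<^sub>F nhds b)"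
    by (simp add: nhds_prod plus_prod_def)
qed

instance prod :: (topological_group_add, topological_group_add) topological_group_add
proof
  fix a :: "'a \<times> 'b"
  have "((\<lambda>x. (- fst x, - snd x)) \<longlongrightarrow> (- fst a, - snd a)) (nhds a)"
    by (intro tendsto_Pair tendsto_minus tendsto_fst tendsto_snd filterlim_ident)
  then show "(uminus \<longlongrightarrow> - a) (nhds a)"
    by (simp add: uminus_prod_def[abs_def])
qed

instance prod :: (topological_ab_group_add, topological_ab_group_add) topological_ab_group_add ..

lemma tendsto_scaleR_tvs [tendsto_intros]:
  fixes g :: "'c \<Rightarrow> 'a::real_tvs"
  assumes "(f \<longlongrightarrow> a) F" "(g \<longlongrightarrow> x) F"
  shows "((\<lambda>t. f t *\<^sub>R g t) \<longlongrightarrow> a *\<^sub>R x) F"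
  using filterlim_compose[OF tendsto_scaleR_Pair[of a x] filterlim_Pair[OF assms]] by simp

instance prod :: (real_tvs, real_tvs) real_tvs
proof
  fix a :: real and x :: "'a \<times> 'b"
  have "((\<lambda>p. (fst p *\<^sub>R fst (snd p), fst p *\<^sub>R snd (snd p)))
          \<longlongrightarrow> (a *\<^sub>R fst x, a *\<^sub>R snd x)) (nhds (a, x))"
    by (intro tendsto_Pair tendsto_scaleR_tvs tendsto_fst tendsto_snd
        filterlim_ident[of "nhds (a, x)", THEN tendsto_fst, simplified fst_conv]
         filterlim_ident[of "nhds (a, x)", THEN tendsto_snd, simplified snd_conv])
  then show "((\<lambda>p. fst p *\<^sub>R snd p) \<longlongrightarrow> a *\<^sub>R x) (nhds a \<times>\<^sub>F nhds x)"
    by (simp add: nhds_prod scaleR_prod_def)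
qed

instance prod :: (locally_convex_space, locally_convex_space) locally_convex_space
proof
  fix U :: "('a \<times> 'b) set"
  assume "open U" "0 \<in> U"
  then obtain A B where A: "open A" "0 \<in> A" and B: "open B" "0 \<in> B" and AB: "A \<times> B \<subseteq> U"
    by (metis open_prod_elim zero_prod_def mem_Sigma_iff)
  obtain A' where A': "open A'" "0 \<in> A'" "A' \<subseteq> A"
      "\<And>x y u. x \<in> A' \<Longrightarrow> y \<in> A' \<Longrightarrow> 0 \<le> u \<Longrightarrow> u \<le> 1 \<Longrightarrow> (1 - u) *\<^sub>R x + u *\<^sub>R y \<in> A'"
    using convex_nhds_0[OF A] by metis
  obtain B' where B': "open B'" "0 \<in> B'" "B' \<subseteq> B"
      "\<And>x y u. x \<in> B' \<Longrightarrow> y \<in> B' \<Longrightarrow> 0 \<le> u \<Longrightarrow> u \<le> 1 \<Longrightarrow> (1 - u) *\<^sub>R x + u *\<^sub>R y \<in> B'"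
    using convex_nhds_0[OF B] by metis
  show "\<exists>W. open W \<and> 0 \<in> W \<and> W \<subseteq> U \<and>
           (\<forall>x\<in>W. \<forall>y\<in>W. \<forall>u. 0 \<le> u \<and> u \<le> 1 \<longrightarrow> (1 - u) *\<^sub>R x + u *\<^sub>R y \<in> W)"
    using A' B' AB by (intro exI[of _ "A' \<times> B'"]) (auto simp: open_Times zero_prod_def)
qed

section \<open>The mean value theorem in locally convex spaces\<close>

lemma open_shift:
  fixes S :: "'a::real_tvs set"
  assumes "open S"
  shows "open {y. y - a \<in> S}"
  using open_vimage[OF assms, of "\<lambda>y. y - a"] by (simp add: vimage_def continuous_on_diff)

lemma convex_nhd:
  fixes x :: "'a::locally_convex_space"
  assumes "open U" "x \<in> U"
  obtains C where "open C" "convex C" "x \<in> C" "C \<subseteq> U"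
proof -
  have "open {y. y + x \<in> U}" "0 \<in> {y. y + x \<in> U}"
    using open_shift[OF assms(1), of "- x"] assms(2) by auto
  from convex_nhds_0[OF this] obtain W where W: "open W" "0 \<in> W" "W \<subseteq> {y. y + x \<in> U}"
      "\<And>y z u. y \<in> W \<Longrightarrow> z \<in> W \<Longrightarrow> 0 \<le> u \<Longrightarrow> u \<le> 1 \<Longrightarrow> (1 - u) *\<^sub>R y + u *\<^sub>R z \<in> W"
    by metis
  show ?thesis
  proof (rule that)
    show "open {y. y - x \<in> W}" by (rule open_shift[OF W(1)])
    show "convex {y. y - x \<in> W}"
      unfolding convex_alt
    proof clarsimp
      fix y z and u :: real assume "y - x \<in> W" "z - x \<in> W" "0 \<le> u" "u \<le> 1"
      from W(4)[OF this] show "(1 - u) *\<^sub>R y + u *\<^sub>R z - x \<in> W"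
        by (simp add: algebra_simps)
    qed
    show "x \<in> {y. y - x \<in> W}" using W(2) by simp
    show "{y. y - x \<in> W} \<subseteq> U" using W(3) by auto
  qed
qed

text \<open>The slope of \<open>c\<close> over two adjacent intervals is a convex combination of the slopes over each of
  them, so that a bound by a convex set propagates from small intervals to large ones.\<close>

lemma slope_convex:
  fixes c :: "real \<Rightarrow> 'b::real_vector"
  assumes "convex C" "a < x" "x < b"
    and "(1 / (x - a)) *\<^sub>R (c x - c a) \<in> C" "(1 / (b - x)) *\<^sub>R (c b - c x) \<in> C"
  shows "(1 / (b - a)) *\<^sub>R (c b - c a) \<in> C"
proof -
  let ?u = "(x - a) / (b - a)" and ?v = "(b - x) / (b - a)"
  have "?u + ?v = 1" using assms(2,3) by (simp add: add_divide_distrib[symmetric])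
  then have "?u *\<^sub>R ((1 / (x - a)) *\<^sub>R (c x - c a)) + ?v *\<^sub>R ((1 / (b - x)) *\<^sub>R (c b - c x)) \<in> C"
    using assms by (intro convexD[OF assms(1)]) auto
  moreover have "?u *\<^sub>R ((1 / (x - a)) *\<^sub>R (c x - c a)) = (1 / (b - a)) *\<^sub>R (c x - c a)"
    "?v *\<^sub>R ((1 / (b - x)) *\<^sub>R (c b - c x)) = (1 / (b - a)) *\<^sub>R (c b - c x)"
    using less_imp_neq[OF assms(2)] less_imp_neq[OF assms(3)] by auto
  ultimately have "(1 / (b - a)) *\<^sub>R (c x - c a) + (1 / (b - a)) *\<^sub>R (c b - c x) \<in> C"
    by (simp only:)
  then show ?thesis by (simp add: scaleR_right_distrib[symmetric])
qed

text \<open>The mean value theorem.  Openness of \<open>C\<close> puts all sufficiently short difference quotients around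
  a given point into \<open>C\<close>; convexity glues them together by bisection of $[0,1]$.  This argument
  stays inside \<open>C\<close> and thus avoids the functionals of the Hahn--Banach theorem.\<close>

lemma increment_in_convex:
  fixes c :: "real \<Rightarrow> 'b::locally_convex_space"
  assumes "open C" "convex C"
    and D: "\<And>s. 0 \<le> s \<Longrightarrow> s \<le> 1 \<Longrightarrow> \<exists>l\<in>C. has_dirderiv c s 1 l"
  shows "c 1 - c 0 \<in> C"
proof -
  define P where "P a b \<longleftrightarrow> (a < b \<longrightarrow> (1 / (b - a)) *\<^sub>R (c b - c a) \<in> C)" for a b
  have "P 0 1"
  proof (rule Bolzano)
    show "(0::real) \<le> 1" by simp
    show "P a b" if "P a x" "P x b" "a \<le> x" "x \<le> b" for a x b
    proof -
      consider "a = x" | "x = b" | "a < x" "x < b" using \<open>a \<le> x\<close> \<open>x \<le> b\<close> by linarith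
      then show ?thesis
      proof cases
        case 3
        then show ?thesis
          using slope_convex[OF assms(2) 3, of c] that(1,2) by (simp add: P_def)
      qed (use that in \<open>simp_all add: P_def\<close>)
    qed
    fix x :: real assume "0 \<le> x" "x \<le> 1"
    from D[OF this] obtain l where "l \<in> C" and l: "has_dirderiv c x 1 l" by auto
    have "\<forall>\<^sub>F t in at 0. (1 / t) *\<^sub>R (c (x + t) - c x) \<in> C"
      using topological_tendstoD[OF l[unfolded has_dirderiv_def] assms(1) \<open>l \<in> C\<close>] by simp
    then obtain d where d: "d > 0" "\<And>t. t \<noteq> 0 \<Longrightarrow> \<bar>t\<bar> < d \<Longrightarrow> (1 / t) *\<^sub>R (c (x + t) - c x) \<in> C"
      unfolding eventually_at by (auto simp: dist_real_def)
    show "\<exists>d>0. \<forall>a b. a \<le> x \<and> x \<le> b \<and> b - a < d \<longrightarrow> P a b"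
    proof (intro exI[of _ d] conjI allI impI)
      fix a b assume ab: "a \<le> x \<and> x \<le> b \<and> b - a < d"
      have r: "(1 / (b - x)) *\<^sub>R (c b - c x) \<in> C" if "x < b"
      proof -
        have "b - x \<noteq> 0" "\<bar>b - x\<bar> < d" using that ab by linarith+
        from d(2)[OF this] show ?thesis by simp
      qed
      have l: "(1 / (x - a)) *\<^sub>R (c x - c a) \<in> C" if "a < x"
      proof -
        have "(1 / (a - x)) *\<^sub>R (c a - c x) = (1 / (x - a)) *\<^sub>R (c x - c a)"
        proof -
          have "1 / (a - x) = - (1 / (x - a))" by (simp add: minus_divide_right)
          moreover have "c a - c x = - (c x - c a)" by simp
          ultimately show ?thesis by (simp only: scaleR_minus_left scaleR_minus_right minus_minus)
        qed
        moreover have "a - x \<noteq> 0" "\<bar>a - x\<bar> < d" using that ab by linarith+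
        from d(2)[OF this] have "(1 / (a - x)) *\<^sub>R (c a - c x) \<in> C" by simp
        ultimately show ?thesis by simp
      qed
      consider "a = x" | "x = b" | "a < x" "x < b" using ab by linarith
      then show "P a b"
      proof cases
        case 3
        from slope_convex[OF assms(2) this l r] 3 show ?thesis by (simp add: P_def)
      qed (use l r in \<open>simp_all add: P_def\<close>)
    qed (rule d(1))
  qed
  then show ?thesis by (simp add: P_def)
qed

text \<open>For each convex neighbourhood \<open>N\<close> of $0$ the set $W + N$ is open and convex, hence contains the
  increment; a closed \<open>W\<close> is the intersection of these sets.\<close>

lemma increment_in_closed_subspace:
  fixes c :: "real \<Rightarrow> 'b::locally_convex_space"
  assumes W: "closed W" "subspace W"
    and D: "\<And>s. 0 \<le> s \<Longrightarrow> s \<le> 1 \<Longrightarrow> \<exists>l\<in>W. has_dirderiv c s 1 l"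
  shows "c 1 - c 0 \<in> W"
proof (rule ccontr)
  let ?z = "c 1 - c 0"
  assume z: "?z \<notin> W"
  have "open {n. ?z - n \<in> - W}"
    using open_vimage[OF open_Compl[OF W(1)], of "\<lambda>n. ?z - n"]
    by (simp add: vimage_def continuous_on_diff)
  moreover have "0 \<in> {n. ?z - n \<in> - W}" using z by simp
  ultimately obtain N where N: "open N" "convex N" "0 \<in> N" "N \<subseteq> {n. ?z - n \<in> - W}"
    by (rule convex_nhd)
  let ?C = "\<Union>w\<in>W. {y. y - w \<in> N}"
  have "open ?C" using open_shift[OF N(1)] by auto
  moreover have "convex ?C"
  proof (unfold convex_alt, clarsimp)
    fix y y' w w' and u :: real
    assume u: "0 \<le> u" "u \<le> 1" and w: "w \<in> W" "w' \<in> W" and y: "y - w \<in> N" "y' - w' \<in> N"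
    have "(1 - u) *\<^sub>R w + u *\<^sub>R w' \<in> W"
      using W(2) w by (intro subspace_add subspace_scale)
    moreover have "(1 - u) *\<^sub>R (y - w) + u *\<^sub>R (y' - w') \<in> N"
      using N(2) y u unfolding convex_alt by blast
    then have "((1 - u) *\<^sub>R y + u *\<^sub>R y') - ((1 - u) *\<^sub>R w + u *\<^sub>R w') \<in> N"
      by (simp add: algebra_simps)
    ultimately show "\<exists>x\<in>W. (1 - u) *\<^sub>R y + u *\<^sub>R y' - x \<in> N" by blast
  qed
  moreover have "\<exists>l\<in>?C. has_dirderiv c s 1 l" if "0 \<le> s" "s \<le> 1" for s
  proof -
    obtain l where "l \<in> W" "has_dirderiv c s 1 l" using D \<open>0 \<le> s\<close> \<open>s \<le> 1\<close> by blast
    moreover have "l - l \<in> N" using N(3) by simp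
    ultimately show ?thesis by blast
  qed
  ultimately have "?z \<in> ?C" by (rule increment_in_convex)
  then obtain w where "w \<in> W" "?z - w \<in> N" by blast
  with N(4) show False by auto
qed

section \<open>Directional derivatives\<close>

text \<open>A directional derivative is the velocity of the image of a straight line.  The rules for
  composite maps below are stated for arbitrary curves and specialize to lines by this equivalence.\<close>

lemma has_dirderiv_curve:
  "has_dirderiv f x h l \<longleftrightarrow> has_dirderiv (\<lambda>t::real. f (x + t *\<^sub>R h)) 0 1 l"
  by (simp add: has_dirderiv_def)

lemma has_dirderiv_unique: "has_dirderiv f x h l \<Longrightarrow> has_dirderiv f x h l' \<Longrightarrow> l = l'"
  unfolding has_dirderiv_def by (rule tendsto_unique[OF at_neq_bot])

lemma dirderiv_eqI: "has_dirderiv f x h l \<Longrightarrow> dirderiv f x h = l"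
  unfolding has_dirderiv_def dirderiv_def by (rule tendsto_Lim[OF at_neq_bot])

lemma tendsto_line:
  fixes x h :: "'a::real_tvs"
  shows "((\<lambda>t::real. x + t *\<^sub>R h) \<longlongrightarrow> x) (at 0)"
proof -
  have "((\<lambda>t::real. x + t *\<^sub>R h) \<longlongrightarrow> x + 0 *\<^sub>R h) (at 0)"
    by (intro tendsto_intros)
  then show ?thesis by simp
qed

lemma eventually_line_in:
  fixes x h :: "'a::real_tvs"
  assumes "open U" "x \<in> U"
  shows "\<forall>\<^sub>F t::real in at 0. x + t *\<^sub>R h \<in> U"
  using topological_tendstoD[OF tendsto_line assms] .

lemma has_dirderiv_cong_ev:
  assumes "\<forall>\<^sub>F t::real in at 0. f (x + t *\<^sub>R h) = g (x + t *\<^sub>R h)" "f x = g x"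
  shows "has_dirderiv f x h l \<longleftrightarrow> has_dirderiv g x h l"
  unfolding has_dirderiv_def
  by (rule tendsto_cong) (use assms in \<open>auto elim: eventually_mono\<close>)

lemma has_dirderiv_cong:
  fixes x h :: "'a::real_tvs"
  assumes "open U" "x \<in> U" "\<And>y. y \<in> U \<Longrightarrow> f y = g y"
  shows "has_dirderiv f x h l \<longleftrightarrow> has_dirderiv g x h l"
  using eventually_line_in[OF assms(1,2), of h] assms
  by (intro has_dirderiv_cong_ev) (auto elim: eventually_mono)

lemma has_dirderiv_transform:
  fixes x h :: "'a::real_tvs"
  assumes "has_dirderiv g x h l" "open U" "x \<in> U" "\<And>y. y \<in> U \<Longrightarrow> f y = g y"
  shows "has_dirderiv f x h l"
  using has_dirderiv_cong[OF assms(2-4)] assms(1) by simp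

lemma has_dirderiv_const: "has_dirderiv (\<lambda>x. a) x h 0"
  by (simp add: has_dirderiv_def)

lemma has_dirderiv_add:
  fixes f g :: "'a::real_vector \<Rightarrow> 'b::locally_convex_space"
  assumes "has_dirderiv f x h l" "has_dirderiv g x h m"
  shows "has_dirderiv (\<lambda>x. f x + g x) x h (l + m)"
  using tendsto_add[OF assms[unfolded has_dirderiv_def]] unfolding has_dirderiv_def
  by (rule back_subst[where P="\<lambda>f. (f \<longlongrightarrow> _) _"]) (auto simp: algebra_simps)

lemma has_dirderiv_scale_fun:
  fixes f :: "'a::real_vector \<Rightarrow> 'b::locally_convex_space"
  assumes "has_dirderiv f x h l"
  shows "has_dirderiv (\<lambda>x. a *\<^sub>R f x) x h (a *\<^sub>R l)"
  using tendsto_scaleR_tvs[OF tendsto_const[of a] assms[unfolded has_dirderiv_def]] unfolding has_dirderiv_def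
  by (rule back_subst[where P="\<lambda>f. (f \<longlongrightarrow> _) _"]) (auto simp: algebra_simps)

lemma has_dirderiv_diff:
  fixes f g :: "'a::real_vector \<Rightarrow> 'b::locally_convex_space"
  assumes "has_dirderiv f x h l" "has_dirderiv g x h m"
  shows "has_dirderiv (\<lambda>x. f x - g x) x h (l - m)"
  using has_dirderiv_add[OF assms(1) has_dirderiv_scale_fun[OF assms(2), of "-1"]] by simp

lemma has_dirderiv_Pair:
  assumes "has_dirderiv f x h l" "has_dirderiv g x h m"
  shows "has_dirderiv (\<lambda>x. (f x, g x)) x h (l, m)"
  using tendsto_Pair[OF assms[unfolded has_dirderiv_def]] unfolding has_dirderiv_def
  by (rule back_subst[where P="\<lambda>f. (f \<longlongrightarrow> _) _"]) (auto simp: algebra_simps)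

lemma has_dirderiv_linear:
  fixes L :: "'b::locally_convex_space \<Rightarrow> 'c::locally_convex_space"
  assumes L: "linear L" "continuous_on UNIV L" and f: "has_dirderiv f x h l"
  shows "has_dirderiv (\<lambda>x. L (f x)) x h (L l)"
proof -
  have "((\<lambda>t. L ((1 / t) *\<^sub>R (f (x + t *\<^sub>R h) - f x))) \<longlongrightarrow> L l) (at 0)"
    using continuous_on_tendsto_compose[OF L(2) f[unfolded has_dirderiv_def]] by simp
  then show ?thesis
    unfolding has_dirderiv_def by (simp add: linear_scale[OF L(1)] linear_diff[OF L(1)])
qed

lemma has_dirderiv_id: "has_dirderiv (\<lambda>x. x) x h (h::'a::locally_convex_space)"
  unfolding has_dirderiv_def by (rule tendsto_eventually) (simp add: eventually_at_filter)

lemma tendsto_at_0_scale: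
  assumes "r \<noteq> (0::real)"
  shows "filterlim (\<lambda>t. t * r) (at 0) (at 0)"
  unfolding filterlim_at
proof
  have "((\<lambda>t. t * r) \<longlongrightarrow> 0 * r) (at 0)" by (intro tendsto_intros)
  then show "((\<lambda>t. t * r) \<longlongrightarrow> 0) (at 0)" by simp
  show "\<forall>\<^sub>F t in at 0. t * r \<in> UNIV \<and> t * r \<noteq> 0"
    using assms by (simp add: eventually_at_filter)
qed

lemma has_dirderiv_scale:
  fixes f :: "'a::real_vector \<Rightarrow> 'b::locally_convex_space"
  assumes "has_dirderiv f x h l"
  shows "has_dirderiv f x (r *\<^sub>R h) (r *\<^sub>R l)"
proof (cases "r = 0")
  case True then show ?thesis by (simp add: has_dirderiv_def)
next
  case False
  have "((\<lambda>t. r *\<^sub>R ((1 / (t * r)) *\<^sub>R (f (x + (t * r) *\<^sub>R h) - f x))) \<longlongrightarrow> r *\<^sub>R l) (at 0)"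
    using filterlim_compose[OF assms[unfolded has_dirderiv_def] tendsto_at_0_scale[OF False]]
    by (intro tendsto_intros) simp
  then show ?thesis
    unfolding has_dirderiv_def using False by simp
qed

text \<open>$c(t) = c(0) + t \cdot q(t)$, where the difference quotient $q(t)$ converges.\<close>

lemma has_dirderiv_isCont:
  fixes c :: "real \<Rightarrow> 'b::locally_convex_space"
  assumes "has_dirderiv c 0 1 l"
  shows "(c \<longlongrightarrow> c 0) (at 0)"
proof -
  have "((\<lambda>t. c 0 + t *\<^sub>R ((1 / t) *\<^sub>R (c (0 + t *\<^sub>R 1) - c 0))) \<longlongrightarrow> c 0 + 0 *\<^sub>R l) (at 0)"
    using assms[unfolded has_dirderiv_def] by (intro tendsto_intros)
  then have "((\<lambda>t. c 0 + t *\<^sub>R ((1 / t) *\<^sub>R (c (0 + t *\<^sub>R 1) - c 0))) \<longlongrightarrow> c 0) (at 0)" by simp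
  then show ?thesis
    by (rule Lim_transform_eventually) (simp add: eventually_at_filter)
qed

section \<open>Continuously differentiable maps\<close>

definition C1_on :: "'a::locally_convex_space set \<Rightarrow> ('a \<Rightarrow> 'b::locally_convex_space) \<Rightarrow> ('a \<Rightarrow> 'a \<Rightarrow> 'b) \<Rightarrow> bool" where
  "C1_on V f f' \<longleftrightarrow> open V \<and> (\<forall>y\<in>V. \<forall>h. has_dirderiv f y h (f' y h)) \<and>
     continuous_on (V \<times> UNIV) (\<lambda>(y, h). f' y h)"

text \<open>Strict differentiability: the base point and the direction may move with $t$.  Joint continuity of
  the derivative keeps it in a small convex set along the segment from $Y(t)$ to $Y(t) + t q(t)$,
  and the mean value theorem transfers this to the difference quotient.  Both the chain rule and the
  additivity of the derivative in its direction are instances.\<close>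

lemma C1_strong:
  assumes f: "C1_on V f f'" and y: "y \<in> V" and Y: "(Y \<longlongrightarrow> y) (at 0)" and q: "(q \<longlongrightarrow> k) (at 0)"
  shows "((\<lambda>t. (1 / t) *\<^sub>R (f (Y t + t *\<^sub>R q t) - f (Y t))) \<longlongrightarrow> f' y k) (at (0::real))"
proof (rule topological_tendstoI)
  fix S assume "open S" "f' y k \<in> S"
  then obtain C where C: "open C" "convex C" "f' y k \<in> C" "C \<subseteq> S" by (rule convex_nhd)
  from f have V: "open V" and D: "\<And>z h. z \<in> V \<Longrightarrow> has_dirderiv f z h (f' z h)"
    and cont: "continuous_on (V \<times> UNIV) (\<lambda>(y, h). f' y h)" by (auto simp: C1_on_def)
  have "open (V \<times> (UNIV :: 'a set))" by (simp add: V open_Times)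
  from continuous_openin_preimage_gen[OF cont C(1)] this
  have "open (V \<times> UNIV \<inter> (\<lambda>(y, h). f' y h) -` C)"
    by (simp add: openin_open_eq)
  moreover have "(y, k) \<in> V \<times> UNIV \<inter> (\<lambda>(y, h). f' y h) -` C" using y C(3) by simp
  ultimately obtain N0 Q where N0: "open N0" "y \<in> N0" and Q: "open Q" "k \<in> Q"
    and NQ: "N0 \<times> Q \<subseteq> V \<times> UNIV \<inter> (\<lambda>(y, h). f' y h) -` C"
    by (metis open_prod_elim mem_Sigma_iff)
  obtain N where N: "open N" "convex N" "y \<in> N" "N \<subseteq> N0" using convex_nhd[OF N0] .
  have "((\<lambda>t. Y t + t *\<^sub>R q t) \<longlongrightarrow> y + 0 *\<^sub>R k) (at 0)" by (intro tendsto_intros Y q)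
  then have Yq: "((\<lambda>t. Y t + t *\<^sub>R q t) \<longlongrightarrow> y) (at 0)" by simp
  have ne: "\<forall>\<^sub>F t::real in at 0. t \<noteq> 0" by (simp add: eventually_at_filter)
  show "\<forall>\<^sub>F t in at 0. (1 / t) *\<^sub>R (f (Y t + t *\<^sub>R q t) - f (Y t)) \<in> S"
    using topological_tendstoD[OF Y N(1,3)] topological_tendstoD[OF Yq N(1,3)]
      topological_tendstoD[OF q Q] ne
  proof eventually_elim
    case (elim t)
    define \<psi> where "\<psi> s = (1 / t) *\<^sub>R f (Y t + (s * t) *\<^sub>R q t)" for s
    have "\<psi> 1 - \<psi> 0 \<in> C"
    proof (rule increment_in_convex[OF C(1,2)])
      fix s :: real assume s: "0 \<le> s" "s \<le> 1"
      let ?z = "Y t + (s * t) *\<^sub>R q t"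
      have "(1 - s) *\<^sub>R Y t + s *\<^sub>R (Y t + t *\<^sub>R q t) \<in> N"
        using N(2) elim s unfolding convex_alt by blast
      then have z: "?z \<in> N0" using N(4) by (auto simp: algebra_simps)
      then have l: "?z \<in> V" "f' ?z (q t) \<in> C" using NQ elim by auto
      have "((\<lambda>r. (1 / (r * t)) *\<^sub>R (f (?z + (r * t) *\<^sub>R q t) - f ?z)) \<longlongrightarrow> f' ?z (q t)) (at 0)"
        using filterlim_compose[OF D[OF l(1), unfolded has_dirderiv_def] tendsto_at_0_scale] elim
        by blast
      then have "has_dirderiv \<psi> s 1 (f' ?z (q t))"
        unfolding has_dirderiv_def \<psi>_def
        by (simp add: algebra_simps)
      with l(2) show "\<exists>l\<in>C. has_dirderiv \<psi> s 1 l" by blast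
    qed
    then show ?case using C(4) unfolding \<psi>_def by (auto simp: scaleR_diff_right)
  qed
qed

lemma C1_chain:
  assumes f: "C1_on V f f'" and P: "has_dirderiv P 0 1 p'" "P 0 \<in> V"
  shows "has_dirderiv (\<lambda>t::real. f (P t)) 0 1 (f' (P 0) p')"
proof -
  define q where "q t = (1 / t) *\<^sub>R (P (0 + t *\<^sub>R 1) - P 0)" for t
  have "(q \<longlongrightarrow> p') (at 0)" using P(1) unfolding has_dirderiv_def q_def .
  from C1_strong[OF f P(2) tendsto_const this]
  have "((\<lambda>t. (1 / t) *\<^sub>R (f (P 0 + t *\<^sub>R q t) - f (P 0))) \<longlongrightarrow> f' (P 0) p') (at 0)" .
  then show ?thesis unfolding has_dirderiv_def
    by (rule Lim_transform_eventually) (simp add: eventually_at_filter q_def)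
qed

text \<open>Additivity: walk first along \<open>h\<close> and then along \<open>k\<close>; the second step starts at a moving base
  point.\<close>

lemma C1_linear:
  assumes f: "C1_on V f f'" and y: "y \<in> V"
  shows "linear (f' y)"
proof -
  have D: "\<And>h. has_dirderiv f y h (f' y h)" using f y by (simp add: C1_on_def)
  show ?thesis
  proof (rule linearI)
    show "f' y (r *\<^sub>R h) = r *\<^sub>R f' y h" for r h
      by (rule has_dirderiv_unique[OF D has_dirderiv_scale[OF D]])
    fix h k
    have "((\<lambda>t. (1 / t) *\<^sub>R (f ((y + t *\<^sub>R h) + t *\<^sub>R k) - f (y + t *\<^sub>R h))
             + (1 / t) *\<^sub>R (f (y + t *\<^sub>R h) - f y)) \<longlongrightarrow> f' y k + f' y h) (at 0)"
      using D[of h, unfolded has_dirderiv_def]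
      by (intro tendsto_add C1_strong[OF f y] tendsto_line tendsto_const)
    then have "has_dirderiv f y (h + k) (f' y k + f' y h)"
      unfolding has_dirderiv_def by (simp add: algebra_simps)
    from has_dirderiv_unique[OF D this] show "f' y (h + k) = f' y h + f' y k" by simp
  qed
qed


section \<open>Iterated directional derivatives\<close>

abbreviation smooth :: "'a::locally_convex_space set \<Rightarrow> ('a \<Rightarrow> 'b::locally_convex_space) \<Rightarrow> bool" where
  "smooth U f \<equiv> smooth_on UNIV UNIV U f"

lemma smoothD:
  assumes "smooth U f"
  shows "x \<in> U \<Longrightarrow> has_dirderiv (iter_dirderiv f j h) x (h j) (iter_dirderiv f (Suc j) h x)"
    and "continuous_on (U \<times> UNIV) (\<lambda>(x, h). iter_dirderiv f j h x)"
  using assms unfolding smooth_on_def by (auto dest: dirderiv_eqI)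

lemma iter_dirderiv_0: "iter_dirderiv f 0 h = f"
  by (simp add: fun_eq_iff)

lemma iter_dirderiv_cong:
  "(\<And>i. i < j \<Longrightarrow> h i = h' i) \<Longrightarrow> iter_dirderiv f j h = iter_dirderiv f j h'"
proof (induction j)
  case (Suc j)
  then have "iter_dirderiv f j h = iter_dirderiv f j h'" "h j = h' j" by auto
  then show ?case by (intro ext) (simp only: iter_dirderiv.simps)
qed (simp add: fun_eq_iff)

lemma has_dirderiv_iter:
  assumes "smooth U f" "x \<in> U"
  shows "has_dirderiv (iter_dirderiv f j h) x k (iter_dirderiv f (Suc j) (h(j := k)) x)"
  using smoothD(1)[OF assms, of j "h(j := k)"] iter_dirderiv_cong[of j "h(j := k)" h f] by simp

lemma continuous_on_iter_compose:
  assumes "smooth V g" "continuous_on S p" "\<And>i. continuous_on S (u i)" "\<And>z. z \<in> S \<Longrightarrow> p z \<in> V"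
  shows "continuous_on S (\<lambda>z. iter_dirderiv g k (\<lambda>i. u i z) (p z))"
proof -
  have "continuous_on S (\<lambda>z. (p z, \<lambda>i. u i z))"
    by (intro continuous_on_Pair assms continuous_on_coordinatewise_then_product)
  from continuous_on_compose2[OF smoothD(2)[OF assms(1), of k] this] assms(4) show ?thesis by auto
qed

lemma C1_on_iter:
  assumes "smooth U f" "open U"
  shows "C1_on U (iter_dirderiv f j h) (\<lambda>x k. iter_dirderiv f (Suc j) (h(j := k)) x)"
  unfolding C1_on_def
proof (intro conjI ballI allI assms(2) has_dirderiv_iter[OF assms(1)])
  have "continuous_on (U \<times> UNIV) (\<lambda>z. if i = j then snd z else h i)" for i
    by (cases "i = j") (auto intro!: continuous_intros)
  then have "continuous_on (U \<times> UNIV) (\<lambda>z. iter_dirderiv f (Suc j) (\<lambda>i. (if i = j then snd z else h i)) (fst z))"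
    by (intro continuous_on_iter_compose[OF assms(1), of _ fst "\<lambda>i z. if i = j then snd z else h i"])
       (auto intro!: continuous_intros)
  then show "continuous_on (U \<times> UNIV) (\<lambda>(y, k). iter_dirderiv f (Suc j) (h(j := k)) y)"
    by (simp only: fun_upd_def case_prod_unfold)
qed

text \<open>Linearity in the last direction is the linearity of a first derivative; in an earlier direction
  it survives the remaining differentiations, because these commute with linear combinations.\<close>

lemma linear_iter_dirderiv:
  assumes "smooth U f" "open U" "x \<in> U" "i < j"
  shows "linear (\<lambda>k. iter_dirderiv f j (h(i := k)) x)"
  using assms(3,4)
proof (induction j arbitrary: x)
  case (Suc j)
  show ?case
  proof (cases "i = j")
    case True
    then show ?thesis using C1_linear[OF C1_on_iter[OF assms(1,2)] Suc.prems(1), of j h]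
      by (simp only: True)
  next
    case False
    then have i: "i < j" using Suc.prems by simp
    have D: "has_dirderiv (iter_dirderiv f j (h(i := k))) x (h j) (iter_dirderiv f (Suc j) (h(i := k)) x)" for k
      using smoothD(1)[OF assms(1) Suc.prems(1), of j "h(i := k)"] False by simp
    note lin = Suc.IH[OF _ i]
    show ?thesis
    proof (rule linearI)
      fix k l
      have "has_dirderiv (iter_dirderiv f j (h(i := k + l))) x (h j)
              (iter_dirderiv f (Suc j) (h(i := k)) x + iter_dirderiv f (Suc j) (h(i := l)) x)"
        by (subst has_dirderiv_cong[OF assms(2) Suc.prems(1) linear_add[OF lin]])
           (assumption, rule has_dirderiv_add[OF D D])
      from has_dirderiv_unique[OF D this]
      show "iter_dirderiv f (Suc j) (h(i := k + l)) x =
              iter_dirderiv f (Suc j) (h(i := k)) x + iter_dirderiv f (Suc j) (h(i := l)) x" .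
    next
      fix r k
      have "has_dirderiv (iter_dirderiv f j (h(i := r *\<^sub>R k))) x (h j)
              (r *\<^sub>R iter_dirderiv f (Suc j) (h(i := k)) x)"
        by (subst has_dirderiv_cong[OF assms(2) Suc.prems(1) linear_scale[OF lin]])
           (assumption, rule has_dirderiv_scale_fun[OF D])
      from has_dirderiv_unique[OF D this]
      show "iter_dirderiv f (Suc j) (h(i := r *\<^sub>R k)) x = r *\<^sub>R iter_dirderiv f (Suc j) (h(i := k)) x" .
    qed
  qed
qed simp

lemma tendsto_fun:
  fixes f :: "'c \<Rightarrow> 'i \<Rightarrow> 'b::topological_space"
  assumes "\<And>i. ((\<lambda>t. f t i) \<longlongrightarrow> l i) F"
  shows "(f \<longlongrightarrow> l) F"
  using assms limitin_componentwise[of "\<lambda>i::'i. euclidean :: 'b topology" UNIV f l F]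
  by (simp add: euclidean_product_topology)

lemma tendsto_iter_compose:
  assumes "smooth V g" "open V" "(p \<longlongrightarrow> y) F" "\<And>i. (u i \<longlongrightarrow> l i) F" "y \<in> V"
  shows "((\<lambda>t. iter_dirderiv g k (\<lambda>i. u i t) (p t)) \<longlongrightarrow> iter_dirderiv g k l y) F"
proof -
  have lim: "((\<lambda>t. (p t, \<lambda>i. u i t)) \<longlongrightarrow> (y, l)) F"
    by (intro tendsto_Pair assms tendsto_fun)
  have "\<forall>\<^sub>F t in F. (p t, \<lambda>i. u i t) \<in> V \<times> UNIV"
    using topological_tendstoD[OF assms(3,2,5)] by simp
  from continuous_on_tendsto_compose[OF smoothD(2)[OF assms(1), of k] lim _ this] assms(5)
  show ?thesis by simp
qed

text \<open>The product and chain rule for $t \mapsto D^k g(P(t))(v_0(t), \dots, v_{k-1}(t))$: one term for the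
  motion of the base point and one for each direction.\<close>

lemma has_dirderiv_iter_curve:
  assumes g: "smooth V g" "open V" and P: "has_dirderiv P 0 1 p'" "P 0 \<in> V"
    and v: "\<And>i. i < k \<Longrightarrow> has_dirderiv (v i) 0 1 (v' i)"
  shows "has_dirderiv (\<lambda>t::real. iter_dirderiv g k (\<lambda>i. v i t) (P t)) 0 1
           (iter_dirderiv g (Suc k) ((\<lambda>i. v i 0)(k := p')) (P 0)
             + (\<Sum>i<k. iter_dirderiv g k ((\<lambda>i. v i 0)(i := v' i)) (P 0)))"
proof -
  \<comment> \<open>only the first \<open>m\<close> directions move; they are set in motion one after the other\<close>
  define A where "A m t = iter_dirderiv g k (\<lambda>i. if i < m then v i t else v i 0) (P t)" for m t
  note Pc = has_dirderiv_isCont[OF P(1)] and vc = has_dirderiv_isCont[OF v]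
  have "has_dirderiv (A m) 0 1 (iter_dirderiv g (Suc k) ((\<lambda>i. v i 0)(k := p')) (P 0)
          + (\<Sum>i<m. iter_dirderiv g k ((\<lambda>i. v i 0)(i := v' i)) (P 0)))" if "m \<le> k" for m
    using that
  proof (induction m)
    case 0
    show ?case using C1_chain[OF C1_on_iter[OF g] P, of k "\<lambda>i. v i 0"]
      by (simp only: A_def[abs_def] not_less0 if_False lessThan_0 sum.empty add_0_right)
  next
    case (Suc m)
    then have m: "m < k" by simp
    define q where "q t = (1 / t) *\<^sub>R (v m (0 + t *\<^sub>R 1) - v m 0)" for t
    have q: "((\<lambda>t. q t) \<longlongrightarrow> v' m) (at 0)" using v[OF m] unfolding has_dirderiv_def q_def .
    define w where "w i t = (if i < m then v i t else if i = m then q t else v i 0)" for i t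
    have "((\<lambda>t. iter_dirderiv g k (\<lambda>i. w i t) (P t)) \<longlongrightarrow>
            iter_dirderiv g k ((\<lambda>i. v i 0)(m := v' m)) (P 0)) (at 0)"
    proof (rule tendsto_iter_compose[OF g Pc _ P(2)])
      show "(w i \<longlongrightarrow> ((\<lambda>i. v i 0)(m := v' m)) i) (at 0)" for i
        using vc[of i] q m unfolding w_def by (cases "i < m"; cases "i = m") auto
    qed
    moreover have "\<forall>\<^sub>F t in at 0. iter_dirderiv g k (\<lambda>i. w i t) (P t)
        = (1 / t) *\<^sub>R ((A (Suc m) (0 + t *\<^sub>R 1) - A m (0 + t *\<^sub>R 1)) - (A (Suc m) 0 - A m 0))"
      using topological_tendstoD[OF Pc g(2) P(2)]
    proof eventually_elim
      case (elim t)
      define h where "h i = (if i < m then v i t else v i 0)" for i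
      note L = linear_iter_dirderiv[OF g elim m, of h]
      have "A (Suc m) t = iter_dirderiv g k (h(m := v m t)) (P t)"
        unfolding A_def h_def by (rule arg_cong[where f="\<lambda>h. iter_dirderiv g k h (P t)"]) auto
      moreover have "A m t = iter_dirderiv g k (h(m := v m 0)) (P t)"
        unfolding A_def h_def by (rule arg_cong[where f="\<lambda>h. iter_dirderiv g k h (P t)"]) auto
      moreover have "A (Suc m) 0 = A m 0" by (simp add: A_def)
      moreover have "(\<lambda>i. w i t) = h(m := (1 / t) *\<^sub>R (v m t - v m 0))"
        unfolding w_def h_def q_def by auto
      ultimately show ?case
        by (simp add: linear_scale[OF L] linear_diff[OF L])
    qed
    ultimately have "has_dirderiv (\<lambda>t. A (Suc m) t - A m t) 0 1
        (iter_dirderiv g k ((\<lambda>i. v i 0)(m := v' m)) (P 0))"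
      unfolding has_dirderiv_def by (rule Lim_transform_eventually)
    from has_dirderiv_add[OF this Suc.IH[OF less_imp_le[OF m]]] show ?case
      by (simp only: sum.lessThan_Suc diff_add_cancel) (simp only: add_ac)
  qed
  from this[of k]
  have "has_dirderiv (A k) 0 1 (iter_dirderiv g (Suc k) ((\<lambda>i. v i 0)(k := p')) (P 0)
          + (\<Sum>i<k. iter_dirderiv g k ((\<lambda>i. v i 0)(i := v' i)) (P 0)))" by simp
  moreover have "A k = (\<lambda>t. iter_dirderiv g k (\<lambda>i. v i t) (P t))"
    unfolding A_def by (intro ext fun_cong[OF iter_dirderiv_cong]) auto
  ultimately show ?thesis by simp
qed

section \<open>Symmetry of second derivatives\<close>

text \<open>Two applications of the mean value theorem, one in each direction, place the second difference
  quotient into any convex neighbourhood of the mixed derivative.  The second difference itself does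
  not depend on the order of the two directions, which yields the symmetry.\<close>

lemma second_difference_tendsto:
  assumes f: "smooth U f" "open U" "x \<in> U"
  shows "((\<lambda>t. (1 / t) *\<^sub>R ((1 / t) *\<^sub>R
            ((f (x + t *\<^sub>R k + t *\<^sub>R h) - f (x + t *\<^sub>R h)) - (f (x + t *\<^sub>R k) - f x))))
          \<longlongrightarrow> iter_dirderiv f 2 ((\<lambda>i. k)(0 := h)) x) (at (0::real))"
proof (rule topological_tendstoI)
  let ?H = "(\<lambda>i. k)(0 := h)"
  fix S assume "open S" "iter_dirderiv f 2 ?H x \<in> S"
  then obtain C where C: "open C" "convex C" "iter_dirderiv f 2 ?H x \<in> C" "C \<subseteq> S" by (rule convex_nhd)
  have "continuous_on U (\<lambda>z. iter_dirderiv f 2 ?H z)"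
    using continuous_on_iter_compose[OF f(1), of U "\<lambda>z. z" "\<lambda>i z. ?H i" 2]
    by (simp add: fun_upd_def)
  from continuous_openin_preimage_gen[OF this C(1)]
  have "open (U \<inter> iter_dirderiv f 2 ?H -` C)" using f(2) by (simp add: openin_open_eq)
  then obtain N where N: "open N" "convex N" "x \<in> N" "N \<subseteq> U \<inter> iter_dirderiv f 2 ?H -` C"
    using convex_nhd[of _ x] f(3) C(3) by (metis IntI vimageI)
  have k: "((\<lambda>t::real. x + t *\<^sub>R k) \<longlongrightarrow> x) (at 0)" and h: "((\<lambda>t::real. x + t *\<^sub>R h) \<longlongrightarrow> x) (at 0)"
    by (rule tendsto_line)+
  have "((\<lambda>t::real. x + t *\<^sub>R k + t *\<^sub>R h) \<longlongrightarrow> x + 0 *\<^sub>R k + 0 *\<^sub>R h) (at 0)" by (intro tendsto_intros)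
  then have kh: "((\<lambda>t::real. x + t *\<^sub>R k + t *\<^sub>R h) \<longlongrightarrow> x) (at 0)" by simp
  have ne: "\<forall>\<^sub>F t::real in at 0. t \<noteq> 0" by (simp add: eventually_at_filter)
  show "\<forall>\<^sub>F t in at 0. (1 / t) *\<^sub>R ((1 / t) *\<^sub>R
            ((f (x + t *\<^sub>R k + t *\<^sub>R h) - f (x + t *\<^sub>R h)) - (f (x + t *\<^sub>R k) - f x))) \<in> S"
    using topological_tendstoD[OF k N(1,3)] topological_tendstoD[OF h N(1,3)]
      topological_tendstoD[OF kh N(1,3)] ne
  proof eventually_elim
    case (elim t)
    let ?p = "\<lambda>r s. x + (r * t) *\<^sub>R k + (s * t) *\<^sub>R h"
    have p: "?p r s \<in> N" if "0 \<le> r" "r \<le> 1" "0 \<le> s" "s \<le> 1" for r s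
    proof -
      have "(1 - r) *\<^sub>R x + r *\<^sub>R (x + t *\<^sub>R k) \<in> N"
        using N(2,3) elim that unfolding convex_alt by blast
      moreover have "(1 - r) *\<^sub>R (x + t *\<^sub>R h) + r *\<^sub>R (x + t *\<^sub>R k + t *\<^sub>R h) \<in> N"
        using N(2) elim that unfolding convex_alt by blast
      ultimately have "(1 - s) *\<^sub>R ((1 - r) *\<^sub>R x + r *\<^sub>R (x + t *\<^sub>R k)) +
          s *\<^sub>R ((1 - r) *\<^sub>R (x + t *\<^sub>R h) + r *\<^sub>R (x + t *\<^sub>R k + t *\<^sub>R h)) \<in> N"
        using N(2) that unfolding convex_alt by blast
      moreover have "(1 - s) *\<^sub>R ((1 - r) *\<^sub>R x + r *\<^sub>R (x + t *\<^sub>R k)) +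
          s *\<^sub>R ((1 - r) *\<^sub>R (x + t *\<^sub>R h) + r *\<^sub>R (x + t *\<^sub>R k + t *\<^sub>R h)) = ?p r s"
        by (simp add: algebra_simps)
      ultimately show ?thesis by simp
    qed
    note pU = p[THEN subsetD[OF N(4)]]
    have D1: "has_dirderiv f z h (iter_dirderiv f 1 ?H z)" if "z \<in> U" for z
      using smoothD(1)[OF f(1) that, of 0 ?H] by (simp add: iter_dirderiv_0)
    have D2: "has_dirderiv (iter_dirderiv f 1 ?H) z k (iter_dirderiv f 2 ?H z)" if "z \<in> U" for z
      using smoothD(1)[OF f(1) that, of 1 ?H] by (simp add: numeral_2_eq_2)
    have move: "has_dirderiv (\<lambda>s. F (z + (s * t) *\<^sub>R w)) s 1 (t *\<^sub>R l)"
      if "has_dirderiv F (z + (s * t) *\<^sub>R w) w l" for F :: "'a \<Rightarrow> 'b" and z w l s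
      using has_dirderiv_scale[OF that, of t] unfolding has_dirderiv_def
      by (simp add: algebra_simps)
    \<comment> \<open>the side of the parallelogram in direction \<open>k\<close>, moved along \<open>h\<close>\<close>
    define \<psi> where "\<psi> s = (1 / t) *\<^sub>R ((1 / t) *\<^sub>R (f (?p 1 s) - f (?p 0 s)))" for s
    have "\<psi> 1 - \<psi> 0 \<in> C"
    proof (rule increment_in_convex[OF C(1,2)])
      fix s :: real assume s: "0 \<le> s" "s \<le> 1"
      \<comment> \<open>the derivative of \<open>\<psi>\<close> is the increment of \<open>\<theta>\<close>\<close>
      define \<theta> where "\<theta> r = (1 / t) *\<^sub>R iter_dirderiv f 1 ?H (?p r s)" for r
      have "\<theta> 1 - \<theta> 0 \<in> C"
      proof (rule increment_in_convex[OF C(1,2)])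
        fix r :: real assume r: "0 \<le> r" "r \<le> 1"
        have eq: "?p r s = (x + (s * t) *\<^sub>R h) + (r * t) *\<^sub>R k" for r by simp
        have "has_dirderiv (\<lambda>r. iter_dirderiv f 1 ?H (?p r s)) r 1 (t *\<^sub>R iter_dirderiv f 2 ?H (?p r s))"
          unfolding eq using pU[OF r s] unfolding eq by (intro move D2) simp
        from has_dirderiv_scale_fun[OF this, of "1 / t"] elim
        have "has_dirderiv \<theta> r 1 (iter_dirderiv f 2 ?H (?p r s))" by (simp add: \<theta>_def[abs_def])
        with pU[OF r s] show "\<exists>l\<in>C. has_dirderiv \<theta> r 1 l" by blast
      qed
      moreover have "has_dirderiv \<psi> s 1 (\<theta> 1 - \<theta> 0)"
      proof -
        have "has_dirderiv (\<lambda>s. f (?p r s)) s 1 (t *\<^sub>R iter_dirderiv f 1 ?H (?p r s))" if "0 \<le> r" "r \<le> 1" for r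
          using pU[OF that s] by (intro move D1) simp
        from has_dirderiv_scale_fun[OF has_dirderiv_scale_fun[OF has_dirderiv_diff[OF this[of 1] this[of 0]],
              of "1 / t"], of "1 / t"] elim
        show ?thesis by (simp add: \<psi>_def[abs_def] \<theta>_def scaleR_diff_right)
      qed
      ultimately show "\<exists>l\<in>C. has_dirderiv \<psi> s 1 l" by blast
    qed
    then show ?case using C(4) by (auto simp: \<psi>_def scaleR_diff_right)
  qed
qed

lemma iter_dirderiv_2_commute:
  assumes f: "smooth U f" "open U" "x \<in> U"
  shows "iter_dirderiv f 2 h x = iter_dirderiv f 2 ((\<lambda>i. h 0)(0 := h 1)) x"
proof -
  have "((\<lambda>t. (1 / t) *\<^sub>R ((1 / t) *\<^sub>R
            ((f (x + t *\<^sub>R h 1 + t *\<^sub>R h 0) - f (x + t *\<^sub>R h 0)) - (f (x + t *\<^sub>R h 1) - f x))))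
          \<longlongrightarrow> iter_dirderiv f 2 ((\<lambda>i. h 0)(0 := h 1)) x) (at (0::real))"
    using second_difference_tendsto[OF f, of "h 0" "h 1"] by (simp add: algebra_simps)
  from tendsto_unique[OF at_neq_bot second_difference_tendsto[OF f, of "h 1" "h 0"] this]
  have "iter_dirderiv f 2 ((\<lambda>i. h 1)(0 := h 0)) x = iter_dirderiv f 2 ((\<lambda>i. h 0)(0 := h 1)) x" .
  moreover have "iter_dirderiv f 2 ((\<lambda>i. h 1)(0 := h 0)) = iter_dirderiv f 2 h"
    by (rule iter_dirderiv_cong) (auto simp: less_2_cases_iff)
  ultimately show ?thesis by simp
qed


section \<open>Families of maps with parameters\<close>

text \<open>$C^k$ maps $U \to F$ that depend on an infinite sequence \<open>h\<close> of directions as parameters.  One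
  derivative of \<open>u\<close> consumes the parameter \<open>h 0\<close> as its direction and leaves the shifted sequence to
  \<open>u\<close>, so that the derivative is a family of the same type.  This makes induction on the order of
  differentiability possible, whereas the tangent map of $f : E \to F$ is a map on $E \times E$.\<close>

primrec Ck :: "nat \<Rightarrow> 'a::locally_convex_space set \<Rightarrow> ((nat \<Rightarrow> 'a) \<Rightarrow> 'a \<Rightarrow> 'b::locally_convex_space) \<Rightarrow> bool" where
  "Ck 0 U u \<longleftrightarrow> continuous_on (U \<times> UNIV) (\<lambda>(x, h). u h x)"
| "Ck (Suc n) U u \<longleftrightarrow> continuous_on (U \<times> UNIV) (\<lambda>(x, h). u h x) \<and>
     (\<exists>u'. (\<forall>x\<in>U. \<forall>h. has_dirderiv (u (\<lambda>i. h (Suc i))) x (h 0) (u' h x)) \<and> Ck n U u')"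

lemma Ck_imp_continuous: "Ck n U u \<Longrightarrow> continuous_on (U \<times> UNIV) (\<lambda>(x, h). u h x)"
  by (cases n) auto

lemma Ck_lower: "Ck (Suc n) U u \<Longrightarrow> Ck n U u"
proof (induction n arbitrary: u)
  case (Suc n)
  then show ?case unfolding Ck.simps(2)[of "Suc n"] Ck.simps(2)[of n] by blast
qed simp

lemma Ck_SucI:
  assumes "continuous_on (U \<times> UNIV) (\<lambda>(x, h). u h x)"
    and "\<And>x h. x \<in> U \<Longrightarrow> has_dirderiv (u (\<lambda>i. h (Suc i))) x (h 0) (u' h x)"
    and "Ck n U u'"
  shows "Ck (Suc n) U u"
  using assms by auto

lemma continuous_on_fun_apply:
  "continuous_on S f \<Longrightarrow> continuous_on S (\<lambda>x. f x i)"
  for f :: "'c::topological_space \<Rightarrow> 'i \<Rightarrow> 'b::topological_space"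
  by (rule continuous_on_product_then_coordinatewise)

lemma continuous_on_reindex:
  "continuous_on S (\<lambda>z::'c::topological_space \<times> ('j \<Rightarrow> 'b::topological_space). (fst z, \<lambda>i::'i. snd z (s i)))"
proof (rule continuous_on_Pair)
  show "continuous_on S (\<lambda>z::'c \<times> ('j \<Rightarrow> 'b). (\<lambda>i::'i. snd z (s i)))"
    by (rule continuous_on_coordinatewise_then_product, rule continuous_on_fun_apply,
        rule continuous_on_snd, rule continuous_on_id)
qed (rule continuous_on_fst, rule continuous_on_id)

lemma continuous_on_family_reindex:
  assumes "continuous_on (U \<times> UNIV) (\<lambda>(x, h). u h x)"
  shows "continuous_on (U \<times> UNIV) (\<lambda>(x, h). u (\<lambda>i. h (s i)) x)"
proof -
  have "(\<lambda>z. (fst z, \<lambda>i. snd z (s i))) ` (U \<times> UNIV) \<subseteq> U \<times> UNIV" by auto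
  from continuous_on_compose2[OF assms continuous_on_reindex this]
  show ?thesis by (simp add: case_prod_unfold)
qed

text \<open>Differentiating a reindexed family uses one more parameter, the direction, which the reindexing
  must leave in place; the index map therefore has to be arbitrary in the induction.\<close>

lemma Ck_reindex: "Ck n U u \<Longrightarrow> Ck n U (\<lambda>h. u (\<lambda>i. h (s i)))"
proof (induction n arbitrary: u s)
  case 0
  then show ?case by (simp add: continuous_on_family_reindex)
next
  case (Suc n)
  obtain u' where u': "\<And>x h. x \<in> U \<Longrightarrow> has_dirderiv (u (\<lambda>i. h (Suc i))) x (h 0) (u' h x)"
    "Ck n U u'"
    using Suc.prems(1) by auto
  note continuous_on_family_reindex[OF Ck_imp_continuous[OF Suc.prems], of s]
  then have c: "continuous_on (U \<times> UNIV) (\<lambda>(x, h). u (\<lambda>i. h (s i)) x)" .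
  let ?s = "\<lambda>i. case i of 0 \<Rightarrow> 0 | Suc i \<Rightarrow> Suc (s i)"
  show ?case
  proof (rule Ck_SucI[OF c _ Suc.IH[OF u'(2), of ?s]])
    fix x h assume "x \<in> U"
    from u'(1)[OF this, of "\<lambda>i. h (?s i)"]
    show "has_dirderiv (u (\<lambda>i. h (Suc (s i)))) x (h 0) (u' (\<lambda>i. h (?s i)) x)" by simp
  qed
qed

text \<open>A family that is constant in $x$ has derivative $0$, whatever its dependence on the
  parameters; the derivative \<open>\<lambda>h x. h 0\<close> of the identity is of this kind.\<close>

lemma Ck_param:
  assumes "continuous_on UNIV g"
  shows "Ck n U (\<lambda>h x. g h)"
  using assms
proof (induction n arbitrary: g)
  case (Suc n)
  have "continuous_on (U \<times> UNIV) (\<lambda>z. g (snd z))"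
    by (intro continuous_on_compose2[OF Suc.prems] continuous_intros) auto
  then show ?case
    by (intro Ck_SucI[where u'="\<lambda>h x. 0"] Suc.IH) (auto simp: case_prod_unfold intro: has_dirderiv_const)
next
  case 0
  have "continuous_on (U \<times> UNIV) (\<lambda>z. g (snd z))"
    by (intro continuous_on_compose2[OF 0] continuous_intros) auto
  then show ?case by (simp add: case_prod_unfold)
qed

lemma Ck_const: "Ck n U (\<lambda>h x. a)"
  by (rule Ck_param) (rule continuous_on_const)

lemma Ck_id: "Ck n U (\<lambda>h x. x)"
proof (cases n)
  case (Suc m)
  show ?thesis unfolding Suc
    by (rule Ck_SucI[OF _ has_dirderiv_id Ck_param[of "\<lambda>h. h 0"]])
       (auto simp: case_prod_unfold intro!: continuous_intros)
qed (auto simp: case_prod_unfold intro!: continuous_intros)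

lemma Ck_linear_comp:
  assumes L: "linear L" "continuous_on UNIV L"
  shows "Ck n U u \<Longrightarrow> Ck n U (\<lambda>h x. L (u h x))"
proof (induction n arbitrary: u)
  case 0
  then show ?case
    using continuous_on_compose2[OF L(2) Ck_imp_continuous[OF 0]] by (simp add: case_prod_unfold)
next
  case (Suc n)
  obtain u' where u': "\<And>x h. x \<in> U \<Longrightarrow> has_dirderiv (u (\<lambda>i. h (Suc i))) x (h 0) (u' h x)"
    "Ck n U u'"
    using Suc.prems(1) by auto
  have "continuous_on (U \<times> UNIV) (\<lambda>(x, h). L (u h x))"
    using continuous_on_compose2[OF L(2) Ck_imp_continuous[OF Suc.prems]] by (simp add: case_prod_unfold)
  then show ?case
    by (rule Ck_SucI[OF _ has_dirderiv_linear[OF L u'(1)] Suc.IH[OF u'(2)]])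
qed

lemma Ck_Pair: "Ck n U u \<Longrightarrow> Ck n U w \<Longrightarrow> Ck n U (\<lambda>h x. (u h x, w h x))"
proof (induction n arbitrary: u w)
  case 0
  then show ?case
    using continuous_on_Pair[OF Ck_imp_continuous[OF 0(1)] Ck_imp_continuous[OF 0(2)]] by (simp add: case_prod_unfold)
next
  case (Suc n)
  obtain u' where u': "\<And>x h. x \<in> U \<Longrightarrow> has_dirderiv (u (\<lambda>i. h (Suc i))) x (h 0) (u' h x)"
    "Ck n U u'"
    using Suc.prems(1) by auto
  obtain w' where w': "\<And>x h. x \<in> U \<Longrightarrow> has_dirderiv (w (\<lambda>i. h (Suc i))) x (h 0) (w' h x)"
    "Ck n U w'"
    using Suc.prems(2) by auto
  have "continuous_on (U \<times> UNIV) (\<lambda>(x, h). (u h x, w h x))"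
    using continuous_on_Pair[OF Ck_imp_continuous[OF Suc.prems(1)] Ck_imp_continuous[OF Suc.prems(2)]]
    by (simp add: case_prod_unfold)
  then show ?case
    by (rule Ck_SucI[OF _ has_dirderiv_Pair[OF u'(1) w'(1)] Suc.IH[OF u'(2) w'(2)]])
qed

lemma linear_add_pair: "linear (\<lambda>p::'b::real_vector \<times> 'b. fst p + snd p)"
  by (intro linearI) (simp_all add: algebra_simps)

lemma Ck_add: 
  assumes "Ck n U u" "Ck n U w"
  shows "Ck n U (\<lambda>h x. u h x + w h x)"
  using Ck_linear_comp[OF linear_add_pair _ Ck_Pair[OF assms]]
  by (simp add: continuous_on_add continuous_on_fst continuous_on_snd)

lemma Ck_sum: 
  assumes "\<And>i. i \<in> I \<Longrightarrow> Ck n U (u i)"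
  shows "Ck n U (\<lambda>h x. \<Sum>i\<in>I. u i h x)"
  using assms by (induction I rule: infinite_finite_induct) (simp_all add: Ck_const Ck_add)

text \<open>The maps $x \mapsto D^k g(p(x))(u_0(x), \dots, u_{k-1}(x))$ are stable under differentiation up to
  finite sums, which is all that is needed for an induction on \<open>n\<close> over all \<open>k\<close>, \<open>p\<close> and \<open>u\<close> at
  once.  The case $k = 0$ is the smoothness of composites, the case $k = 1$ that of the tangent map.\<close>

lemma Ck_iter_compose:
  fixes g :: "'b::locally_convex_space \<Rightarrow> 'c::locally_convex_space" and U :: "'a::locally_convex_space set"
  assumes g: "smooth V g" "open V"
  shows "Ck n U p \<Longrightarrow> (\<And>i. Ck n U (u i)) \<Longrightarrow> (\<And>x h. x \<in> U \<Longrightarrow> p h x \<in> V) \<Longrightarrow>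
    Ck n U (\<lambda>h x. iter_dirderiv g k (\<lambda>i. u i h x) (p h x))"
proof (induction n arbitrary: k p u)
  case 0
  have "continuous_on (U \<times> UNIV) (\<lambda>z. iter_dirderiv g k (\<lambda>i. u i (snd z) (fst z)) (p (snd z) (fst z)))"
    using Ck_imp_continuous[OF 0(1)] Ck_imp_continuous[OF 0(2)] 0(3)
    by (intro continuous_on_iter_compose[OF g(1)]) (auto simp: case_prod_unfold)
  then show ?case by (simp add: case_prod_unfold)
next
  case (Suc n)
  have c: "continuous_on (U \<times> UNIV) (\<lambda>z. iter_dirderiv g k (\<lambda>i. u i (snd z) (fst z)) (p (snd z) (fst z)))"
    using Ck_imp_continuous[OF Suc.prems(1)] Ck_imp_continuous[OF Suc.prems(2)] Suc.prems(3)
    by (intro continuous_on_iter_compose[OF g(1)]) (auto simp: case_prod_unfold)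
  obtain p' where p': "\<And>x h. x \<in> U \<Longrightarrow> has_dirderiv (p (\<lambda>i. h (Suc i))) x (h 0) (p' h x)"
    "Ck n U p'"
    using Suc.prems(1) by auto
  have "\<forall>i. \<exists>u'. (\<forall>x\<in>U. \<forall>h. has_dirderiv (u i (\<lambda>i. h (Suc i))) x (h 0) (u' h x)) \<and> Ck n U u'"
    using Suc.prems(2) by auto
  from choice[OF this] obtain u' where
    "\<forall>i. (\<forall>x\<in>U. \<forall>h. has_dirderiv (u i (\<lambda>i. h (Suc i))) x (h 0) (u' i h x)) \<and> Ck n U (u' i)"
    by blast
  then have u': "\<And>i x h. x \<in> U \<Longrightarrow> has_dirderiv (u i (\<lambda>i. h (Suc i))) x (h 0) (u' i h x)"
    "\<And>i. Ck n U (u' i)" by auto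
  define S where "S h = (\<lambda>i. h (Suc i))" for h :: "nat \<Rightarrow> 'a"
  have pS: "Ck n U (\<lambda>h. p (S h))" unfolding S_def by (rule Ck_reindex[OF Ck_lower[OF Suc.prems(1)]])
  have uS: "Ck n U (\<lambda>h. u i (S h))" for i unfolding S_def by (rule Ck_reindex[OF Ck_lower[OF Suc.prems(2)]])
  have in_V: "p (S h) x \<in> V" if "x \<in> U" for x h using Suc.prems(3)[OF that] .
  let ?d = "\<lambda>h x. iter_dirderiv g (Suc k) (\<lambda>i. if i = k then p' h x else u i (S h) x) (p (S h) x)
      + (\<Sum>i<k. iter_dirderiv g k (\<lambda>l. if l = i then u' i h x else u l (S h) x) (p (S h) x))"
  show ?case
  proof (rule Ck_SucI[where u'="?d"])
    show "continuous_on (U \<times> UNIV) (\<lambda>(x, h). iter_dirderiv g k (\<lambda>i. u i h x) (p h x))"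
      using c by (simp add: case_prod_unfold)
    show "has_dirderiv (\<lambda>x. iter_dirderiv g k (\<lambda>i. u i (\<lambda>i. h (Suc i)) x) (p (\<lambda>i. h (Suc i)) x)) x (h 0) (?d h x)"
      if x: "x \<in> U" for x h
    proof -
      have "has_dirderiv (\<lambda>t. iter_dirderiv g k (\<lambda>i. u i (S h) (x + t *\<^sub>R h 0)) (p (S h) (x + t *\<^sub>R h 0))) 0 1
        (iter_dirderiv g (Suc k) ((\<lambda>i. u i (S h) (x + 0 *\<^sub>R h 0))(k := p' h x)) (p (S h) (x + 0 *\<^sub>R h 0))
          + (\<Sum>i<k. iter_dirderiv g k ((\<lambda>i. u i (S h) (x + 0 *\<^sub>R h 0))(i := u' i h x)) (p (S h) (x + 0 *\<^sub>R h 0))))"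
      proof (rule has_dirderiv_iter_curve[OF g])
        show "has_dirderiv (\<lambda>t. p (S h) (x + t *\<^sub>R h 0)) 0 1 (p' h x)"
          using p'(1)[OF x, of h] by (simp only: S_def has_dirderiv_curve[of _ x])
        show "has_dirderiv (\<lambda>t. u i (S h) (x + t *\<^sub>R h 0)) 0 1 (u' i h x)" for i
          using u'(1)[OF x, of i h] by (simp only: S_def has_dirderiv_curve[of _ x])
        show "p (S h) (x + 0 *\<^sub>R h 0) \<in> V" using in_V[OF x, of h] by simp
      qed
      then have "has_dirderiv (\<lambda>t. iter_dirderiv g k (\<lambda>i. u i (S h) (x + t *\<^sub>R h 0)) (p (S h) (x + t *\<^sub>R h 0))) 0 1 (?d h x)"
        by (simp only: fun_upd_def scaleR_zero_left add_0_right)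
      then show ?thesis by (subst has_dirderiv_curve) (simp only: S_def)
    qed
    show "Ck n U ?d"
    proof (intro Ck_add Ck_sum)
      have "Ck n U (\<lambda>h x. if i = k then p' h x else u i (S h) x)" for i
        using p'(2) uS by (cases "i = k") simp_all
      from Suc.IH[OF pS, of "\<lambda>i h x. if i = k then p' h x else u i (S h) x", OF this in_V]
      show "Ck n U (\<lambda>h x. iter_dirderiv g (Suc k) (\<lambda>i. if i = k then p' h x else u i (S h) x) (p (S h) x))" .
      fix i
      have "Ck n U (\<lambda>h x. if l = i then u' i h x else u l (S h) x)" for l
        using u'(2) uS by (cases "l = i") simp_all
      from Suc.IH[OF pS, of "\<lambda>l h x. if l = i then u' i h x else u l (S h) x", OF this in_V]
      show "Ck n U (\<lambda>h x. iter_dirderiv g k (\<lambda>l. if l = i then u' i h x else u l (S h) x) (p (S h) x))" .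
    qed
  qed
qed

lemma continuous_on_iter_reindex:
  assumes "smooth U f"
  shows "continuous_on (U \<times> UNIV) (\<lambda>(x, h). iter_dirderiv f j (\<lambda>i. h (s i)) x)"
  unfolding case_prod_unfold
proof (rule continuous_on_iter_compose[OF assms])
  show "continuous_on (U \<times> UNIV) (\<lambda>x. snd x (s i))" for i
    by (rule continuous_on_fun_apply, rule continuous_on_snd, rule continuous_on_id)
qed (auto intro: continuous_on_fst continuous_on_id)

text \<open>The parameters are consumed from the front, so the most recent direction of differentiation is
  \<open>h 0\<close>; hence the reversal of the sequence of directions.\<close>

lemma Ck_iter:
  assumes "smooth U f"
  shows "Ck n U (\<lambda>h. iter_dirderiv f j (\<lambda>i. h (j - Suc i)))"
proof (induction n arbitrary: j)
  case 0
  show ?case using continuous_on_iter_reindex[OF assms] by simp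
next
  case (Suc n)
  show ?case
  proof (rule Ck_SucI[OF _ _ Suc.IH[of "Suc j"]])
    show "continuous_on (U \<times> UNIV) (\<lambda>(x, h). iter_dirderiv f j (\<lambda>i. h (j - Suc i)) x)"
      by (rule continuous_on_iter_reindex[OF assms])
    fix x h assume x: "x \<in> U"
    have "iter_dirderiv f j (\<lambda>i. h (Suc (j - Suc i))) = iter_dirderiv f j (\<lambda>i. h (Suc j - Suc i))"
      by (rule iter_dirderiv_cong) (simp add: Suc_diff_Suc)
    then show "has_dirderiv (iter_dirderiv f j (\<lambda>i. h (Suc (j - Suc i)))) x (h 0)
        (iter_dirderiv f (Suc j) (\<lambda>i. h (Suc j - Suc i)) x)"
      using smoothD(1)[OF assms x, of j "\<lambda>i. h (Suc j - Suc i)"] by simp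
  qed
qed

lemma smooth_imp_Ck: "smooth U f \<Longrightarrow> Ck n U (\<lambda>h. f)"
  using Ck_iter[of U f n 0] by (simp add: iter_dirderiv_0)

text \<open>The derivative families provided by different orders \<open>n\<close> are all equal to the iterated directional
  derivatives, as limits are unique.\<close>

lemma Ck_imp_smooth:
  assumes U: "open U" and f: "\<And>n. Ck n U (\<lambda>h. f)"
  shows "smooth U f"
proof -
  let ?I = "\<lambda>j h. iter_dirderiv f j (\<lambda>i. h (j - Suc i))"
  have ex: "\<exists>u. Ck n U u \<and> (\<forall>x\<in>U. \<forall>h. ?I j h x = u h x)" for j n
  proof (induction j arbitrary: n)
    case 0
    then show ?case using f by auto
  next
    case (Suc j)
    from Suc[of "Suc n"] obtain u where u: "Ck (Suc n) U u" "\<And>x h. x \<in> U \<Longrightarrow> ?I j h x = u h x" by blast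
    obtain u' where u': "\<And>x h. x \<in> U \<Longrightarrow> has_dirderiv (u (\<lambda>i. h (Suc i))) x (h 0) (u' h x)"
      "Ck n U u'" using u(1) by auto
    have "?I (Suc j) h x = u' h x" if x: "x \<in> U" for x h
    proof -
      have "iter_dirderiv f j (\<lambda>i. h (Suc (j - Suc i))) = iter_dirderiv f j (\<lambda>i. h (Suc j - Suc i))"
        by (rule iter_dirderiv_cong) (simp add: Suc_diff_Suc)
      moreover have e: "iter_dirderiv f j (\<lambda>i. h (Suc (j - Suc i))) y = u (\<lambda>i. h (Suc i)) y" if "y \<in> U" for y
        using u(2)[OF that, of "\<lambda>i. h (Suc i)"] by simp
      ultimately have "has_dirderiv (iter_dirderiv f j (\<lambda>i. h (Suc j - Suc i))) x (h 0) (u' h x)"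
        using u'(1)[OF x, of h] has_dirderiv_cong[OF U x e] by simp
      from dirderiv_eqI[OF this] show ?thesis by simp
    qed
    then show ?case using u'(2) by blast
  qed
  have eq: "iter_dirderiv f j h = ?I j (\<lambda>i. h (j - Suc i))" for j h
    by (rule iter_dirderiv_cong) simp
  show ?thesis
    unfolding smooth_on_def
  proof (intro allI conjI ballI impI)
    fix j x and h :: "nat \<Rightarrow> 'a" assume x: "x \<in> U"
    from ex[of "Suc 0" j] obtain u where u: "Ck (Suc 0) U u" "\<And>x h. x \<in> U \<Longrightarrow> ?I j h x = u h x" by blast
    obtain u' where u': "\<And>x h. x \<in> U \<Longrightarrow> has_dirderiv (u (\<lambda>i. h (Suc i))) x (h 0) (u' h x)"
      using u(1) by auto
    have e: "?I j (\<lambda>i. h (j - Suc i)) y = u (\<lambda>i. h (j - Suc i)) y" if "y \<in> U" for y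
      using u(2)[OF that, of "\<lambda>i. h (j - Suc i)"] .
    have "has_dirderiv (?I j (\<lambda>i. h (j - Suc i))) x (h j) (u' (\<lambda>i. h (j - i)) x)"
      using u'[OF x, of "\<lambda>i. h (j - i)"] has_dirderiv_cong[OF U x e] by simp
    then show "\<exists>l. has_dirderiv (iter_dirderiv f j h) x (h j) l"
      unfolding eq[of j h] by blast
  next
    fix j
    from ex[of 0 j] obtain u where u: "Ck 0 U u" "\<And>x h. x \<in> U \<Longrightarrow> ?I j h x = u h x" by blast
    from continuous_on_family_reindex[OF Ck_imp_continuous[OF u(1)], of "\<lambda>i. j - Suc i"]
    have "continuous_on (U \<times> UNIV) (\<lambda>(x, h). iter_dirderiv f j h x)"
    proof (rule continuous_on_eq)
      fix z :: "'a \<times> (nat \<Rightarrow> 'a)" assume "z \<in> U \<times> UNIV"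
      then show "(case z of (x, h) \<Rightarrow> u (\<lambda>i. h (j - Suc i)) x) = (case z of (x, h) \<Rightarrow> iter_dirderiv f j h x)"
        using u(2)[of "fst z" "\<lambda>i. snd z (j - Suc i)"] eq[of j "snd z"] by (auto simp: case_prod_unfold)
    qed
    then show "continuous_on (U \<times> {h. \<forall>i. h i \<in> UNIV}) (\<lambda>(x, h). iter_dirderiv f j h x)"
      by simp
  qed auto
qed

section \<open>Smooth maps on open sets\<close>

lemma smooth_compose:
  assumes g: "smooth V g" "open V" and f: "smooth U f" "open U" and fV: "\<And>x. x \<in> U \<Longrightarrow> f x \<in> V"
  shows "smooth U (\<lambda>x. g (f x))"
proof (rule Ck_imp_smooth[OF f(2)])
  show "Ck n U (\<lambda>h x. g (f x))" for n
    using Ck_iter_compose[OF g smooth_imp_Ck[OF f(1)] Ck_const[of _ _ 0] fV, of n 0]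
    by (simp add: iter_dirderiv_0)
qed

lemma smooth_dirderiv:
  assumes f: "smooth U f" "open U"
  shows "smooth (U \<times> UNIV) (\<lambda>z. dirderiv f (fst z) (snd z))"
proof (rule Ck_imp_smooth)
  show "open (U \<times> (UNIV :: 'a set))" using f(2) by (simp add: open_Times)
  fix n
  have "Ck n (U \<times> UNIV) (\<lambda>h (x::'a \<times> 'a). fst x)" "Ck n (U \<times> UNIV) (\<lambda>h (x::'a \<times> 'a). snd x)"
    by (rule Ck_linear_comp[OF linear_fst continuous_on_fst[OF continuous_on_id] Ck_id],
        rule Ck_linear_comp[OF linear_snd continuous_on_snd[OF continuous_on_id] Ck_id])
  note c = Ck_iter_compose[OF f this, of 1]
  have "fst x \<in> U" if "x \<in> U \<times> UNIV" for x :: "'a \<times> 'a" using that by auto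
  from c[OF this] show "Ck n (U \<times> UNIV) (\<lambda>h x. dirderiv f (fst x) (snd x))"
    by (simp add: iter_dirderiv_0)
qed

lemma smooth_Pair:
  assumes "smooth U f" "smooth U g" "open U"
  shows "smooth U (\<lambda>x. (f x, g x))"
  by (rule Ck_imp_smooth[OF assms(3) Ck_Pair[OF smooth_imp_Ck[OF assms(1)] smooth_imp_Ck[OF assms(2)]]])

lemma smooth_const: "open U \<Longrightarrow> smooth U (\<lambda>x. a)"
  by (rule Ck_imp_smooth[OF _ Ck_const])

lemma smooth_linear_comp: "open U \<Longrightarrow> linear L \<Longrightarrow> continuous_on UNIV L \<Longrightarrow> smooth U f \<Longrightarrow> smooth U (\<lambda>x. L (f x))"
  by (rule Ck_imp_smooth, assumption, rule Ck_linear_comp, assumption, assumption, rule smooth_imp_Ck)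

lemma smooth_id: "open U \<Longrightarrow> smooth U (\<lambda>x. x)"
  by (rule Ck_imp_smooth[OF _ Ck_id])

lemma smooth_fst: "open U \<Longrightarrow> smooth U f \<Longrightarrow> smooth U (\<lambda>x. fst (f x))"
  by (rule smooth_linear_comp[OF _ linear_fst continuous_on_fst[OF continuous_on_id]])

lemma smooth_snd: "open U \<Longrightarrow> smooth U f \<Longrightarrow> smooth U (\<lambda>x. snd (f x))"
  by (rule smooth_linear_comp[OF _ linear_snd continuous_on_snd[OF continuous_on_id]])

lemma smooth_add:
  assumes "smooth U f" "smooth U g" "open U"
  shows "smooth U (\<lambda>x. f x + g x)"
  by (rule Ck_imp_smooth[OF assms(3) Ck_add[OF smooth_imp_Ck[OF assms(1)] smooth_imp_Ck[OF assms(2)]]])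

lemma smooth_minus: "open U \<Longrightarrow> smooth U f \<Longrightarrow> smooth U (\<lambda>x. - f x)"
  by (rule smooth_linear_comp[OF _ linear_uminus continuous_on_minus[OF continuous_on_id]])

lemma smooth_diff:
  assumes "smooth U f" "smooth U g" "open U"
  shows "smooth U (\<lambda>x. f x - g x)"
  using smooth_add[OF assms(1) smooth_minus[OF assms(3,2)] assms(3)] by simp

lemma smooth_imp_continuous_on: "smooth U f \<Longrightarrow> continuous_on U f"
  using continuous_on_iter_compose[of U f U "\<lambda>x. x" "\<lambda>i x. 0" 0] by (simp add: iter_dirderiv_0)

lemma smooth_C1:
  assumes "smooth U f" "open U"
  shows "C1_on U f (dirderiv f)"
  using C1_on_iter[OF assms, of 0] by (simp add: iter_dirderiv_0)

lemma smooth_subset: "smooth U f \<Longrightarrow> V \<subseteq> U \<Longrightarrow> smooth V f"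
  unfolding smooth_on_def by (meson continuous_on_subset Sigma_mono subset_refl subsetD)

lemma smooth_local:
  assumes "\<And>x. x \<in> U \<Longrightarrow> \<exists>V. open V \<and> x \<in> V \<and> smooth V f"
  shows "smooth U f"
  unfolding smooth_on_def
proof (intro allI conjI ballI impI)
  fix j x and h :: "nat \<Rightarrow> 'a" assume "x \<in> U"
  then obtain V where "x \<in> V" "smooth V f" using assms by blast
  from smoothD(1)[OF this(2,1)] show "\<exists>l. has_dirderiv (iter_dirderiv f j h) x (h j) l" by blast
next
  fix j
  let ?A = "{V. open V \<and> smooth V f}"
  have "continuous_on (\<Union>V\<in>?A. V \<times> UNIV) (\<lambda>(x, h). iter_dirderiv f j h x)"
    by (rule continuous_on_open_UN) (auto simp: open_Times intro: smoothD(2))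
  moreover have "U \<times> {h. \<forall>i. h i \<in> UNIV} \<subseteq> (\<Union>V\<in>?A. V \<times> UNIV)"
    using assms by fastforce
  ultimately show "continuous_on (U \<times> {h. \<forall>i. h i \<in> UNIV}) (\<lambda>(x, h). iter_dirderiv f j h x)"
    by (rule continuous_on_subset)
qed auto

text \<open>The iterated derivatives make no reference to the subspace \<open>E\<close>, and limits of difference
  quotients with values in a closed subspace \<open>F\<close> remain in \<open>F\<close>.  Smoothness on a closed subspace can
  thus be checked in the surrounding space, where the domain is open.\<close>

lemma smooth_on_restrict:
  assumes f: "smooth V f" "open V" and E: "subspace E" and F: "subspace F" "closed F"
    and g: "\<And>x. x \<in> V \<Longrightarrow> x \<in> E \<Longrightarrow> g x = f x \<and> f x \<in> F"
  shows "smooth_on E F (V \<inter> E) g"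
proof -
  have ev: "\<forall>\<^sub>F t::real in at 0. x + t *\<^sub>R h \<in> V \<inter> E" if "x \<in> V \<inter> E" "h \<in> E" for x h
    using eventually_line_in[OF f(2), of x h] that E
    by (auto simp: subspace_add subspace_scale elim: eventually_mono)
  have transfer: "has_dirderiv p x k l"
    if "has_dirderiv q x k l" "x \<in> V \<inter> E" "k \<in> E" "\<And>y. y \<in> V \<inter> E \<Longrightarrow> p y = q y" for p q x k l
  proof -
    have "\<forall>\<^sub>F t::real in at 0. p (x + t *\<^sub>R k) = q (x + t *\<^sub>R k)"
      using ev[OF that(2,3)] by (rule eventually_mono) (rule that(4))
    from has_dirderiv_cong_ev[OF this that(4)[OF that(2)]] that(1) show ?thesis by simp
  qed
  have main: "iter_dirderiv g j h x = iter_dirderiv f j h x \<and> iter_dirderiv f j h x \<in> F \<and>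
      has_dirderiv (iter_dirderiv g j h) x (h j) (iter_dirderiv f (Suc j) h x)"
    if "x \<in> V \<inter> E" "\<And>i. h i \<in> E" for j x h
    using that(1)
  proof (induction j arbitrary: x)
    case 0
    have "has_dirderiv f x (h 0) (iter_dirderiv f (Suc 0) h x)"
      using smoothD(1)[OF f(1), of x 0 h] 0 by (simp add: iter_dirderiv_0)
    then have "has_dirderiv g x (h 0) (iter_dirderiv f (Suc 0) h x)"
      by (rule transfer[OF _ 0 that(2)]) (use g in auto)
    then show ?case using g 0 by (simp add: iter_dirderiv_0)
  next
    case (Suc j)
    have eqF: "iter_dirderiv g (Suc j) h y = iter_dirderiv f (Suc j) h y \<and> iter_dirderiv f (Suc j) h y \<in> F"
      if "y \<in> V \<inter> E" for y
    proof -
      note D = conjunct2[OF conjunct2[OF Suc.IH[OF that]]]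
      have "iter_dirderiv f (Suc j) h y \<in> F"
      proof (rule Lim_in_closed_set[OF F(2) _ at_neq_bot D[unfolded has_dirderiv_def]])
        show "\<forall>\<^sub>F t in at 0. (1 / t) *\<^sub>R (iter_dirderiv g j h (y + t *\<^sub>R h j) - iter_dirderiv g j h y) \<in> F"
          using ev[OF that \<open>\<And>i. h i \<in> E\<close>[of j]]
        proof eventually_elim
          case (elim t)
          then show ?case using Suc.IH[OF elim] Suc.IH[OF that] F(1)
            by (auto intro!: subspace_scale subspace_diff)
        qed
      qed
      then show ?thesis using dirderiv_eqI[OF D] by simp
    qed
    have "has_dirderiv (iter_dirderiv g (Suc j) h) x (h (Suc j)) (iter_dirderiv f (Suc (Suc j)) h x)"
      by (rule transfer[OF smoothD(1)[OF f(1)] Suc.prems that(2)]) (use Suc.prems eqF in blast)+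
    then show ?case using eqF Suc.prems by blast
  qed
  show ?thesis
    unfolding smooth_on_def
  proof (intro allI conjI ballI impI)
    fix j
    have "continuous_on ((V \<inter> E) \<times> {h. \<forall>i. h i \<in> E}) (\<lambda>(x, h). iter_dirderiv f j h x)"
      by (rule continuous_on_subset[OF smoothD(2)[OF f(1), of j]]) auto
    then show "continuous_on ((V \<inter> E) \<times> {h. \<forall>i. h i \<in> E}) (\<lambda>(x, h). iter_dirderiv g j h x)"
      by (rule continuous_on_eq) (use main in auto)
    fix x and h :: "nat \<Rightarrow> 'a" assume "x \<in> V \<inter> E" "\<forall>i. h i \<in> E"
    then have "iter_dirderiv g j h x = iter_dirderiv f j h x \<and> iter_dirderiv f j h x \<in> F \<and>
      has_dirderiv (iter_dirderiv g j h) x (h j) (iter_dirderiv f (Suc j) h x)" by (intro main) auto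
    then show "iter_dirderiv g j h x \<in> F" "\<exists>l. has_dirderiv (iter_dirderiv g j h) x (h j) l" by auto
  qed
qed

lemma smooth_cong:
  assumes "smooth U f" "open U" "\<And>x. x \<in> U \<Longrightarrow> g x = f x"
  shows "smooth U g"
  using smooth_on_restrict[OF assms(1,2), of UNIV UNIV g] assms(3) by (simp add: subspace_UNIV)


section \<open>Manifolds modelled on a whole space\<close>

text \<open>The topological part of the notion of a manifold; compatibility of the charts enters separately,
  where the identity and the projections are shown to be smooth.\<close>

definition charted :: "('p, 'e::locally_convex_space) mfd \<Rightarrow> bool" where
  "charted M \<longleftrightarrow> model M = UNIV \<and> \<Union> (fst ` atlas M) = topspace (mtop M) \<and>
     (\<forall>(U, \<phi>)\<in>atlas M. openin (mtop M) U \<and> open (\<phi> ` U) \<and>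
        homeomorphic_map (subtopology (mtop M) U) (top_of_set (\<phi> ` U)) \<phi>)"

lemma manifold_imp_charted: "manifold M \<Longrightarrow> model M = UNIV \<Longrightarrow> charted M"
  unfolding manifold_def charted_def by (auto simp: openin_open_eq)

lemma chartedD:
  assumes "charted M" "(U, \<phi>) \<in> atlas M"
  shows "openin (mtop M) U" "open (\<phi> ` U)"
    "homeomorphic_map (subtopology (mtop M) U) (top_of_set (\<phi> ` U)) \<phi>"
  using assms unfolding charted_def by auto

lemma charted_cover:
  assumes "charted M" "p \<in> topspace (mtop M)"
  obtains U \<phi> where "(U, \<phi>) \<in> atlas M" "p \<in> U"
  using assms unfolding charted_def by force

lemma charted_model: "charted M \<Longrightarrow> model M = UNIV"
  by (simp add: charted_def)

lemma chart_subset: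
  assumes "charted M" "(U, \<phi>) \<in> atlas M"
  shows "U \<subseteq> topspace (mtop M)"
  using openin_subset[OF chartedD(1)[OF assms]] .

lemma chart_inj:
  assumes "charted M" "(U, \<phi>) \<in> atlas M"
  shows "inj_on \<phi> U"
  using homeomorphic_imp_injective_map[OF chartedD(3)[OF assms]] chart_subset[OF assms]
  by (simp add: inf.absorb2)

lemma chart_inv_left:
  assumes "charted M" "(U, \<phi>) \<in> atlas M" "p \<in> U"
  shows "chart_inv (U, \<phi>) (\<phi> p) = p"
  unfolding chart_inv_def using chart_inj[OF assms(1,2)] assms(3) by simp

lemma chart_inv_right: "x \<in> \<phi> ` U \<Longrightarrow> \<phi> (chart_inv (U, \<phi>) x) = x"
  by (simp add: chart_inv_def f_inv_into_f)

lemma chart_inv_into: "x \<in> \<phi> ` U \<Longrightarrow> chart_inv (U, \<phi>) x \<in> U"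
  by (simp add: chart_inv_def inv_into_into)

lemma chart_open_image:
  assumes "charted M" "(U, \<phi>) \<in> atlas M" "openin (mtop M) V" "V \<subseteq> U"
  shows "open (\<phi> ` V)"
proof -
  have "openin (subtopology (mtop M) U) V"
    using assms(3,4) by (simp add: openin_subset_topspace_eq openin_subtopology_Int2 openin_subtopology inf.absorb1) blast
  then have "openin (top_of_set (\<phi> ` U)) (\<phi> ` V)"
    using homeomorphic_imp_open_map[OF chartedD(3)[OF assms(1,2)]] unfolding open_map_def by blast
  then show ?thesis using chartedD(2)[OF assms(1,2)] by (simp add: openin_open_eq)
qed

lemma openin_chart_preimage:
  assumes "charted M" "(U, \<phi>) \<in> atlas M" "continuous_map (mtop M) X f" "openin X W"
  shows "openin (mtop M) {p \<in> U. f p \<in> W}"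
proof -
  have "{p \<in> U. f p \<in> W} = U \<inter> {p \<in> topspace (mtop M). f p \<in> W}"
    using chart_subset[OF assms(1,2)] by auto
  then show ?thesis
    using openin_Int[OF chartedD(1)[OF assms(1,2)] openin_continuous_map_preimage[OF assms(3,4)]] by simp
qed

lemma smooth_mapD_chart:
  assumes f: "smooth_map M N f" and M: "charted M" "(U, \<phi>) \<in> atlas M" and N: "charted N" "(W, \<psi>) \<in> atlas N"
  shows "smooth {x \<in> \<phi> ` U. f (chart_inv (U, \<phi>) x) \<in> W} (\<lambda>x. \<psi> (f (chart_inv (U, \<phi>) x)))"
    and "open {x \<in> \<phi> ` U. f (chart_inv (U, \<phi>) x) \<in> W}"
proof -
  have eq: "{x \<in> \<phi> ` U. f (chart_inv (U, \<phi>) x) \<in> W} = \<phi> ` {p \<in> U. f p \<in> W}"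
    using chart_inv_left[OF M] by auto
  have "smooth_on UNIV UNIV (\<phi> ` {p \<in> U. f p \<in> W}) (\<psi> \<circ> f \<circ> chart_inv (U, \<phi>))"
    using f M(2) N(2) charted_model[OF M(1)] charted_model[OF N(1)] unfolding smooth_map_def by auto
  then show "smooth {x \<in> \<phi> ` U. f (chart_inv (U, \<phi>) x) \<in> W} (\<lambda>x. \<psi> (f (chart_inv (U, \<phi>) x)))"
    unfolding eq by (simp only: comp_def)
  have "continuous_map (mtop M) (mtop N) f" using f by (simp add: smooth_map_def)
  then show "open {x \<in> \<phi> ` U. f (chart_inv (U, \<phi>) x) \<in> W}"
    unfolding eq
    by (rule chart_open_image[OF M openin_chart_preimage[OF M _ chartedD(1)[OF N]]]) auto
qed

lemma smooth_mapI_chart: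
  assumes "charted M" "charted N" "continuous_map (mtop M) (mtop N) f"
    and "\<And>U \<phi> W \<psi>. (U, \<phi>) \<in> atlas M \<Longrightarrow> (W, \<psi>) \<in> atlas N \<Longrightarrow>
      open {x \<in> \<phi> ` U. f (chart_inv (U, \<phi>) x) \<in> W} \<Longrightarrow>
      smooth {x \<in> \<phi> ` U. f (chart_inv (U, \<phi>) x) \<in> W} (\<lambda>x. \<psi> (f (chart_inv (U, \<phi>) x)))"
  shows "smooth_map M N f"
  unfolding smooth_map_def
proof (intro conjI assms(3) ballI, clarify)
  fix U \<phi> W \<psi> assume c: "(U, \<phi>) \<in> atlas M" "(W, \<psi>) \<in> atlas N"
  have eq: "{x \<in> \<phi> ` U. f (chart_inv (U, \<phi>) x) \<in> W} = \<phi> ` {p \<in> U. f p \<in> W}"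
    using chart_inv_left[OF assms(1) c(1)] by auto
  have "open {x \<in> \<phi> ` U. f (chart_inv (U, \<phi>) x) \<in> W}"
    unfolding eq using chartedD(1)[OF assms(2) c(2)] assms(3)
    by (intro chart_open_image[OF assms(1) c(1)] openin_chart_preimage[OF assms(1) c(1)]) auto
  from assms(4)[OF c this]
  show "smooth_on (model M) (model N) (\<phi> ` {p \<in> U. f p \<in> W}) (\<psi> \<circ> f \<circ> chart_inv (U, \<phi>))"
    unfolding eq by (simp add: comp_def charted_model[OF assms(1)] charted_model[OF assms(2)])
qed

text \<open>Around each point a chart of the middle manifold is inserted.\<close>

lemma smooth_map_compose:
  assumes M: "charted M" and N: "charted N" and P: "charted P"
    and f: "smooth_map M N f" and g: "smooth_map N P g"
  shows "smooth_map M P (\<lambda>p. g (f p))"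
proof (rule smooth_mapI_chart[OF M P])
  have cf: "continuous_map (mtop M) (mtop N) f" using f by (simp add: smooth_map_def)
  have cg: "continuous_map (mtop N) (mtop P) g" using g by (simp add: smooth_map_def)
  show cgf: "continuous_map (mtop M) (mtop P) (\<lambda>p. g (f p))"
    using continuous_map_compose[OF cf cg] by (simp add: comp_def)
  fix U \<phi> W \<psi> assume c: "(U, \<phi>) \<in> atlas M" "(W, \<psi>) \<in> atlas P"
  let ?i = "chart_inv (U, \<phi>)"
  assume o: "open {x \<in> \<phi> ` U. g (f (?i x)) \<in> W}"
  show "smooth {x \<in> \<phi> ` U. g (f (?i x)) \<in> W} (\<lambda>x. \<psi> (g (f (?i x))))"
  proof (rule smooth_local)
    fix x assume x: "x \<in> {x \<in> \<phi> ` U. g (f (?i x)) \<in> W}"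
    then have "f (?i x) \<in> topspace (mtop N)"
      using chart_inv_into[of x \<phi> U] chart_subset[OF M c(1)] continuous_map_image_subset_topspace[OF cf] by auto
    then obtain V \<theta> where V: "(V, \<theta>) \<in> atlas N" "f (?i x) \<in> V" using charted_cover[OF N] by blast
    let ?S = "{x \<in> \<phi> ` U. f (?i x) \<in> V}"
    let ?T = "{y \<in> \<theta> ` V. g (chart_inv (V, \<theta>) y) \<in> W}"
    let ?O = "{x \<in> \<phi> ` U. g (f (?i x)) \<in> W} \<inter> ?S"
    have "open ?O" using o smooth_mapD_chart(2)[OF f M c(1) N V(1)] by auto
    moreover have "x \<in> ?O" using x V(2) by auto
    moreover have "smooth ?O (\<lambda>x. \<psi> (g (f (?i x))))"
    proof (rule smooth_cong)
      show "smooth ?O (\<lambda>x. (\<lambda>y. \<psi> (g (chart_inv (V, \<theta>) y))) (\<theta> (f (?i x))))"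
      proof (rule smooth_compose[OF smooth_mapD_chart[OF g N V(1) P c(2)]])
        show "smooth ?O (\<lambda>x. \<theta> (f (?i x)))"
          by (rule smooth_subset[OF smooth_mapD_chart(1)[OF f M c(1) N V(1)]]) auto
        show "open ?O" by fact
        show "\<theta> (f (?i x)) \<in> ?T" if "x \<in> ?O" for x
          using that chart_inv_left[OF N V(1)] by auto
      qed
      show "open ?O" by fact
      show "\<psi> (g (f (?i x))) = \<psi> (g (chart_inv (V, \<theta>) (\<theta> (f (?i x)))))" if "x \<in> ?O" for x
        using that chart_inv_left[OF N V(1)] by auto
    qed
    ultimately show "\<exists>V. open V \<and> x \<in> V \<and> smooth V (\<lambda>x. \<psi> (g (f (?i x))))" by blast
  qed
qed

lemma prod_mfd_simps:
  "mtop (prod_mfd M N) = prod_topology (mtop M) (mtop N)"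
  "model (prod_mfd M N) = model M \<times> model N"
  "atlas (prod_mfd M N) =
     {(U \<times> W, map_prod \<phi> \<psi>) |U \<phi> W \<psi>. (U, \<phi>) \<in> atlas M \<and> (W, \<psi>) \<in> atlas N}"
  by (simp_all add: prod_mfd_def)

lemma charted_prod:
  assumes M: "charted M" and N: "charted N"
  shows "charted (prod_mfd M N)"
  unfolding charted_def prod_mfd_simps
proof (intro conjI)
  show "model M \<times> model N = UNIV" using M N by (simp add: charted_def)
  show "\<Union> (fst ` {(U \<times> W, map_prod \<phi> \<psi>) |U \<phi> W \<psi>. (U, \<phi>) \<in> atlas M \<and> (W, \<psi>) \<in> atlas N})
      = topspace (prod_topology (mtop M) (mtop N))"
  proof (intro equalityI subsetI)
    fix z assume "z \<in> topspace (prod_topology (mtop M) (mtop N))"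
    then have z: "fst z \<in> topspace (mtop M)" "snd z \<in> topspace (mtop N)" by auto
    obtain U \<phi> where "(U, \<phi>) \<in> atlas M" "fst z \<in> U" using charted_cover[OF M z(1)] .
    moreover obtain W \<psi> where "(W, \<psi>) \<in> atlas N" "snd z \<in> W" using charted_cover[OF N z(2)] .
    ultimately have "(U \<times> W, map_prod \<phi> \<psi>) \<in> {(U \<times> W, map_prod \<phi> \<psi>) |U \<phi> W \<psi>. (U, \<phi>) \<in> atlas M \<and> (W, \<psi>) \<in> atlas N}"
      "z \<in> fst (U \<times> W, map_prod \<phi> \<psi>)" by (blast, simp add: mem_Times_iff)
    then show "z \<in> \<Union> (fst ` {(U \<times> W, map_prod \<phi> \<psi>) |U \<phi> W \<psi>. (U, \<phi>) \<in> atlas M \<and> (W, \<psi>) \<in> atlas N})"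
      by (rule UN_I)
  next
    fix z assume "z \<in> \<Union> (fst ` {(U \<times> W, map_prod \<phi> \<psi>) |U \<phi> W \<psi>. (U, \<phi>) \<in> atlas M \<and> (W, \<psi>) \<in> atlas N})"
    then obtain U \<phi> W \<psi> where "(U, \<phi>) \<in> atlas M" "(W, \<psi>) \<in> atlas N" "z \<in> U \<times> W" by auto
    with chart_subset[OF M, of U \<phi>] chart_subset[OF N, of W \<psi>]
    show "z \<in> topspace (prod_topology (mtop M) (mtop N))" by auto
  qed
  show "\<forall>(U, \<phi>)\<in>{(U \<times> W, map_prod \<phi> \<psi>) |U \<phi> W \<psi>. (U, \<phi>) \<in> atlas M \<and> (W, \<psi>) \<in> atlas N}.
      openin (prod_topology (mtop M) (mtop N)) U \<and> open (\<phi> ` U) \<and>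
      homeomorphic_map (subtopology (prod_topology (mtop M) (mtop N)) U) (top_of_set (\<phi> ` U)) \<phi>"
  proof clarify
    fix U \<phi> W \<psi> assume c: "(U, \<phi>) \<in> atlas M" "(W, \<psi>) \<in> atlas N"
    have im: "map_prod \<phi> \<psi> ` (U \<times> W) = \<phi> ` U \<times> \<psi> ` W" by (rule map_prod_image)
    obtain \<phi>' where \<phi>': "homeomorphic_maps (subtopology (mtop M) U) (top_of_set (\<phi> ` U)) \<phi> \<phi>'"
      using chartedD(3)[OF M c(1)] by (auto simp: homeomorphic_map_maps)
    obtain \<psi>' where \<psi>': "homeomorphic_maps (subtopology (mtop N) W) (top_of_set (\<psi> ` W)) \<psi> \<psi>'"
      using chartedD(3)[OF N c(2)] by (auto simp: homeomorphic_map_maps)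
    have h: "homeomorphic_map (prod_topology (subtopology (mtop M) U) (subtopology (mtop N) W))
       (prod_topology (top_of_set (\<phi> ` U)) (top_of_set (\<psi> ` W))) (map_prod \<phi> \<psi>)"
      unfolding homeomorphic_map_maps map_prod_def using \<phi>' \<psi>' homeomorphic_maps_prod by blast
    show "openin (prod_topology (mtop M) (mtop N)) (U \<times> W) \<and> open (map_prod \<phi> \<psi> ` (U \<times> W)) \<and>
      homeomorphic_map (subtopology (prod_topology (mtop M) (mtop N)) (U \<times> W)) (top_of_set (map_prod \<phi> \<psi> ` (U \<times> W))) (map_prod \<phi> \<psi>)"
      unfolding im subtopology_Times prod_topology_subtopology_eu[symmetric]
      using chartedD(1,2)[OF M c(1)] chartedD(1,2)[OF N c(2)] h
      by (simp add: openin_prod_Times_iff open_Times)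
  qed
qed

lemma chart_inv_prod:
  assumes M: "charted M" "(U, \<phi>) \<in> atlas M" and N: "charted N" "(W, \<psi>) \<in> atlas N"
    and z: "x \<in> \<phi> ` U" "y \<in> \<psi> ` W"
  shows "chart_inv (U \<times> W, map_prod \<phi> \<psi>) (x, y) = (chart_inv (U, \<phi>) x, chart_inv (W, \<psi>) y)"
proof -
  from z obtain p q where pq: "p \<in> U" "q \<in> W" "x = \<phi> p" "y = \<psi> q" by blast
  have "(U \<times> W, map_prod \<phi> \<psi>) \<in> atlas (prod_mfd M N)" using M(2) N(2) by (auto simp: prod_mfd_simps)
  from chart_inv_left[OF charted_prod[OF M(1) N(1)] this, of "(p, q)"] pq
  show ?thesis by (simp add: chart_inv_left[OF M] chart_inv_left[OF N])
qed

lemma smooth_map_Pair: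
  assumes M: "charted M" and N: "charted N" and P: "charted P"
    and f: "smooth_map M N f" and g: "smooth_map M P g"
  shows "smooth_map M (prod_mfd N P) (\<lambda>p. (f p, g p))"
proof (rule smooth_mapI_chart[OF M charted_prod[OF N P]])
  show "continuous_map (mtop M) (mtop (prod_mfd N P)) (\<lambda>p. (f p, g p))"
    using f g by (simp add: prod_mfd_simps smooth_map_def continuous_map_pairedI)
  fix U \<phi> W \<psi> assume c: "(U, \<phi>) \<in> atlas M" "(W, \<psi>) \<in> atlas (prod_mfd N P)"
  let ?i = "chart_inv (U, \<phi>)"
  from c(2) obtain W1 \<psi>1 W2 \<psi>2 where W: "W = W1 \<times> W2" "\<psi> = map_prod \<psi>1 \<psi>2"
    "(W1, \<psi>1) \<in> atlas N" "(W2, \<psi>2) \<in> atlas P" by (auto simp: prod_mfd_simps)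
  let ?S = "{x \<in> \<phi> ` U. (f (?i x), g (?i x)) \<in> W}"
  assume o: "open ?S"
  have "smooth ?S (\<lambda>x. \<psi>1 (f (?i x)))"
    by (rule smooth_subset[OF smooth_mapD_chart(1)[OF f M c(1) N W(3)]]) (auto simp: W)
  moreover have "smooth ?S (\<lambda>x. \<psi>2 (g (?i x)))"
    by (rule smooth_subset[OF smooth_mapD_chart(1)[OF g M c(1) P W(4)]]) (auto simp: W)
  ultimately show "smooth ?S (\<lambda>x. \<psi> (f (?i x), g (?i x)))"
    using smooth_Pair[OF _ _ o] by (simp add: W)
qed

text \<open>In charts the identity is a transition map.\<close>

lemma smooth_map_id:
  fixes M :: "('p, 'e::locally_convex_space) mfd"
  assumes "manifold M" "model M = UNIV"
  shows "smooth_map M M (\<lambda>p. p)"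
proof (rule smooth_mapI_chart[OF manifold_imp_charted[OF assms] manifold_imp_charted[OF assms]])
  note M = manifold_imp_charted[OF assms]
  fix U \<phi> W \<psi> assume c: "(U, \<phi>) \<in> atlas M" "(W, \<psi>) \<in> atlas M"
  have "smooth (\<phi> ` (U \<inter> W)) (\<psi> \<circ> chart_inv (U, \<phi>))"
  proof -
    have "\<forall>(U, \<phi>)\<in>atlas M. \<forall>(W, \<psi>)\<in>atlas M.
        smooth (\<phi> ` (U \<inter> W)) (\<psi> \<circ> chart_inv (U, \<phi>))"
      using assms unfolding manifold_def by simp
    with c show ?thesis by auto
  qed
  moreover have "{x \<in> \<phi> ` U. chart_inv (U, \<phi>) x \<in> W} = \<phi> ` (U \<inter> W)"
    using chart_inv_left[OF M c(1)] by auto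
  ultimately show "smooth {x \<in> \<phi> ` U. chart_inv (U, \<phi>) x \<in> W} (\<lambda>x. \<psi> (chart_inv (U, \<phi>) x))"
    by (simp add: comp_def)
qed (simp add: continuous_map_id[unfolded id_def])

lemma smooth_map_const:
  assumes "charted M" "charted N" "a \<in> topspace (mtop N)"
  shows "smooth_map M N (\<lambda>p. a)"
  by (rule smooth_mapI_chart[OF assms(1,2)]) (use assms(3) in \<open>auto intro: smooth_const\<close>)

text \<open>In charts the projection is a transition map after a linear projection.\<close>

lemma smooth_map_fst:
  fixes M :: "('p, 'e::locally_convex_space) mfd"
  assumes M: "manifold M" "model M = UNIV" and N: "charted N"
  shows "smooth_map (prod_mfd M N) M fst"
proof (rule smooth_mapI_chart[OF charted_prod[OF manifold_imp_charted[OF M] N] manifold_imp_charted[OF M]])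
  note cM = manifold_imp_charted[OF M]
  show "continuous_map (mtop (prod_mfd M N)) (mtop M) fst"
    by (simp add: prod_mfd_simps continuous_map_fst)
  fix U \<phi> W \<psi> assume c: "(U, \<phi>) \<in> atlas (prod_mfd M N)" "(W, \<psi>) \<in> atlas M"
  from c(1) obtain U1 \<phi>1 U2 \<phi>2 where U: "U = U1 \<times> U2" "\<phi> = map_prod \<phi>1 \<phi>2"
    "(U1, \<phi>1) \<in> atlas M" "(U2, \<phi>2) \<in> atlas N" by (auto simp: prod_mfd_simps)
  let ?S = "{x \<in> \<phi> ` U. fst (chart_inv (U, \<phi>) x) \<in> W}"
  let ?T = "{x \<in> \<phi>1 ` U1. chart_inv (U1, \<phi>1) x \<in> W}"
  assume o: "open ?S"
  have inv: "fst (chart_inv (U, \<phi>) z) = chart_inv (U1, \<phi>1) (fst z) \<and> fst z \<in> \<phi>1 ` U1" if "z \<in> \<phi> ` U" for z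
    using that chart_inv_prod[OF cM U(3) N U(4), of "fst z" "snd z"] unfolding U(1,2) by (auto simp: map_prod_image)
  have S: "fst z \<in> ?T \<and> fst (chart_inv (U, \<phi>) z) = chart_inv (U1, \<phi>1) (fst z)" if "z \<in> ?S" for z
    using that inv[of z] by simp
  have "smooth ?S (\<lambda>z. (\<lambda>x. \<psi> (chart_inv (U1, \<phi>1) x)) (fst z))"
    by (rule smooth_compose[OF smooth_mapD_chart[OF smooth_map_id[OF M] cM U(3) cM c(2)]
          smooth_fst[OF o smooth_id[OF o]] o]) (rule conjunct1[OF S])
  then show "smooth ?S (\<lambda>x. \<psi> (fst (chart_inv (U, \<phi>) x)))"
    by (rule smooth_cong[OF _ o]) (simp only: conjunct2[OF S])
qed

lemma vec_mfd_simps: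
  "mtop (vec_mfd E) = top_of_set E" "model (vec_mfd E) = E" "atlas (vec_mfd E) = {(E, id)}"
  by (simp_all add: vec_mfd_def)

lemma charted_vec: "charted (vec_mfd (UNIV :: 'e::locally_convex_space set))"
  by (simp add: charted_def vec_mfd_simps homeomorphic_map_id)

lemma chart_inv_vec: "x \<in> E \<Longrightarrow> chart_inv (E, id) x = x"
  by (simp add: chart_inv_def inv_into_f_eq)

lemma continuous_map_from_charts:
  assumes M: "charted M" and f: "\<And>U \<phi>. (U, \<phi>) \<in> atlas M \<Longrightarrow> continuous_on (\<phi> ` U) (\<lambda>x. f (chart_inv (U, \<phi>) x))"
  shows "continuous_map (mtop M) euclidean f"
proof (rule pasting_lemma[where I="atlas M" and T=fst and f="\<lambda>i. f"])
  fix c assume c: "c \<in> atlas M"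
  obtain U \<phi> where cU: "c = (U, \<phi>)" by (cases c)
  note c' = c[unfolded cU]
  show "openin (mtop M) (fst c)" using chartedD(1)[OF M c'] cU by simp
  have "continuous_map (subtopology (mtop M) U) (top_of_set (\<phi> ` U)) \<phi>"
    using chartedD(3)[OF M c'] by (rule homeomorphic_imp_continuous_map)
  moreover have "continuous_map (top_of_set (\<phi> ` U)) euclidean (\<lambda>x. f (chart_inv (U, \<phi>) x))"
    using f[OF c'] by simp
  ultimately have "continuous_map (subtopology (mtop M) U) euclidean ((\<lambda>x. f (chart_inv (U, \<phi>) x)) \<circ> \<phi>)"
    by (rule continuous_map_compose)
  then have "continuous_map (subtopology (mtop M) U) euclidean (\<lambda>p. f (chart_inv (U, \<phi>) (\<phi> p)))"
    by (simp only: comp_def)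
  then show "continuous_map (subtopology (mtop M) (fst c)) euclidean f"
    unfolding cU fst_conv by (rule continuous_map_eq) (simp add: chart_inv_left[OF M c'])
next
  fix p assume "p \<in> topspace (mtop M)"
  then obtain U \<phi> where "(U, \<phi>) \<in> atlas M" "p \<in> U" using charted_cover[OF M] by blast
  then show "\<exists>j. j \<in> atlas M \<and> p \<in> fst j \<and> f p = f p" by force
qed auto

lemma smooth_map_vecI:
  assumes M: "charted M" and f: "\<And>U \<phi>. (U, \<phi>) \<in> atlas M \<Longrightarrow> smooth (\<phi> ` U) (\<lambda>x. f (chart_inv (U, \<phi>) x))"
  shows "smooth_map M (vec_mfd UNIV) f"
proof (rule smooth_mapI_chart[OF M charted_vec])
  show "continuous_map (mtop M) (mtop (vec_mfd UNIV)) f"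
    using continuous_map_from_charts[OF M smooth_imp_continuous_on[OF f]] by (simp add: vec_mfd_simps)
qed (use f in \<open>auto simp: vec_mfd_simps\<close>)

lemma smooth_map_vecD:
  assumes "smooth_map M (vec_mfd UNIV) f" "charted M" "(U, \<phi>) \<in> atlas M"
  shows "smooth (\<phi> ` U) (\<lambda>x. f (chart_inv (U, \<phi>) x))"
  using smooth_mapD_chart(1)[OF assms charted_vec, of UNIV id] by (simp add: vec_mfd_simps)

text \<open>The chart representation of a map of two variables, with the product charts already resolved.\<close>

lemma smooth_mapD_chart2:
  assumes f: "smooth_map (prod_mfd M N) P (\<lambda>(p, q). f p q)"
    and M: "charted M" "(U, \<phi>) \<in> atlas M" and N: "charted N" "(V, \<theta>) \<in> atlas N"
    and P: "charted P" "(W, \<psi>) \<in> atlas P"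
  defines "S \<equiv> {z \<in> \<phi> ` U \<times> \<theta> ` V. f (chart_inv (U, \<phi>) (fst z)) (chart_inv (V, \<theta>) (snd z)) \<in> W}"
  shows "smooth S (\<lambda>z. \<psi> (f (chart_inv (U, \<phi>) (fst z)) (chart_inv (V, \<theta>) (snd z))))" and "open S"
proof -
  let ?c = "(U \<times> V, map_prod \<phi> \<theta>)"
  have c: "?c \<in> atlas (prod_mfd M N)" using M(2) N(2) by (auto simp: prod_mfd_simps)
  have eq: "chart_inv ?c z = (chart_inv (U, \<phi>) (fst z), chart_inv (V, \<theta>) (snd z))" if "z \<in> \<phi> ` U \<times> \<theta> ` V" for z
    using chart_inv_prod[OF M N, of "fst z" "snd z"] that by auto
  have S: "{z \<in> map_prod \<phi> \<theta> ` (U \<times> V). (case chart_inv ?c z of (p, q) \<Rightarrow> f p q) \<in> W} = S"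
    unfolding S_def map_prod_image using eq by (auto simp: case_prod_unfold)
  note D = smooth_mapD_chart[OF f charted_prod[OF M(1) N(1)] c P, unfolded S]
  show "open S" by (rule D(2))
  show "smooth S (\<lambda>z. \<psi> (f (chart_inv (U, \<phi>) (fst z)) (chart_inv (V, \<theta>) (snd z))))"
    by (rule smooth_cong[OF D]) (use eq in \<open>auto simp: S_def\<close>)
qed


section \<open>The adjoint action of a Lie group\<close>

locale lie_group_chart =
  fixes G :: "('p, 'm) monoid_scheme" (structure) and M :: "('p, 'g::locally_convex_space) mfd"
    and U0 :: "'p set" and \<phi>0 :: "'p \<Rightarrow> 'g"
  assumes lie: "lie_group G M" and chart: "chart_at_one G M (U0, \<phi>0)"

sublocale lie_group_chart \<subseteq> group G
  using lie by (simp add: lie_group_def)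

context lie_group_chart
begin

abbreviation \<iota> where "\<iota> \<equiv> chart_inv (U0, \<phi>0)"
abbreviation e where "e \<equiv> \<phi>0 \<one>"
abbreviation Adj where "Adj \<equiv> Ad G (U0, \<phi>0)"
abbreviation bracket where "bracket \<equiv> lie_bracket G (U0, \<phi>0)"

lemma manifold_M: "manifold M" and model_M: "model M = UNIV" and topspace_M: "topspace (mtop M) = carrier G"
  and smooth_mult: "smooth_map (prod_mfd M M) M (\<lambda>(g, h). g \<otimes> h)"
  and smooth_inverse: "smooth_map M M (\<lambda>g. inv g)"
  using lie by (simp_all add: lie_group_def)

lemma charted_M: "charted M"
  by (rule manifold_imp_charted[OF manifold_M model_M])

lemma chart0: "(U0, \<phi>0) \<in> atlas M" and one_in: "\<one> \<in> U0"
  using chart by (simp_all add: chart_at_one_def)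

lemma chart_carrier: "(U, \<phi>) \<in> atlas M \<Longrightarrow> p \<in> U \<Longrightarrow> p \<in> carrier G"
  using chart_subset[OF charted_M] topspace_M by auto

lemma chart_inv_carrier: "(U, \<phi>) \<in> atlas M \<Longrightarrow> x \<in> \<phi> ` U \<Longrightarrow> chart_inv (U, \<phi>) x \<in> carrier G"
  by (rule chart_carrier[OF _ chart_inv_into])

lemma inv_chart_carrier [simp]: "x \<in> \<phi>0 ` U0 \<Longrightarrow> \<iota> x \<in> carrier G"
  by (rule chart_inv_carrier[OF chart0])

lemma e_in: "e \<in> \<phi>0 ` U0" using one_in by simp

lemma inv_chart_e [simp]: "\<iota> e = \<one>"
  by (rule chart_inv_left[OF charted_M chart0 one_in])

lemma open_chart0: "open (\<phi>0 ` U0)"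
  by (rule chartedD(2)[OF charted_M chart0])

lemma smooth_map_mult:
  assumes "charted N" "smooth_map N M f" "smooth_map N M g"
  shows "smooth_map N M (\<lambda>p. f p \<otimes> g p)"
  using smooth_map_compose[OF assms(1) charted_prod[OF charted_M charted_M] charted_M
      smooth_map_Pair[OF assms(1) charted_M charted_M assms(2,3)] smooth_mult] by simp

lemma smooth_map_inverse:
  assumes "charted N" "smooth_map N M f"
  shows "smooth_map N M (\<lambda>p. inv (f p))"
  by (rule smooth_map_compose[OF assms(1) charted_M charted_M assms(2) smooth_inverse])

lemma smooth_map_const_M: "charted N \<Longrightarrow> g \<in> carrier G \<Longrightarrow> smooth_map N M (\<lambda>p. g)"
  by (rule smooth_map_const) (simp_all add: charted_M topspace_M)

lemma smooth_map_id_M: "smooth_map M M (\<lambda>p. p)"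
  by (rule smooth_map_id[OF manifold_M model_M])

lemma smooth_conjugation: "smooth_map (prod_mfd M M) M (\<lambda>(g, h). g \<otimes> h \<otimes> inv g)"
proof -
  note MM = charted_prod[OF charted_M charted_M]
  have "smooth_map (prod_mfd M M) M (\<lambda>z. (case z of (g, h) \<Rightarrow> g \<otimes> h) \<otimes> inv (fst z))"
    by (intro smooth_map_mult smooth_map_inverse MM smooth_mult smooth_map_fst manifold_M model_M charted_M)
  then show ?thesis by (simp add: case_prod_unfold)
qed

definition conj_dom :: "'p \<Rightarrow> 'g set" where
  "conj_dom g = {x \<in> \<phi>0 ` U0. g \<otimes> \<iota> x \<otimes> inv g \<in> U0}"

definition conj_chart :: "'p \<Rightarrow> 'g \<Rightarrow> 'g" where
  "conj_chart g x = \<phi>0 (g \<otimes> \<iota> x \<otimes> inv g)"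

lemma Ad_eq_dirderiv: "Adj g X = dirderiv (conj_chart g) e X"
  by (simp add: Ad_def conj_chart_def[abs_def])

lemma conj_chart:
  assumes "g \<in> carrier G"
  shows "smooth (conj_dom g) (conj_chart g)" "open (conj_dom g)" "e \<in> conj_dom g" "conj_chart g e = e"
proof -
  have "smooth_map M M (\<lambda>h. g \<otimes> h \<otimes> inv g)"
    using assms by (intro smooth_map_mult smooth_map_const_M smooth_map_id_M charted_M) auto
  from smooth_mapD_chart[OF this charted_M chart0 charted_M chart0]
  show "smooth (conj_dom g) (conj_chart g)" "open (conj_dom g)"
    by (simp_all only: conj_dom_def conj_chart_def[abs_def])
  show "e \<in> conj_dom g" "conj_chart g e = e"
    using assms e_in one_in by (simp_all add: conj_dom_def conj_chart_def)
qed

lemma Ad_has_dirderiv: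
  assumes "g \<in> carrier G"
  shows "has_dirderiv (conj_chart g) e X (Adj g X)"
  using smooth_C1[OF conj_chart(1,2)[OF assms]] conj_chart(3)[OF assms]
  unfolding C1_on_def Ad_eq_dirderiv by blast

lemma Ad_linear: "g \<in> carrier G \<Longrightarrow> linear (Adj g)"
  using C1_linear[OF smooth_C1[OF conj_chart(1,2)] conj_chart(3)]
  by (simp add: Ad_eq_dirderiv[abs_def])

lemma Ad_one: "Adj \<one> X = X"
proof -
  have "has_dirderiv (conj_chart \<one>) e X X"
    using has_dirderiv_cong[OF open_chart0 e_in, of "conj_chart \<one>" "\<lambda>x. x"] has_dirderiv_id[of e X]
    by (simp add: conj_chart_def chart_inv_right)
  from has_dirderiv_unique[OF Ad_has_dirderiv[OF one_closed] this] show ?thesis .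
qed

text \<open>Conjugation by $gh$ is the composite of the conjugations; differentiate at the fixed point \<open>e\<close>.\<close>

lemma Ad_mult:
  assumes g: "g \<in> carrier G" and h: "h \<in> carrier G"
  shows "Adj (g \<otimes> h) X = Adj g (Adj h X)"
proof -
  have P: "has_dirderiv (\<lambda>t::real. conj_chart h (e + t *\<^sub>R X)) 0 1 (Adj h X)"
    using Ad_has_dirderiv[OF h, of X] unfolding has_dirderiv_curve[of _ e] .
  have 1: "has_dirderiv (\<lambda>t::real. conj_chart g (conj_chart h (e + t *\<^sub>R X))) 0 1 (Adj g (Adj h X))"
    using C1_chain[OF smooth_C1[OF conj_chart(1,2)[OF g]] P] conj_chart(3,4)[OF g] conj_chart(4)[OF h]
    by (simp add: Ad_eq_dirderiv)
  have "conj_chart (g \<otimes> h) x = conj_chart g (conj_chart h x)" if "x \<in> conj_dom h" for x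
  proof -
    have "\<iota> (conj_chart h x) = h \<otimes> \<iota> x \<otimes> inv h"
      using that chart_inv_left[OF charted_M chart0] by (simp add: conj_dom_def conj_chart_def)
    moreover have "\<iota> x \<in> carrier G" using that by (simp add: conj_dom_def)
    ultimately show ?thesis using g h by (simp add: conj_chart_def inv_mult_group m_assoc)
  qed
  then have "has_dirderiv (\<lambda>x. conj_chart g (conj_chart h x)) e X (Adj (g \<otimes> h) X)"
    using g h by (intro has_dirderiv_transform[OF Ad_has_dirderiv conj_chart(2,3)[OF h]]) simp_all
  then have "has_dirderiv (\<lambda>t::real. conj_chart g (conj_chart h (e + t *\<^sub>R X))) 0 1 (Adj (g \<otimes> h) X)"
    unfolding has_dirderiv_curve[of _ e] .
  from has_dirderiv_unique[OF this 1] show ?thesis .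
qed

lemma Ad_inverse:
  assumes "g \<in> carrier G"
  shows "Adj g (Adj (inv g) X) = X" "Adj (inv g) (Adj g X) = X"
  using Ad_mult[of g "inv g" X] Ad_mult[of "inv g" g X] assms by (simp_all add: Ad_one)

lemma inv_into_Ad:
  assumes "g \<in> carrier G"
  shows "inv_into UNIV (Adj g) X = Adj (inv g) X"
proof (rule inv_f_eq)
  show "inj (Adj g)" by (rule inj_on_inverseI[of _ "Adj (inv g)"]) (simp add: Ad_inverse[OF assms])
qed (simp add: Ad_inverse[OF assms])

text \<open>$\mathrm{Ad}(g)X$ is a partial derivative at $h = 1$ of the smooth map $(g,h) \mapsto ghg^{-1}$.\<close>

lemma smooth_Ad:
  assumes c: "(U, \<phi>) \<in> atlas M"
  shows "smooth (\<phi> ` U \<times> UNIV) (\<lambda>z. Adj (chart_inv (U, \<phi>) (fst z)) (snd z))"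
proof -
  let ?i = "chart_inv (U, \<phi>)"
  define S where "S = {z \<in> \<phi> ` U \<times> \<phi>0 ` U0. ?i (fst z) \<otimes> \<iota> (snd z) \<otimes> inv (?i (fst z)) \<in> U0}"
  define F where "F z = \<phi>0 (?i (fst z) \<otimes> \<iota> (snd z) \<otimes> inv (?i (fst z)))" for z
  have F: "smooth S F" "open S"
    using smooth_mapD_chart2[OF smooth_conjugation charted_M c charted_M chart0 charted_M chart0]
    by (simp_all only: S_def F_def[abs_def])
  have o: "open (\<phi> ` U \<times> (UNIV :: 'g set))"
    using chartedD(2)[OF charted_M c] by (simp add: open_Times)
  have eS: "(x, e) \<in> S" if "x \<in> \<phi> ` U" for x
    using that chart_inv_carrier[OF c that] e_in one_in by (simp add: S_def)
  have "smooth (\<phi> ` U \<times> UNIV) (\<lambda>z::'g \<times> 'g. ((fst z, e), (0::'g, snd z)))"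
    by (intro smooth_Pair smooth_fst smooth_snd smooth_const smooth_id o)
  from smooth_compose[OF smooth_dirderiv[OF F] _ this o]
  have "smooth (\<phi> ` U \<times> UNIV) (\<lambda>z. dirderiv F (fst z, e) (0, snd z))"
    using F(2) eS by (auto simp: open_Times)
  then show ?thesis
  proof (rule smooth_cong[OF _ o])
    show "Adj (?i (fst z)) (snd z) = dirderiv F (fst z, e) (0, snd z)" for z
      by (simp add: Ad_def dirderiv_def F_def)
  qed
qed

definition mult_dom :: "('g \<times> 'g) set" where
  "mult_dom = {z \<in> \<phi>0 ` U0 \<times> \<phi>0 ` U0. \<iota> (fst z) \<otimes> \<iota> (snd z) \<in> U0}"

definition mult_chart :: "'g \<times> 'g \<Rightarrow> 'g" where
  "mult_chart z = \<phi>0 (\<iota> (fst z) \<otimes> \<iota> (snd z))"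

lemma mult_chart: "smooth mult_dom mult_chart" "open mult_dom"
  using smooth_mapD_chart2[OF smooth_mult charted_M chart0 charted_M chart0 charted_M chart0]
  by (simp_all only: mult_dom_def mult_chart_def[abs_def])

lemma mult_chart_e:
  assumes "x \<in> \<phi>0 ` U0"
  shows "(x, e) \<in> mult_dom" "(e, x) \<in> mult_dom" "mult_chart (x, e) = x" "mult_chart (e, x) = x"
  using assms e_in chart_inv_into[OF assms] by (simp_all add: mult_dom_def mult_chart_def chart_inv_right)

text \<open>Multiplication by the identity is the identity map.\<close>

lemma dirderiv_mult_chart_e:
  "dirderiv mult_chart (e, e) (X, 0) = X" "dirderiv mult_chart (e, e) (0, X) = X"
proof -
  have "has_dirderiv (\<lambda>x. mult_chart (x, e)) e X X"
    using has_dirderiv_cong[OF open_chart0 e_in, of "\<lambda>x. mult_chart (x, e)" "\<lambda>x. x"] has_dirderiv_id[of e X]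
      mult_chart_e(3) by blast
  then have "has_dirderiv mult_chart (e, e) (X, 0) X" by (simp add: has_dirderiv_def)
  then show "dirderiv mult_chart (e, e) (X, 0) = X" by (rule dirderiv_eqI)
  have "has_dirderiv (\<lambda>x. mult_chart (e, x)) e X X"
    using has_dirderiv_cong[OF open_chart0 e_in, of "\<lambda>x. mult_chart (e, x)" "\<lambda>x. x"] has_dirderiv_id[of e X]
      mult_chart_e(4) by blast
  then have "has_dirderiv mult_chart (e, e) (0, X) X" by (simp add: has_dirderiv_def)
  then show "dirderiv mult_chart (e, e) (0, X) = X" by (rule dirderiv_eqI)
qed

lemma left_inv_field_eq: "left_inv_field G (U0, \<phi>0) X x = dirderiv mult_chart (x, e) (0, X)"
  by (simp add: left_inv_field_def dirderiv_def mult_chart_def)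

text \<open>A left invariant field is a partial derivative of the multiplication $m$, hence the bracket is the
  difference of two mixed second derivatives of $m$ at the identity.\<close>

lemma bracket_eq:
  "bracket X Y = iter_dirderiv mult_chart 2 ((\<lambda>i. (X, 0))(0 := (0, Y))) (e, e)
     - iter_dirderiv mult_chart 2 ((\<lambda>i. (Y, 0))(0 := (0, X))) (e, e)"
proof -
  have "dirderiv (left_inv_field G (U0, \<phi>0) Y) e X
      = iter_dirderiv mult_chart 2 ((\<lambda>i. (X, 0))(0 := (0, Y))) (e, e)" for X Y
    unfolding numeral_2_eq_2 iter_dirderiv.simps
    by (simp add: dirderiv_def[of "left_inv_field G (U0, \<phi>0) Y"] left_inv_field_eq iter_dirderiv_0
        dirderiv_def[of "\<lambda>x. dirderiv mult_chart x (0, Y)"])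
  then show ?thesis
    by (simp add: lie_bracket_def Let_def left_inv_field_eq[of _ e] dirderiv_mult_chart_e)
qed

text \<open>The derivative in \<open>h\<close> at $h = 1$ of the identity $(ghg^{-1}) g = g h$, with \<open>g = \<iota> x\<close>.\<close>

lemma mult_conj_dirderiv:
  assumes x: "x \<in> \<phi>0 ` U0"
  shows "dirderiv mult_chart (e, x) (Adj (\<iota> x) Y, 0) = dirderiv mult_chart (x, e) (0, Y)"
proof -
  let ?g = "\<iota> x"
  have g: "?g \<in> carrier G" using x by simp
  note C1 = smooth_C1[OF mult_chart]
  have D: "has_dirderiv mult_chart (x, e) (0, Y) (dirderiv mult_chart (x, e) (0, Y))"
    using C1 mult_chart_e(1)[OF x] unfolding C1_on_def by blast
  have "has_dirderiv (\<lambda>y. (conj_chart ?g y, x)) e Y (Adj ?g Y, 0)"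
    by (intro has_dirderiv_Pair has_dirderiv_const Ad_has_dirderiv g)
  then have "has_dirderiv (\<lambda>t::real. (conj_chart ?g (e + t *\<^sub>R Y), x)) 0 1 (Adj ?g Y, 0)"
    unfolding has_dirderiv_curve[of _ e] .
  from C1_chain[OF C1 this]
  have L: "has_dirderiv (\<lambda>t::real. mult_chart (conj_chart ?g (e + t *\<^sub>R Y), x)) 0 1
      (dirderiv mult_chart (e, x) (Adj ?g Y, 0))"
    using mult_chart_e(2)[OF x] conj_chart(4)[OF g] by simp
  have eq: "mult_chart (conj_chart ?g y, x) = mult_chart (x, y)" if "y \<in> conj_dom ?g" for y
  proof -
    have y: "\<iota> y \<in> carrier G" using that by (simp add: conj_dom_def)
    have "\<iota> (conj_chart ?g y) = ?g \<otimes> \<iota> y \<otimes> inv ?g"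
      using that chart_inv_left[OF charted_M chart0] by (simp add: conj_dom_def conj_chart_def)
    then show ?thesis using g y by (simp add: mult_chart_def m_assoc)
  qed
  have "has_dirderiv (\<lambda>y. mult_chart (x, y)) e Y (dirderiv mult_chart (x, e) (0, Y))"
    using D by (simp add: has_dirderiv_def)
  then have "has_dirderiv (\<lambda>y. mult_chart (conj_chart ?g y, x)) e Y (dirderiv mult_chart (x, e) (0, Y))"
    by (rule has_dirderiv_transform[OF _ conj_chart(2,3)[OF g] eq])
  then have "has_dirderiv (\<lambda>t::real. mult_chart (conj_chart ?g (e + t *\<^sub>R Y), x)) 0 1
      (dirderiv mult_chart (x, e) (0, Y))"
    unfolding has_dirderiv_curve[of _ e] .
  from has_dirderiv_unique[OF L this] show ?thesis .
qed

text \<open>The derivative of the adjoint representation is the bracket.  Differentiating the identity of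
  the previous lemma in $x$ at \<open>e\<close>, the left hand side contributes a mixed second derivative of the
  multiplication and the wanted derivative \<open>B\<close>, the right hand side the other mixed second
  derivative.  By the symmetry of second derivatives their difference is the bracket.\<close>

lemma dirderiv_Ad: "has_dirderiv (\<lambda>x. Adj (\<iota> x) Y) e X (bracket X Y)"
proof -
  note C1 = smooth_C1[OF mult_chart]
  have ee: "(e, e) \<in> mult_dom" by (rule mult_chart_e(1)[OF e_in])
  define a where "a t = Adj (\<iota> (e + t *\<^sub>R X)) Y" for t :: real
  have a0: "a 0 = Y" by (simp add: a_def Ad_one)
  have o: "open (\<phi>0 ` U0 \<times> (UNIV :: 'g set))" by (simp add: open_Times open_chart0)
  have "has_dirderiv (\<lambda>z. Adj (\<iota> (fst z)) (snd z)) (e, Y) (X, 0)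
      (dirderiv (\<lambda>z. Adj (\<iota> (fst z)) (snd z)) (e, Y) (X, 0))"
    using smooth_C1[OF smooth_Ad[OF chart0] o] e_in unfolding C1_on_def by blast
  then obtain B where B: "has_dirderiv (\<lambda>x. Adj (\<iota> x) Y) e X B"
    by (auto simp: has_dirderiv_def)
  then have aB: "has_dirderiv a 0 1 B"
    unfolding has_dirderiv_curve[of _ e] a_def .
  define v where "v i t = (a t, 0::'g)" for i :: nat and t
  have v: "has_dirderiv (v i) 0 1 (B, 0)" for i
    unfolding v_def by (intro has_dirderiv_Pair has_dirderiv_const aB)
  have P: "has_dirderiv (\<lambda>t::real. (e, e + t *\<^sub>R X)) 0 1 (0, X)"
    by (intro has_dirderiv_Pair has_dirderiv_const, subst has_dirderiv_curve[symmetric], rule has_dirderiv_id)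
  have h2: "iter_dirderiv mult_chart (Suc 1) ((\<lambda>i. v i 0)(1 := (0, X)))
      = iter_dirderiv mult_chart 2 ((\<lambda>i. (0, X))(0 := (Y, 0)))"
    unfolding numeral_2_eq_2 One_nat_def
    by (rule iter_dirderiv_cong) (auto simp: v_def a0 less_Suc_eq)
  have "has_dirderiv (\<lambda>t. iter_dirderiv mult_chart 1 (\<lambda>i. v i t) (e, e + t *\<^sub>R X)) 0 1
     (iter_dirderiv mult_chart (Suc 1) ((\<lambda>i. v i 0)(1 := (0, X))) (e, e + 0 *\<^sub>R X) +
       (\<Sum>i<1. iter_dirderiv mult_chart 1 ((\<lambda>i. v i 0)(i := (B, 0))) (e, e + 0 *\<^sub>R X)))"
    by (rule has_dirderiv_iter_curve[OF mult_chart P _ v]) (simp add: ee)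
  from this[unfolded h2]
  have 1: "has_dirderiv (\<lambda>t. dirderiv mult_chart (e, e + t *\<^sub>R X) (a t, 0)) 0 1
     (iter_dirderiv mult_chart 2 ((\<lambda>i. (0, X))(0 := (Y, 0))) (e, e) + B)"
    by (simp add: v_def iter_dirderiv_0 dirderiv_mult_chart_e)
  have "has_dirderiv (iter_dirderiv mult_chart 1 ((\<lambda>i. (X, 0))(0 := (0, Y)))) (e, e) (X, 0)
      (iter_dirderiv mult_chart 2 ((\<lambda>i. (X, 0))(0 := (0, Y))) (e, e))"
    using smoothD(1)[OF mult_chart(1) ee, of 1 "(\<lambda>i. (X, 0))(0 := (0, Y))"] by (simp add: numeral_2_eq_2)
  then have 2: "has_dirderiv (\<lambda>t::real. dirderiv mult_chart (e + t *\<^sub>R X, e) (0, Y)) 0 1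
      (iter_dirderiv mult_chart 2 ((\<lambda>i. (X, 0))(0 := (0, Y))) (e, e))"
    by (simp add: has_dirderiv_def iter_dirderiv_0)
  have "\<forall>\<^sub>F t::real in at 0. dirderiv mult_chart (e, e + t *\<^sub>R X) (a t, 0) = dirderiv mult_chart (e + t *\<^sub>R X, e) (0, Y)"
    using eventually_line_in[OF open_chart0 e_in, of X]
    by eventually_elim (simp add: a_def mult_conj_dirderiv)
  then have "has_dirderiv (\<lambda>t. dirderiv mult_chart (e, e + t *\<^sub>R X) (a t, 0)) 0 1
      (iter_dirderiv mult_chart 2 ((\<lambda>i. (X, 0))(0 := (0, Y))) (e, e))"
    using 2 has_dirderiv_cong_ev[of "\<lambda>t. dirderiv mult_chart (e, e + t *\<^sub>R X) (a t, 0)" 0 1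
        "\<lambda>t. dirderiv mult_chart (e + t *\<^sub>R X, e) (0, Y)"]
    by (simp add: a0 dirderiv_mult_chart_e)
  from has_dirderiv_unique[OF 1 this]
  have "B = iter_dirderiv mult_chart 2 ((\<lambda>i. (X, 0))(0 := (0, Y))) (e, e)
      - iter_dirderiv mult_chart 2 ((\<lambda>i. (0, X))(0 := (Y, 0))) (e, e)"
    by (simp add: algebra_simps)
  also have "iter_dirderiv mult_chart 2 ((\<lambda>i. (0, X))(0 := (Y, 0))) (e, e)
      = iter_dirderiv mult_chart 2 ((\<lambda>i. (Y, 0))(0 := (0, X))) (e, e)"
    using iter_dirderiv_2_commute[OF mult_chart ee, of "(\<lambda>i. (0, X))(0 := (Y, 0))"] by simp
  finally show ?thesis using B by (simp only: bracket_eq)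
qed

text \<open>Differentiate $m(x, x^{-1}) = e$.\<close>

lemma dirderiv_inverse:
  "has_dirderiv (\<lambda>x. \<phi>0 (inv (\<iota> x))) e X (- X)"
proof -
  define S where "S = {x \<in> \<phi>0 ` U0. inv (\<iota> x) \<in> U0}"
  define i where "i x = \<phi>0 (inv (\<iota> x))" for x
  have i: "smooth S i" "open S"
    using smooth_mapD_chart[OF smooth_inverse charted_M chart0 charted_M chart0]
    by (simp_all only: S_def i_def[abs_def])
  have eS: "e \<in> S" and ie: "i e = e" using e_in one_in by (simp_all add: S_def i_def)
  obtain Z where Z: "has_dirderiv i e X Z"
    using smooth_C1[OF i] eS unfolding C1_on_def by blast
  note C1 = smooth_C1[OF mult_chart]
  have ee: "(e, e) \<in> mult_dom" by (rule mult_chart_e(1)[OF e_in])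
  have "has_dirderiv (\<lambda>x. (x, i x)) e X (X, Z)"
    by (intro has_dirderiv_Pair has_dirderiv_id Z)
  then have "has_dirderiv (\<lambda>t::real. (e + t *\<^sub>R X, i (e + t *\<^sub>R X))) 0 1 (X, Z)"
    unfolding has_dirderiv_curve[of _ e] .
  from C1_chain[OF C1 this] have "has_dirderiv (\<lambda>t::real. mult_chart (e + t *\<^sub>R X, i (e + t *\<^sub>R X))) 0 1
      (dirderiv mult_chart (e, e) (X, Z))" by (simp add: ie ee)
  then have 1: "has_dirderiv (\<lambda>x. mult_chart (x, i x)) e X (dirderiv mult_chart (e, e) (X, Z))"
    unfolding has_dirderiv_curve[of _ e] .
  have "mult_chart (x, i x) = e" if "x \<in> S" for x
    using that chart_inv_left[OF charted_M chart0] by (simp add: S_def i_def mult_chart_def)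
  then have "has_dirderiv (\<lambda>x. mult_chart (x, i x)) e X 0"
    by (rule has_dirderiv_transform[OF has_dirderiv_const i(2) eS])
  from has_dirderiv_unique[OF 1 this] have "dirderiv mult_chart (e, e) ((X, 0) + (0, Z)) = 0" by simp
  then have "X + Z = 0"
    unfolding linear_add[OF C1_linear[OF C1 ee]] dirderiv_mult_chart_e .
  then have "Z = - X" by (simp add: eq_neg_iff_add_eq_0 add.commute)
  then show ?thesis using Z by (simp add: i_def[abs_def])
qed

lemma dirderiv_Ad_inverse:
  "has_dirderiv (\<lambda>x. Adj (inv (\<iota> x)) Y) e X (- bracket X Y)"
proof -
  have o: "open (\<phi>0 ` U0)" by (rule open_chart0)
  have "smooth (\<phi>0 ` U0) (\<lambda>x. (x, Y))" by (intro smooth_Pair smooth_id smooth_const o)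
  from smooth_compose[OF smooth_Ad[OF chart0] _ this o]
  have A: "smooth (\<phi>0 ` U0) (\<lambda>x. Adj (\<iota> x) Y)" using o by (simp add: open_Times)
  have D: "dirderiv (\<lambda>x. Adj (\<iota> x) Y) e (- X) = - bracket X Y"
    using has_dirderiv_scale[OF dirderiv_Ad[of Y X], of "-1"] by (intro dirderiv_eqI) simp
  have "has_dirderiv (\<lambda>t::real. \<phi>0 (inv (\<iota> (e + t *\<^sub>R X)))) 0 1 (- X)"
    using dirderiv_inverse[of X] unfolding has_dirderiv_curve[of _ e] .
  from C1_chain[OF smooth_C1[OF A o] this]
  have "has_dirderiv (\<lambda>t::real. Adj (\<iota> (\<phi>0 (inv (\<iota> (e + t *\<^sub>R X))))) Y) 0 1 (- bracket X Y)"
    using e_in by (simp add: D)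
  then have 1: "has_dirderiv (\<lambda>x. Adj (\<iota> (\<phi>0 (inv (\<iota> x)))) Y) e X (- bracket X Y)"
    unfolding has_dirderiv_curve[of _ e] .
  show ?thesis
  proof (rule has_dirderiv_transform[OF 1])
    show "open {x \<in> \<phi>0 ` U0. inv (\<iota> x) \<in> U0}"
      by (rule smooth_mapD_chart(2)[OF smooth_inverse charted_M chart0 charted_M chart0])
    show "e \<in> {x \<in> \<phi>0 ` U0. inv (\<iota> x) \<in> U0}" using e_in one_in by simp
  qed (simp add: chart_inv_left[OF charted_M chart0])
qed

end


section \<open>Integration over a connected Lie group\<close>

context lie_group_chart
begin

text \<open>A curve through \<open>g\<close> is the left translate by \<open>g\<close> of a curve through the identity.  Hence
  derivatives at the identity of all left translates of \<open>f\<close> determine the derivative of \<open>f\<close>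
  everywhere.\<close>

lemma dirderiv_in_subspace:
  fixes f :: "'p \<Rightarrow> 'v::locally_convex_space"
  assumes f: "smooth_map M (vec_mfd UNIV) f"
    and D: "\<And>g X. g \<in> carrier G \<Longrightarrow> \<exists>l\<in>W. has_dirderiv (\<lambda>x. f (g \<otimes> \<iota> x)) e X l"
    and c: "(U, \<phi>) \<in> atlas M" and x: "x \<in> \<phi> ` U"
  shows "\<exists>l\<in>W. has_dirderiv (\<lambda>x. f (chart_inv (U, \<phi>) x)) x z l"
proof -
  let ?i = "chart_inv (U, \<phi>)"
  define g where "g = ?i x"
  have g: "g \<in> carrier G" unfolding g_def by (rule chart_inv_carrier[OF c x])
  define S where "S = {y \<in> \<phi> ` U. inv g \<otimes> ?i y \<in> U0}"
  define s where "s y = \<phi>0 (inv g \<otimes> ?i y)" for y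
  have "smooth_map M M (\<lambda>h. inv g \<otimes> h)"
    using g by (intro smooth_map_mult smooth_map_const_M smooth_map_id_M charted_M) auto
  from smooth_mapD_chart[OF this charted_M c charted_M chart0]
  have s: "smooth S s" "open S" by (simp_all only: S_def s_def[abs_def])
  have xS: "x \<in> S" and sx: "s x = e" using x g one_in by (simp_all add: S_def s_def flip: g_def)
  obtain s' where s': "has_dirderiv s x z s'"
    using smooth_C1[OF s] xS unfolding C1_on_def by blast
  define k where "k y = f (g \<otimes> \<iota> y)" for y
  have "smooth_map M (vec_mfd UNIV) (\<lambda>h. f (g \<otimes> h))"
    using g by (intro smooth_map_compose[OF charted_M charted_M charted_vec _ f]
        smooth_map_mult smooth_map_const_M smooth_map_id_M charted_M)
  from smooth_map_vecD[OF this charted_M chart0] have k: "smooth (\<phi>0 ` U0) k" by (simp only: k_def[abs_def])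
  have sc: "has_dirderiv (\<lambda>t::real. s (x + t *\<^sub>R z)) 0 1 s'" using s' unfolding has_dirderiv_curve[of _ x] .
  from C1_chain[OF smooth_C1[OF k open_chart0] this] e_in sx
  have "has_dirderiv (\<lambda>t::real. k (s (x + t *\<^sub>R z))) 0 1 (dirderiv k e s')" by simp
  then have ks: "has_dirderiv (\<lambda>y. k (s y)) x z (dirderiv k e s')" unfolding has_dirderiv_curve[of _ x] .
  have "f (?i y) = k (s y)" if "y \<in> S" for y
  proof -
    have y: "?i y \<in> carrier G" using that chart_inv_carrier[OF c] by (simp add: S_def)
    have "\<iota> (s y) = inv g \<otimes> ?i y"
      using that chart_inv_left[OF charted_M chart0] by (simp add: S_def s_def)
    then show ?thesis using g y by (simp add: k_def m_assoc[symmetric])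
  qed
  from has_dirderiv_transform[OF ks s(2) xS this]
  have "has_dirderiv (\<lambda>x. f (?i x)) x z (dirderiv k e s')" .
  moreover obtain l where "l \<in> W" "has_dirderiv k e s' l"
    using D[OF g, of s'] unfolding k_def by blast
  ultimately show ?thesis using dirderiv_eqI by blast
qed

text \<open>The mean value theorem on segments in a convex neighbourhood inside a chart.\<close>

lemma locally_increment_in_subspace:
  fixes f :: "'p \<Rightarrow> 'v::locally_convex_space"
  assumes f: "smooth_map M (vec_mfd UNIV) f"
    and W: "closed W" "subspace W"
    and D: "\<And>g X. g \<in> carrier G \<Longrightarrow> \<exists>l\<in>W. has_dirderiv (\<lambda>x. f (g \<otimes> \<iota> x)) e X l"
    and g: "g \<in> carrier G"
  shows "\<exists>N. openin (mtop M) N \<and> g \<in> N \<and> (\<forall>h\<in>N. f h - f g \<in> W)"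
proof -
  obtain U \<phi> where c: "(U, \<phi>) \<in> atlas M" and gU: "g \<in> U"
    using charted_cover[OF charted_M, of g] g topspace_M by auto
  let ?i = "chart_inv (U, \<phi>)"
  obtain C where C: "open C" "convex C" "\<phi> g \<in> C" "C \<subseteq> \<phi> ` U"
    using convex_nhd[OF chartedD(2)[OF charted_M c], of "\<phi> g"] gU by blast
  have "continuous_map (subtopology (mtop M) U) (top_of_set (\<phi> ` U)) \<phi>"
    by (rule homeomorphic_imp_continuous_map[OF chartedD(3)[OF charted_M c]])
  moreover have "openin (top_of_set (\<phi> ` U)) C"
    using C chartedD(2)[OF charted_M c] by (simp add: openin_open_eq)
  ultimately have "openin (subtopology (mtop M) U) {p \<in> topspace (subtopology (mtop M) U). \<phi> p \<in> C}"
    by (rule openin_continuous_map_preimage)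
  then have "openin (mtop M) {p \<in> topspace (subtopology (mtop M) U). \<phi> p \<in> C}"
    using chartedD(1)[OF charted_M c] by (meson openin_trans_full)
  moreover have "{p \<in> topspace (subtopology (mtop M) U). \<phi> p \<in> C} = {p \<in> U. \<phi> p \<in> C}"
    using chart_subset[OF charted_M c] by auto
  ultimately have "openin (mtop M) {p \<in> U. \<phi> p \<in> C}" by simp
  moreover have "f h - f g \<in> W" if h: "h \<in> {p \<in> U. \<phi> p \<in> C}" for h
  proof -
    let ?z = "\<phi> h - \<phi> g"
    define \<gamma> where "\<gamma> s = f (?i (\<phi> g + s *\<^sub>R ?z))" for s :: real
    have "\<gamma> 1 - \<gamma> 0 \<in> W"
    proof (rule increment_in_closed_subspace[OF W])
      fix s :: real assume s: "0 \<le> s" "s \<le> 1"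
      have "(1 - s) *\<^sub>R \<phi> g + s *\<^sub>R \<phi> h \<in> C"
        using C(2,3) h s unfolding convex_alt by blast
      then have "\<phi> g + s *\<^sub>R ?z \<in> \<phi> ` U" using C(4) by (auto simp: algebra_simps)
      from dirderiv_in_subspace[OF f D c this]
      obtain l where "l \<in> W" and l: "has_dirderiv (\<lambda>x. f (?i x)) (\<phi> g + s *\<^sub>R ?z) ?z l" by blast
      have "has_dirderiv \<gamma> s 1 l"
        using l by (simp add: has_dirderiv_def \<gamma>_def scaleR_add_left add.assoc)
      with \<open>l \<in> W\<close> show "\<exists>l\<in>W. has_dirderiv \<gamma> s 1 l" by blast
    qed
    then show ?thesis using h gU chart_inv_left[OF charted_M c] by (simp add: \<gamma>_def)
  qed
  ultimately show ?thesis using gU C(3) by blast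
qed

text \<open>The set of all \<open>g\<close> with $f(g) - f(1) \in W$ is open and closed.\<close>

lemma increment_in_subspace:
  fixes f :: "'p \<Rightarrow> 'v::locally_convex_space"
  assumes conn: "connected_space (mtop M)"
    and f: "smooth_map M (vec_mfd UNIV) f"
    and W: "closed W" "subspace W"
    and D: "\<And>g X. g \<in> carrier G \<Longrightarrow> \<exists>l\<in>W. has_dirderiv (\<lambda>x. f (g \<otimes> \<iota> x)) e X l"
    and g: "g \<in> carrier G"
  shows "f g - f \<one> \<in> W"
proof -
  let ?A = "{g \<in> carrier G. f g - f \<one> \<in> W}"
  note loc = locally_increment_in_subspace[OF f W D]
  have sub: "N \<subseteq> carrier G" if "openin (mtop M) N" for N
    using openin_subset[OF that] topspace_M by simp
  have "openin (mtop M) ?A"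
  proof (subst openin_subopen, intro ballI)
    fix a assume a: "a \<in> ?A"
    then obtain N where N: "openin (mtop M) N" "a \<in> N" "\<And>h. h \<in> N \<Longrightarrow> f h - f a \<in> W"
      using loc[of a] by blast
    have "h \<in> ?A" if "h \<in> N" for h
      using subspace_add[OF W(2) N(3)[OF that], of "f a - f \<one>"] a that sub[OF N(1)] by auto
    with N show "\<exists>T. openin (mtop M) T \<and> a \<in> T \<and> T \<subseteq> ?A" by blast
  qed
  moreover have "openin (mtop M) (topspace (mtop M) - ?A)"
  proof (subst openin_subopen, intro ballI)
    fix a assume a: "a \<in> topspace (mtop M) - ?A"
    then obtain N where N: "openin (mtop M) N" "a \<in> N" "\<And>h. h \<in> N \<Longrightarrow> f h - f a \<in> W"
      using loc[of a] topspace_M by blast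
    have "h \<in> topspace (mtop M) - ?A" if "h \<in> N" for h
      using subspace_diff[OF W(2) _ N(3)[OF that], of "f h - f \<one>"] a that sub[OF N(1)] topspace_M by auto
    with N show "\<exists>T. openin (mtop M) T \<and> a \<in> T \<and> T \<subseteq> topspace (mtop M) - ?A" by blast
  qed
  then have "closedin (mtop M) ?A" using topspace_M by (auto simp: closedin_def)
  ultimately have "?A = {} \<or> ?A = topspace (mtop M)"
    using conn unfolding connected_space_clopen_in by blast
  moreover have "\<one> \<in> ?A" using subspace_0[OF W(2)] by simp
  ultimately show ?thesis using g topspace_M by blast
qed

end

section \<open>Hamiltonian actions\<close>

locale hamiltonian_action = lie_group_chart G M U0 \<phi>0
  for G :: "('p, 'm) monoid_scheme" (structure) and M :: "('p, 'g::locally_convex_space) mfd"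
    and U0 :: "'p set" and \<phi>0 :: "'p \<Rightarrow> 'g" +
  fixes br :: "'h::real_tvs \<Rightarrow> 'h \<Rightarrow> 'h"
    and act :: "'h \<Rightarrow> 'v::locally_convex_space \<Rightarrow> 'v"
    and \<omega> :: "'h \<Rightarrow> 'h \<Rightarrow> 'v"
    and \<zeta> :: "'g \<Rightarrow> 'h"
    and J :: "'g \<Rightarrow> 'v"
    and \<rho> :: "'p \<Rightarrow> 'v \<Rightarrow> 'v"
  assumes br: "topological_lie_algebra br"
    and act: "topological_module br act"
    and \<omega>: "cochain2 \<omega>"
    and connected: "connected_space (mtop M)"
    and \<zeta>: "ham_hom bracket br act \<omega> \<zeta>"
    and J: "momentum_map br act \<omega> UNIV \<zeta> J"
    and \<rho>: "abstract_hamiltonian_action G M (U0, \<phi>0) act \<zeta> \<rho>"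
begin

abbreviation \<tau> where "\<tau> \<equiv> mom_cocycle bracket act \<zeta> J"
abbreviation \<kappa> where "\<kappa> \<equiv> kappa G (U0, \<phi>0) \<rho> J"
abbreviation Adh where "Adh \<equiv> Ad_hat G (U0, \<phi>0) \<rho> J"

lemma act_linear: "linear (act \<xi>)" and act_linear_left: "linear (\<lambda>\<xi>. act \<xi> v)"
  using act by (auto simp: topological_module_def bilinear_def)

lemma continuous_act: "continuous_on UNIV (act \<xi>)"
proof -
  have "continuous_on UNIV (\<lambda>(\<xi>, v). act \<xi> v)" using act by (simp add: topological_module_def)
  from continuous_on_compose2[OF this, of UNIV "\<lambda>v. (\<xi>, v)"] show ?thesis
    by (simp add: continuous_on_Pair continuous_on_const continuous_on_id)
qed

lemma subspace_invariants: "subspace (invariants act)"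
  unfolding subspace_def invariants_def
  by (simp add: linear_0[OF act_linear] linear_add[OF act_linear] linear_scale[OF act_linear])

lemma closed_invariants: "closed (invariants act)"
  unfolding invariants_def
  by (intro closed_Collect_all closed_Collect_eq continuous_act continuous_on_const)

lemma J_linear: "linear J" and J_continuous: "continuous_on UNIV J"
  and J_ham: "J X \<in> ham_fun br act \<omega>" and J_momentum: "act \<eta> (J X) = \<omega> (\<zeta> X) \<eta>"
proof -
  have "J (a *\<^sub>R X + b *\<^sub>R Y) = a *\<^sub>R J X + b *\<^sub>R J Y" for a b X Y
    using J by (simp add: momentum_map_def)
  from this[of 1 _ 1] this[of _ _ 0 0] show "linear J" by (intro linearI) simp_all
  show "continuous_on UNIV J" "J X \<in> ham_fun br act \<omega>" using J by (simp_all add: momentum_map_def)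
  have "d0 act (J X) \<eta> = \<omega> (\<zeta> X) \<eta>" using J by (simp add: momentum_map_def)
  then show "act \<eta> (J X) = \<omega> (\<zeta> X) \<eta>" by (simp add: d0_def)
qed

text \<open>Applying $\eta$ to $\tau(X,Y)$ and replacing $\eta.J(Z)$ by $\omega(\zeta(Z), \eta)$ leaves terms
  that cancel because $\mathcal L_{\zeta(X)} \omega = 0$.\<close>

lemma cocycle_invariant: "\<tau> X Y \<in> invariants act"
  unfolding invariants_def
proof safe
  fix \<eta>
  have lin: "linear (\<omega> \<xi>)" for \<xi> using \<omega> by (simp add: cochain2_def bilinear_def)
  have anti: "br \<xi> \<eta> = - br \<eta> \<xi>" for \<xi> \<eta>
  proof -
    have b: "bilinear br" and z: "\<And>\<xi>. br \<xi> \<xi> = 0" using br by (simp_all add: topological_lie_algebra_def)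
    have "br (\<xi> + \<eta>) (\<xi> + \<eta>) = 0" by (rule z)
    then have "br \<xi> \<eta> + br \<eta> \<xi> = 0"
      by (simp only: bilinear_ladd[OF b] bilinear_radd[OF b]) (simp add: z add.commute)
    then show ?thesis by (rule eq_neg_iff_add_eq_0[THEN iffD2])
  qed
  have "\<zeta> X \<in> sp br act \<omega>" using \<zeta> by (auto simp: ham_hom_def ham_def)
  then have "lie_deriv br act (\<zeta> X) \<omega> (\<zeta> Y) \<eta> = 0" by (auto simp: sp_def fun_eq_iff)
  then have L: "act (\<zeta> X) (\<omega> (\<zeta> Y) \<eta>) = \<omega> (br (\<zeta> X) (\<zeta> Y)) \<eta> + \<omega> (\<zeta> Y) (br (\<zeta> X) \<eta>)"
    by (simp add: lie_deriv_def algebra_simps)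
  have mod: "act (br \<eta> (\<zeta> X)) v = act \<eta> (act (\<zeta> X) v) - act (\<zeta> X) (act \<eta> v)" for v
    using act by (simp add: topological_module_def)
  have "act \<eta> (\<tau> X Y) = act \<eta> (act (\<zeta> X) (J Y)) - act \<eta> (J (bracket X Y))"
    by (simp add: mom_cocycle_def linear_diff[OF act_linear])
  also have "act \<eta> (act (\<zeta> X) (J Y)) = act (br \<eta> (\<zeta> X)) (J Y) + act (\<zeta> X) (act \<eta> (J Y))"
    using mod[of "J Y"] by simp
  also have "act \<eta> (J (bracket X Y)) = \<omega> (br (\<zeta> X) (\<zeta> Y)) \<eta>"
    using \<zeta> by (simp add: J_momentum ham_hom_def)
  also have "act (br \<eta> (\<zeta> X)) (J Y) + act (\<zeta> X) (act \<eta> (J Y)) - \<omega> (br (\<zeta> X) (\<zeta> Y)) \<eta>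
      = \<omega> (\<zeta> Y) (br \<eta> (\<zeta> X)) + \<omega> (\<zeta> Y) (br (\<zeta> X) \<eta>)"
    by (simp add: J_momentum L)
  also have "\<dots> = 0" by (simp add: anti[of \<eta>] linear_neg[OF lin])
  finally show "act \<eta> (\<tau> X Y) = 0" .
qed

lemma rho_one: "\<rho> \<one> v = v"
  and rho_mult: "g \<in> carrier G \<Longrightarrow> h \<in> carrier G \<Longrightarrow> \<rho> (g \<otimes> h) v = \<rho> g (\<rho> h v)"
  and rho_smooth: "smooth_map (prod_mfd M (vec_mfd UNIV)) (vec_mfd UNIV) (\<lambda>(g, v). \<rho> g v)"
  and rho_derived: "has_dirderiv (\<lambda>x. \<rho> (\<iota> x) v) e X (act (\<zeta> X) v)"
  using \<rho> by (simp_all add: abstract_hamiltonian_action_def smooth_linear_action_def derived_action_def)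

lemma rho_linear:
  assumes "g \<in> carrier G"
  shows "linear (\<rho> g)"
proof -
  have "\<rho> g (a *\<^sub>R v + b *\<^sub>R w) = a *\<^sub>R \<rho> g v + b *\<^sub>R \<rho> g w" for a b v w
    using \<rho> assms by (simp add: abstract_hamiltonian_action_def smooth_linear_action_def)
  from this[of 1 _ 1] this[of _ _ 0 0] show ?thesis by (intro linearI) simp_all
qed

lemma smooth_rho:
  assumes c: "(U, \<phi>) \<in> atlas M"
  shows "smooth (\<phi> ` U \<times> UNIV) (\<lambda>z. \<rho> (chart_inv (U, \<phi>) (fst z)) (snd z))"
  using smooth_mapD_chart2(1)[OF rho_smooth charted_M c charted_vec, of UNIV id UNIV id]
  by (simp add: charted_vec vec_mfd_simps chart_inv_vec)

lemma rho_continuous: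
  assumes g: "g \<in> carrier G"
  shows "continuous_on UNIV (\<rho> g)"
proof -
  obtain U \<phi> where c: "(U, \<phi>) \<in> atlas M" and gU: "g \<in> U"
    using charted_cover[OF charted_M, of g] g topspace_M by auto
  have "continuous_on UNIV (\<lambda>v::'v. (\<phi> g, v))"
    by (intro continuous_on_Pair continuous_on_const continuous_on_id)
  from continuous_on_compose2[OF smooth_imp_continuous_on[OF smooth_rho[OF c]] this]
  show ?thesis using gU chart_inv_left[OF charted_M c gU] by auto
qed

text \<open>The derivative of $(x, v) \mapsto \rho(x) v$ is linear, hence the sum of its two partial
  derivatives.\<close>

lemma rho_product_rule:
  assumes w: "has_dirderiv w e X w'"
  shows "has_dirderiv (\<lambda>x. \<rho> (\<iota> x) (w x)) e X (act (\<zeta> X) (w e) + w')"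
proof -
  let ?R = "\<lambda>z. \<rho> (\<iota> (fst z)) (snd z)"
  have "open (\<phi>0 ` U0 \<times> (UNIV :: 'v set))" by (simp add: open_Times open_chart0)
  from smooth_C1[OF smooth_rho[OF chart0] this]
  have C1: "C1_on (\<phi>0 ` U0 \<times> UNIV) ?R (dirderiv ?R)" .
  have e: "(e, w e) \<in> \<phi>0 ` U0 \<times> UNIV" using e_in by simp
  have "has_dirderiv (\<lambda>x. (x, w x)) e X (X, w')" by (intro has_dirderiv_Pair has_dirderiv_id w)
  then have "has_dirderiv (\<lambda>t::real. (e + t *\<^sub>R X, w (e + t *\<^sub>R X))) 0 1 (X, w')"
    unfolding has_dirderiv_curve[of _ e] .
  from C1_chain[OF C1 this] e
  have "has_dirderiv (\<lambda>t::real. \<rho> (\<iota> (e + t *\<^sub>R X)) (w (e + t *\<^sub>R X))) 0 1 (dirderiv ?R (e, w e) (X, w'))"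
    by simp
  then have 1: "has_dirderiv (\<lambda>x. \<rho> (\<iota> x) (w x)) e X (dirderiv ?R (e, w e) (X, w'))"
    unfolding has_dirderiv_curve[of _ e] .
  have "dirderiv ?R (e, w e) ((X, 0) + (0, w')) = dirderiv ?R (e, w e) (X, 0) + dirderiv ?R (e, w e) (0, w')"
    by (rule linear_add[OF C1_linear[OF C1 e]])
  moreover have "dirderiv ?R (e, w e) (X, 0) = act (\<zeta> X) (w e)"
    by (rule dirderiv_eqI) (use rho_derived[of "w e" X] in \<open>simp add: has_dirderiv_def\<close>)
  moreover have "dirderiv ?R (e, w e) (0, w') = w'"
    by (rule dirderiv_eqI) (use has_dirderiv_id[of "w e" w'] in \<open>simp add: has_dirderiv_def rho_one\<close>)
  ultimately show ?thesis using 1 by simp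
qed

lemma smooth_map_rho:
  assumes f: "smooth_map M (vec_mfd UNIV) f"
  shows "smooth_map M (vec_mfd UNIV) (\<lambda>g. \<rho> g (f g))"
  using smooth_map_compose[OF charted_M charted_prod[OF charted_M charted_vec] charted_vec
      smooth_map_Pair[OF charted_M charted_M charted_vec smooth_map_id_M f] rho_smooth] by simp

text \<open>The orbit map of \<open>v\<close> has derivative $\rho(g)(\zeta(X).v) = 0$ everywhere; connectedness makes it
  constant.\<close>

lemma rho_invariant:
  assumes v: "v \<in> invariants act" and g: "g \<in> carrier G"
  shows "\<rho> g v = v"
proof -
  have "\<rho> g v - \<rho> \<one> v \<in> {0}"
  proof (rule increment_in_subspace[OF connected _ _ _ _ g])
    show "smooth_map M (vec_mfd UNIV) (\<lambda>g. \<rho> g v)"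
      by (intro smooth_map_rho smooth_map_const charted_M charted_vec) (simp add: vec_mfd_simps)
    fix g X assume g: "g \<in> carrier G"
    have "has_dirderiv (\<lambda>x. \<rho> (\<iota> x) v) e X 0"
      using rho_derived[of v X] v by (simp add: invariants_def)
    from has_dirderiv_linear[OF rho_linear[OF g] rho_continuous[OF g] this]
    have "has_dirderiv (\<lambda>x. \<rho> g (\<rho> (\<iota> x) v)) e X 0" by (simp add: linear_0[OF rho_linear[OF g]])
    then have "has_dirderiv (\<lambda>x. \<rho> (g \<otimes> \<iota> x) v) e X 0"
      by (rule has_dirderiv_transform[OF _ open_chart0 e_in]) (simp add: rho_mult g)
    then show "\<exists>l\<in>{0}. has_dirderiv (\<lambda>x. \<rho> (g \<otimes> \<iota> x) v) e X l" by simp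
  qed (simp_all add: subspace_0 subspace_single_0)
  then show ?thesis by (simp add: rho_one)
qed

lemma smooth_map_J_Ad: "smooth_map M (vec_mfd UNIV) (\<lambda>g. J (Adj g Y))"
proof (rule smooth_map_vecI[OF charted_M])
  fix U \<phi> assume c: "(U, \<phi>) \<in> atlas M"
  have o: "open (\<phi> ` U)" by (rule chartedD(2)[OF charted_M c])
  have "smooth (\<phi> ` U) (\<lambda>x. (x, Y))" by (intro smooth_Pair smooth_id smooth_const o)
  from smooth_compose[OF smooth_Ad[OF c] _ this o]
  have "smooth (\<phi> ` U) (\<lambda>x. Adj (chart_inv (U, \<phi>) x) Y)" using o by (simp add: open_Times)
  then show "smooth (\<phi> ` U) (\<lambda>x. J (Adj (chart_inv (U, \<phi>) x) Y))"
    by (rule smooth_linear_comp[OF o J_linear J_continuous])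
qed

lemma kappa_eq: "g \<in> carrier G \<Longrightarrow> \<kappa> g Y = \<rho> g (J (Adj (inv g) Y)) - J Y"
  by (simp add: kappa_def inv_into_Ad)

text \<open>The map $g \mapsto g.J(\mathrm{Ad}(g)^{-1}Y)$ has the derivative $g.\tau(X, \mathrm{Ad}(g)^{-1}Y)$ in
  direction \<open>X\<close> after left translation by \<open>g\<close>.  This lies in the closed subspace $V^{\mathfrak h}$,
  and so does its increment $\kappa(g)(Y)$ on the connected group.\<close>

lemma kappa_invariant:
  assumes g: "g \<in> carrier G"
  shows "\<kappa> g Y \<in> invariants act"
proof -
  define f where "f g = \<rho> g (J (Adj (inv g) Y))" for g
  have "f g - f \<one> \<in> invariants act"
  proof (rule increment_in_subspace[OF connected _ closed_invariants subspace_invariants _ g])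
    show "smooth_map M (vec_mfd UNIV) f"
      unfolding f_def
      by (intro smooth_map_rho smooth_map_compose[OF charted_M charted_M charted_vec smooth_inverse smooth_map_J_Ad])
    fix g X assume g: "g \<in> carrier G"
    define Y' where "Y' = Adj (inv g) Y"
    have "has_dirderiv (\<lambda>x. J (Adj (inv (\<iota> x)) Y')) e X (J (- bracket X Y'))"
      by (rule has_dirderiv_linear[OF J_linear J_continuous dirderiv_Ad_inverse])
    from rho_product_rule[OF this]
    have "has_dirderiv (\<lambda>x. \<rho> (\<iota> x) (J (Adj (inv (\<iota> x)) Y'))) e X (\<tau> X Y')"
      by (simp add: Ad_one mom_cocycle_def linear_neg[OF J_linear])
    from has_dirderiv_linear[OF rho_linear[OF g] rho_continuous[OF g] this]
    have "has_dirderiv (\<lambda>x. \<rho> g (\<rho> (\<iota> x) (J (Adj (inv (\<iota> x)) Y')))) e X (\<tau> X Y')"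
      by (simp add: rho_invariant[OF cocycle_invariant g])
    then have "has_dirderiv (\<lambda>x. f (g \<otimes> \<iota> x)) e X (\<tau> X Y')"
      by (rule has_dirderiv_transform[OF _ open_chart0 e_in])
         (simp add: f_def Y'_def rho_mult g inv_mult_group Ad_mult)
    then show "\<exists>l\<in>invariants act. has_dirderiv (\<lambda>x. f (g \<otimes> \<iota> x)) e X l"
      using cocycle_invariant by blast
  qed
  then show ?thesis using g by (simp add: f_def kappa_eq rho_one Ad_one)
qed

text \<open>$\kappa(g)(\mathrm{Ad}(g)X) = g.J(X) - J(\mathrm{Ad}(g)X)$ is the form in which all computations
  with $\widehat{\mathrm{Ad}}$ are carried out.\<close>

lemma Ad_hat_eq:
  assumes "g \<in> carrier G"
  shows "Adh g (v, X) = (v + (\<rho> g (J X) - J (Adj g X)), Adj g X)"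
  using assms by (simp add: Ad_hat_def kappa_eq Ad_inverse)

lemma increment_invariant:
  assumes "g \<in> carrier G"
  shows "\<rho> g (J X) - J (Adj g X) \<in> invariants act"
  using kappa_invariant[OF assms, of "Adj g X"] assms by (simp add: kappa_eq Ad_inverse)

text \<open>The invariant vector $g.J(X) - J(\mathrm{Ad}(g)X)$ is fixed by $g^{-1}$, which turns it into
  $J(X) - g^{-1}.J(\mathrm{Ad}(g)X) = -\kappa(g^{-1})(X)$.\<close>

lemma Ad_hat_inverse_form:
  assumes g: "g \<in> carrier G"
  shows "Adh g (v, X) = (v - \<kappa> (inv g) X, Adj g X)"
proof -
  have "\<rho> (inv g) (\<rho> g (J X) - J (Adj g X)) = \<rho> g (J X) - J (Adj g X)"
    using g by (intro rho_invariant increment_invariant) auto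
  moreover have "\<rho> (inv g) (\<rho> g (J X) - J (Adj g X)) = J X - \<rho> (inv g) (J (Adj g X))"
    using g by (simp add: linear_diff[OF rho_linear] rho_mult[symmetric] rho_one)
  ultimately show ?thesis using g by (simp add: Ad_hat_eq kappa_eq)
qed

lemma subspace_cen_ext: "subspace (cen_ext act :: ('v \<times> 'g) set)"
  unfolding cen_ext_def by (intro subspace_Times subspace_invariants subspace_UNIV)

lemma closed_cen_ext: "closed (cen_ext act :: ('v \<times> 'g) set)"
  unfolding cen_ext_def by (intro closed_Times closed_invariants closed_UNIV)

lemma Ad_hat_closed:
  assumes "g \<in> carrier G" "p \<in> cen_ext act"
  shows "Adh g p \<in> cen_ext act"
  using assms increment_invariant[OF assms(1)] subspace_add[OF subspace_invariants]
  by (cases p) (auto simp: cen_ext_def Ad_hat_eq)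

lemma Ad_hat_one: "Adh \<one> p = p"
  by (cases p) (simp add: Ad_hat_eq rho_one Ad_one)

text \<open>The cocycle identity for $\kappa$, in which \<open>g\<close> fixes the invariant vector belonging to \<open>h\<close>.\<close>

lemma Ad_hat_mult:
  assumes g: "g \<in> carrier G" and h: "h \<in> carrier G"
  shows "Adh (g \<otimes> h) p = Adh g (Adh h p)"
proof -
  obtain v X where p: "p = (v, X)" by (cases p)
  have "\<rho> g (\<rho> h (J X) - J (Adj h X)) = \<rho> h (J X) - J (Adj h X)"
    by (rule rho_invariant[OF increment_invariant[OF h] g])
  then have "\<rho> g (\<rho> h (J X)) = \<rho> g (J (Adj h X)) + (\<rho> h (J X) - J (Adj h X))"
    by (simp add: linear_diff[OF rho_linear[OF g]] algebra_simps)
  then show ?thesis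
    using g h by (simp add: p Ad_hat_eq rho_mult Ad_mult algebra_simps)
qed

lemma Ad_hat_linear:
  assumes g: "g \<in> carrier G"
  shows "Adh g (a *\<^sub>R p + b *\<^sub>R q) = a *\<^sub>R Adh g p + b *\<^sub>R Adh g q"
proof -
  note l = linear_add[OF rho_linear[OF g]] linear_scale[OF rho_linear[OF g]] linear_add[OF Ad_linear[OF g]]
    linear_scale[OF Ad_linear[OF g]] linear_add[OF J_linear] linear_scale[OF J_linear]
  obtain v X w Y where "p = (v, X)" "q = (w, Y)" by (cases p; cases q)
  then show ?thesis by (simp add: Ad_hat_eq g l algebra_simps)
qed

text \<open>Smoothness on the full space $V \times \mathfrak g$, from that of $\mathrm{Ad}$ and of the action
  on $V$.\<close>

lemma smooth_Ad_hat_chart: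
  assumes c: "(U, \<phi>) \<in> atlas M"
  shows "smooth (\<phi> ` U \<times> UNIV) (\<lambda>z. Adh (chart_inv (U, \<phi>) (fst z)) (snd z))"
proof -
  let ?i = "chart_inv (U, \<phi>)" and ?V = "\<phi> ` U \<times> (UNIV :: ('v \<times> 'g) set)"
  have o: "open ?V" using chartedD(2)[OF charted_M c] by (simp add: open_Times)
  note oo = chartedD(2)[OF charted_M c]
  have z: "smooth ?V (\<lambda>z. z)" by (rule smooth_id[OF o])
  note x = smooth_fst[OF o z]
  note v = smooth_fst[OF o smooth_snd[OF o z]]
  note X = smooth_snd[OF o smooth_snd[OF o z]]
  have A: "smooth ?V (\<lambda>z. Adj (?i (fst z)) (snd (snd z)))"
    using smooth_compose[OF smooth_Ad[OF c] _ smooth_Pair[OF x X o] o] oo by (auto simp: open_Times)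
  have R: "smooth ?V (\<lambda>z. \<rho> (?i (fst z)) (J (snd (snd z))))"
    using smooth_compose[OF smooth_rho[OF c] _ smooth_Pair[OF x smooth_linear_comp[OF o J_linear J_continuous X] o] o] oo
    by (auto simp: open_Times)
  have "smooth ?V (\<lambda>z. (fst (snd z) + (\<rho> (?i (fst z)) (J (snd (snd z))) - J (Adj (?i (fst z)) (snd (snd z)))),
      Adj (?i (fst z)) (snd (snd z))))"
    by (intro smooth_Pair smooth_add smooth_diff v R A o smooth_linear_comp[OF o J_linear J_continuous A])
  then show ?thesis
  proof (rule smooth_cong[OF _ o])
    fix z assume "z \<in> ?V"
    then have "?i (fst z) \<in> carrier G" using chart_inv_carrier[OF c] by auto
    from Ad_hat_eq[OF this, of "fst (snd z)" "snd (snd z)"]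
    show "Adh (?i (fst z)) (snd z) = (fst (snd z) + (\<rho> (?i (fst z)) (J (snd (snd z))) - J (Adj (?i (fst z)) (snd (snd z)))),
      Adj (?i (fst z)) (snd (snd z)))" by simp
  qed
qed

text \<open>Continuity is local on the group and there it is continuity of the chart representation.\<close>

lemma continuous_Ad_hat:
  "continuous_map (prod_topology (mtop M) (top_of_set (cen_ext act))) (top_of_set (cen_ext act)) (\<lambda>(g, p). Adh g p)"
proof (rule pasting_lemma[where I="atlas M" and T="\<lambda>c. fst c \<times> cen_ext act" and f="\<lambda>c (g, p). Adh g p"])
  let ?E = "cen_ext act :: ('v \<times> 'g) set"
  fix c assume c: "c \<in> atlas M"
  obtain U \<phi> where cU: "c = (U, \<phi>)" by (cases c)
  note c' = c[unfolded cU]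
  let ?i = "chart_inv (U, \<phi>)"
  show "openin (prod_topology (mtop M) (top_of_set ?E)) (fst c \<times> ?E)"
    using chartedD(1)[OF charted_M c'] cU by (simp add: openin_prod_Times_iff)
  have "continuous_map (prod_topology (subtopology (mtop M) U) (top_of_set ?E))
      (prod_topology (top_of_set (\<phi> ` U)) (top_of_set ?E)) (\<lambda>(g, p). (\<phi> g, id p))"
    unfolding continuous_map_prod_top
    using homeomorphic_imp_continuous_map[OF chartedD(3)[OF charted_M c']] by simp
  moreover have "continuous_map (prod_topology (top_of_set (\<phi> ` U)) (top_of_set ?E)) (top_of_set ?E)
      (\<lambda>z. Adh (?i (fst z)) (snd z))"
    unfolding prod_topology_subtopology_eu
  proof (rule continuous_map_into_subtopology)
    show "continuous_map (top_of_set (\<phi> ` U \<times> ?E)) euclidean (\<lambda>z. Adh (?i (fst z)) (snd z))"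
      using continuous_on_subset[OF smooth_imp_continuous_on[OF smooth_Ad_hat_chart[OF c']], of "\<phi> ` U \<times> ?E"]
      by auto
    show "(\<lambda>z. Adh (?i (fst z)) (snd z)) \<in> topspace (top_of_set (\<phi> ` U \<times> ?E)) \<rightarrow> ?E"
      using chart_inv_carrier[OF c'] by (auto intro!: Ad_hat_closed)
  qed
  ultimately have "continuous_map (prod_topology (subtopology (mtop M) U) (top_of_set ?E)) (top_of_set ?E)
      ((\<lambda>z. Adh (?i (fst z)) (snd z)) \<circ> (\<lambda>(g, p). (\<phi> g, id p)))"
    by (rule continuous_map_compose)
  then have "continuous_map (prod_topology (subtopology (mtop M) U) (top_of_set ?E)) (top_of_set ?E) (\<lambda>(g, p). Adh g p)"
    by (rule continuous_map_eq) (auto simp: chart_inv_left[OF charted_M c'])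
  then show "continuous_map (subtopology (prod_topology (mtop M) (top_of_set ?E)) (fst c \<times> ?E))
     (top_of_set ?E) (\<lambda>(g, p). Adh g p)"
    by (simp add: cU subtopology_Times subtopology_subtopology)
next
  fix z assume z: "z \<in> topspace (prod_topology (mtop M) (top_of_set (cen_ext act :: ('v \<times> 'g) set)))"
  then have "fst z \<in> topspace (mtop M)" by auto
  then obtain U \<phi> where "(U, \<phi>) \<in> atlas M" "fst z \<in> U" by (rule charted_cover[OF charted_M])
  with z show "\<exists>j. j \<in> atlas M \<and> z \<in> fst j \<times> cen_ext act \<and> (case z of (g, p) \<Rightarrow> Adh g p) = (case z of (g, p) \<Rightarrow> Adh g p)"
    by (intro exI[of _ "(U, \<phi>)"]) auto
qed auto

lemma smooth_map_Ad_hat: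
  "smooth_map (prod_mfd M (vec_mfd (cen_ext act))) (vec_mfd (cen_ext act)) (\<lambda>(g, p). Adh g p)"
  unfolding smooth_map_def
proof (intro conjI ballI)
  show "continuous_map (mtop (prod_mfd M (vec_mfd (cen_ext act)))) (mtop (vec_mfd (cen_ext act))) (\<lambda>(g, p). Adh g p)"
    using continuous_Ad_hat by (simp add: prod_mfd_simps vec_mfd_simps)
next
  let ?E = "cen_ext act :: ('v \<times> 'g) set"
  fix C assume "C \<in> atlas (prod_mfd M (vec_mfd ?E))"
  then obtain U \<phi> where c: "(U, \<phi>) \<in> atlas M" and C: "C = (U \<times> ?E, map_prod \<phi> id)"
    by (auto simp: prod_mfd_simps vec_mfd_simps)
  let ?i = "chart_inv (U, \<phi>)"
  have inv: "chart_inv C (x, y) = (?i x, y)" if "x \<in> \<phi> ` U" "y \<in> ?E" for x y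
    unfolding C chart_inv_def fst_conv snd_conv
  proof (rule inv_into_f_eq)
    show "inj_on (map_prod \<phi> id) (U \<times> ?E)"
      using chart_inj[OF charted_M c] by (auto simp: inj_on_def)
    show "(inv_into U \<phi> x, y) \<in> U \<times> ?E" using that by (simp add: inv_into_into)
    show "map_prod \<phi> id (inv_into U \<phi> x, y) = (x, y)" using that by (simp add: f_inv_into_f)
  qed
  have dom: "map_prod \<phi> id ` {p \<in> U \<times> ?E. (case p of (g, p) \<Rightarrow> Adh g p) \<in> ?E} = (\<phi> ` U \<times> UNIV) \<inter> (UNIV \<times> ?E)"
  proof -
    have "{p \<in> U \<times> ?E. (case p of (g, p) \<Rightarrow> Adh g p) \<in> ?E} = U \<times> ?E"
      using chart_carrier[OF c] by (auto intro!: Ad_hat_closed)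
    then show ?thesis by (auto simp: map_prod_image)
  qed
  have o: "open (\<phi> ` U \<times> (UNIV :: ('v \<times> 'g) set))" using chartedD(2)[OF charted_M c] by (simp add: open_Times)
  have "smooth_on (UNIV \<times> ?E) ?E ((\<phi> ` U \<times> UNIV) \<inter> (UNIV \<times> ?E)) (id \<circ> (\<lambda>(g, p). Adh g p) \<circ> chart_inv C)"
  proof (rule smooth_on_restrict[OF smooth_Ad_hat_chart[OF c] o _ subspace_cen_ext closed_cen_ext])
    show "subspace (UNIV \<times> ?E)" by (intro subspace_Times subspace_UNIV subspace_cen_ext)
    fix z assume z: "z \<in> \<phi> ` U \<times> (UNIV :: ('v \<times> 'g) set)" "z \<in> UNIV \<times> ?E"
    then have "?i (fst z) \<in> carrier G" "snd z \<in> ?E" using chart_inv_carrier[OF c] by auto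
    then show "(id \<circ> (\<lambda>(g, p). Adh g p) \<circ> chart_inv C) z = Adh (?i (fst z)) (snd z) \<and>
        Adh (?i (fst z)) (snd z) \<in> ?E"
      using inv[of "fst z" "snd z"] z Ad_hat_closed by auto
  qed
  then show "case C of (U, \<phi>) \<Rightarrow> \<forall>(W, \<psi>)\<in>atlas (vec_mfd ?E).
      smooth_on (model (prod_mfd M (vec_mfd ?E))) (model (vec_mfd ?E)) (\<phi> ` {p \<in> U. (case p of (g, p) \<Rightarrow> Adh g p) \<in> W})
        (\<psi> \<circ> (\<lambda>(g, p). Adh g p) \<circ> chart_inv (U, \<phi>))"
    using dom by (simp add: C vec_mfd_simps prod_mfd_simps model_M)
qed

lemma Ad_hat_action: "smooth_linear_action G M (cen_ext act) Adh"
  unfolding smooth_linear_action_def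
  using Ad_hat_closed Ad_hat_one Ad_hat_mult Ad_hat_linear smooth_map_Ad_hat by simp

lemma Ad_hat_derived: "derived_action G (U0, \<phi>0) (cen_ext act) Adh (ad_hat bracket \<tau>)"
  unfolding derived_action_def
proof (intro allI ballI)
  fix X and p :: "'v \<times> 'g"
  obtain v Y where p: "p = (v, Y)" by (cases p)
  have "has_dirderiv (\<lambda>x. J (Adj (\<iota> x) Y)) e X (J (bracket X Y))"
    by (rule has_dirderiv_linear[OF J_linear J_continuous dirderiv_Ad])
  then have "has_dirderiv (\<lambda>x. (v + (\<rho> (\<iota> x) (J Y) - J (Adj (\<iota> x) Y)), Adj (\<iota> x) Y)) e X
      (0 + (act (\<zeta> X) (J Y) - J (bracket X Y)), bracket X Y)"
    by (intro has_dirderiv_Pair has_dirderiv_add has_dirderiv_diff has_dirderiv_const rho_derived dirderiv_Ad)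
  then have "has_dirderiv (\<lambda>x. Adh (\<iota> x) (v, Y)) e X
      (0 + (act (\<zeta> X) (J Y) - J (bracket X Y)), bracket X Y)"
    by (rule has_dirderiv_transform[OF _ open_chart0 e_in]) (simp add: Ad_hat_eq)
  then show "has_dirderiv (\<lambda>x. Adh (\<iota> x) p) (snd (U0, \<phi>0) \<one>) X (ad_hat bracket \<tau> X p)"
    by (simp add: p ad_hat_def cen_bracket_def mom_cocycle_def)
qed

lemma J_hat_momentum: "momentum_map br act \<omega> (cen_ext act) (\<lambda>p. \<zeta> (snd p)) (J_hat J)"
  unfolding momentum_map_def
proof (intro conjI ballI allI)
  show "J_hat J (a *\<^sub>R p + b *\<^sub>R q) = a *\<^sub>R J_hat J p + b *\<^sub>R J_hat J q" for a b and p q :: "'v \<times> 'g"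
    by (cases p; cases q) (simp add: J_hat_def linear_add[OF J_linear] linear_scale[OF J_linear] algebra_simps)
  have "continuous_on (cen_ext act) (\<lambda>p. J (snd p) + fst p)"
    by (intro continuous_on_add continuous_on_fst continuous_on_id continuous_on_compose2[OF J_continuous]
        continuous_on_snd) auto
  then show "continuous_on (cen_ext act) (J_hat J)" by (simp add: J_hat_def[abs_def] case_prod_unfold)
  fix p :: "'v \<times> 'g" assume p: "p \<in> cen_ext act"
  have d: "d0 act (J_hat J p) = d0 act (J (snd p))"
    using p by (auto simp: d0_def J_hat_def cen_ext_def invariants_def linear_add[OF act_linear] fun_eq_iff)
  then show "J_hat J p \<in> ham_fun br act \<omega>" using J_ham[of "snd p"] by (simp add: ham_fun_def)
  show "d0 act (J_hat J p) = \<omega> (\<zeta> (snd p))" unfolding d by (simp add: d0_def J_momentum)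
qed

lemma J_hat_equivariant:
  assumes g: "g \<in> carrier G" and p: "p \<in> cen_ext act"
  shows "J_hat J (Adh g p) = \<rho> g (J_hat J p)"
proof -
  obtain v X where vX: "p = (v, X)" and v: "v \<in> invariants act" using p by (auto simp: cen_ext_def)
  show ?thesis
    using rho_invariant[OF v g] by (simp add: vX J_hat_def Ad_hat_eq g linear_add[OF rho_linear[OF g]])
qed

end

theorem proposition2p11:
  fixes br :: "'h::real_tvs \<Rightarrow> 'h \<Rightarrow> 'h"
    and act :: "'h \<Rightarrow> 'v::locally_convex_space \<Rightarrow> 'v"
    and \<omega> :: "'h \<Rightarrow> 'h \<Rightarrow> 'v"
    and G :: "('p, 'm) monoid_scheme"
    and M :: "('p, 'g::locally_convex_space) mfd"
    and c :: "'p set \<times> ('p \<Rightarrow> 'g)"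
    and \<zeta> :: "'g \<Rightarrow> 'h"
    and J :: "'g \<Rightarrow> 'v"
    and \<rho> :: "'p \<Rightarrow> 'v \<Rightarrow> 'v"
  assumes "topological_lie_algebra br"
    and "topological_module br act"
    and "cochain2 \<omega>"
    and "lie_group G M"
    and "connected_space (mtop M)"
    and "chart_at_one G M c"
    and "ham_hom (lie_bracket G c) br act \<omega> \<zeta>"
    and "momentum_map br act \<omega> UNIV \<zeta> J"
    and "abstract_hamiltonian_action G M c act \<zeta> \<rho>"
  shows "smooth_linear_action G M (cen_ext act) (Ad_hat G c \<rho> J) \<and>
         derived_action G c (cen_ext act) (Ad_hat G c \<rho> J)
           (ad_hat (lie_bracket G c) (mom_cocycle (lie_bracket G c) act \<zeta> J)) \<and>
         (\<forall>g\<in>carrier G. \<forall>(v, X)\<in>cen_ext act.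
           Ad_hat G c \<rho> J g (v, X) = (v - kappa G c \<rho> J (inv\<^bsub>G\<^esub> g) X, Ad G c g X)) \<and>
         momentum_map br act \<omega> (cen_ext act) (\<lambda>p. \<zeta> (snd p)) (J_hat J) \<and>
         (\<forall>g\<in>carrier G. \<forall>p\<in>cen_ext act.
           J_hat J (Ad_hat G c \<rho> J g p) = \<rho> g (J_hat J p))"
proof -
  obtain U0 \<phi>0 where c: "c = (U0, \<phi>0)" by (cases c)
  interpret hamiltonian_action G M U0 \<phi>0 br act \<omega> \<zeta> J \<rho>
    using assms unfolding c by unfold_locales
  show ?thesis
    unfolding c
    by (intro conjI Ad_hat_action Ad_hat_derived J_hat_momentum)
       (auto simp: Ad_hat_inverse_form J_hat_equivariant)
qed

end
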